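(* Let $\mathfrak h\in\mathcal H^1(\mathcal X)$ and let $\mathfrak b\in \mathrm{BMO}(\mathcal X)$ (a function, not a class modulo constants). Then the product $\mathfrak b\times\mathfrak h$ can be given a meaning in the sense of distributions. That is, whenever $\mathfrak h=\sum_{i\ge1}\lambda_i\mathfrak a_i$ (in the sense of distributions) with $\sum_{i\ge 1}|\lambda_i|<\infty$ and each $\mathfrak a_i$ a $(1,q)$-atom supported in a ball $B_i$, where $q\in(1,\infty]$, the two series $\sum_{i\ge1}\lambda_i(\mathfrak b-\mathfrak b_{B_i})\mathfrak a_i$ and $\sum_{i\ge1}\lambda_i\mathfrak b_{B_i}\mathfrak a_i$ converge in the sense of distributions, and one puts $$\mathfrak b\times\mathfrak h:=\sum_{i\ge1}\lambda_i(\mathfrak b-\mathfrak b_{B_i})\mathfrak a_i+\sum_{i\ge1}\lambda_i\mathfrak b_{B_i}\mathfrak a_i .$$ Moreover, if $x_0$ is a fixed element of $\mathcal X$, then $$\mathfrak b\times\mathfrak h\in L^1(\mathcal X,\mu)+\mathcal H^{\wp}(\mathcal X,\nu),\qquad\text{where } d\nu(x)=\frac{d\mu(x)}{\log(e+d(x_0,x))}.$$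
   Context: Setting. $d$ is a quasimetric on $\mathcal X$: $d(x,y)=0$ iff $x=y$, $d(x,y)=d(y,x)$, and $d(x,y)\le K_0(d(x,z)+d(z,y))$ for a constant $K_0\ge1$. Balls are $B(x,r)=\{y\in\mathcal X:d(x,y)<r\}$, $r>0$; $r(B)$ is the radius of the ball $B$. $\mu$ is a positive Borel measure with all balls of finite positive measure and doubling: $\mu(B(x,2r))\le C_0\mu(B(x,r))$ for all $x,r$, $C_0$ being the smallest such constant; $\mathtt n=\log_2C_0$. All annuli are nonempty: $B(x,R)\setminus B(x,r)\ne\emptyset$ for all $x$ and $0<r<R<\infty$, and reverse doubling holds: there are constants $\kappa,c_\mu>0$ with $\mu(B)/\mu(\tilde B)\ge c_\mu (r(B)/r(\tilde B))^{\kappa}$ for all balls $\tilde B\subset B$. There is a positive nondecreasing function $\varphi$ on $[0,\infty)$ with $\mu(B(x,r))\sim\varphi(r)$ (two-sided bounds with constants independent of $x,r$). There are $A_0'>0$ and $0<\theta\le1$ with $|d(x,z)-d(y,z)|\le A_0'd(x,y)^\theta[d(x,z)+d(y,z)]^{1-\theta}$ for all $x,y,z$. Test functions and distributions. For $x_1\in\mathcal X$, $r>0$, $0<\beta\le1$, $\gamma>0$, $\mathcal G(x_1,r,\beta,\gamma)$ is the space of complex functions $\phi$ on $\mathcal X$ such that for some constant $C$: (i) $|\phi(x)|\le C\frac{1}{\mu(B(x,r+d(x,x_1)))}\left(\frac{r}{r+d(x_1,x)}\right)^\gamma$ for all $x$; (ii) $|\phi(x)-\phi(y)|\le C\left(\frac{d(x,y)}{r+d(x_1,x)}\right)^\beta\frac{1}{\mu(B(x,r+d(x,x_1)))}\left(\frac{r}{r+d(x_1,x)}\right)^\gamma$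 whenever $d(x,y)\le\frac{r+d(x_1,x)}{2K_0}$; normed by the infimum of such $C$. Fix $x_0\in\mathcal X$ and put $\mathcal G(\beta,\gamma)=\mathcal G(x_0,1,\beta,\gamma)$. Fix $\epsilon\in(0,\theta]$ and $0<\beta,\gamma<\epsilon$. $\mathcal G_0^\epsilon(\beta,\gamma)$ is the completion (closure) of $\mathcal G(\epsilon,\epsilon)$ in $\mathcal G(\beta,\gamma)$ with the norm of $\mathcal G(\beta,\gamma)$. Distributions are the elements of the dual $(\mathcal G_0^\epsilon(\beta,\gamma))'$; functions act by integration against $\mu$. The grand maximal function of a distribution $f$ is $$f^*(x)=\sup\{|\langle f,\phi\rangle|:\phi\in\mathcal G_0^\epsilon(\beta,\gamma),\ \|\phi\|_{\mathcal G(x,r,\beta,\gamma)}\le1\text{ for some }r>0\}.$$ Spaces. $\mathcal H^1(\mathcal X)$ is the set of distributions $f$ with $f^*\in L^1(\mathcal X,\mu)$. With $\wp(t)=t/\log(e+t)$, for a measure $\nu$ on $\mathcal X$, $L^\wp(\mathcal X,\nu)$ is the set of measurable $f$ with $\|f\|_{L^\wp(\mathcal X,\nu)}=\inf\{k>0:\int_{\mathcal X}\wp(k^{-1}|f|)\,d\nu\le1\}<\infty$, and $\mathcal H^\wp(\mathcal X,\nu)$ is the set of distributions $f$ with $f^*\in L^\wp(\mathcal X,\nu)$. $\mathrm{BMO}(\mathcal X)$ is the set of locally integrable $\mathfrak b$ with $\|\mathfrak b\|_{\mathrm{BMO}(\mathcal X)}=\sup_B\frac1{\mu(B)}\int_B|\mathfrak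 b-\mathfrak b_B|\,d\mu<\infty$ (sup over all balls), $\mathfrak b_B=\frac1{\mu(B)}\int_B\mathfrak b\,d\mu$. Atoms. For $q\in(1,\infty]$, a $(1,q)$-atom supported in a ball $B$ is a function $\mathfrak a\in L^q(\mathcal X,\mu)$ supported in $B$ with $\|\mathfrak a\|_{L^q}\le\mu(B)^{\frac1q-1}$ (with $1/q=0$ if $q=\infty$) and $\int\mathfrak a\,d\mu=0$. It is known that, for each $q\in(1,\infty]$, a distribution $\mathfrak h$ lies in $\mathcal H^1(\mathcal X)$ iff it has a decomposition $\mathfrak h=\sum\lambda_i\mathfrak a_i$ into $(1,q)$-atoms with $\sum|\lambda_i|<\infty$, converging in the sense of distributions. *)

theory Defs
  imports "HOL-Analysis.Analysis" "HOL-Probability.Essential_Supremum"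
begin

section \<open>The underlying spaces\<close>

definition qball :: "('a \<Rightarrow> 'a \<Rightarrow> real) \<Rightarrow> 'a \<Rightarrow> real \<Rightarrow> 'a set" where
  "qball d x r = {y. d x y < r}"

definition qballs :: "('a \<Rightarrow> 'a \<Rightarrow> real) \<Rightarrow> 'a set set" where
  "qballs d = {qball d x r | x r. 0 < r}"

definition qopen :: "('a \<Rightarrow> 'a \<Rightarrow> real) \<Rightarrow> 'a set \<Rightarrow> bool" where
  "qopen d U \<longleftrightarrow> (\<forall>x\<in>U. \<exists>r>0. qball d x r \<subseteq> U)"

text \<open>
  The space is the whole type. The parameters that later notions depend on (the quasimetric, the
  measure, its quasi-triangle constant and the regularity exponent) are fixed; all other constants
  are existentially quantified. In \<open>reverse_doubling\<close> a ball is a pair of a centre and a radius.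
  In \<open>homogeneous\<close> the function \<open>V\<close> is required to be strictly positive only on
  \<open>(0,\<infinity>)\<close>: the reverse doubling condition forces the measure of a ball to tend to \<open>0\<close> with its
  radius, so that \<open>V 0 > 0\<close> would make the axioms contradictory.
\<close>

locale rd_space =
  fixes d :: "'a \<Rightarrow> 'a \<Rightarrow> real" and M :: "'a measure" and K\<^sub>0 \<theta> :: real
  assumes K0_ge_1: "1 \<le> K\<^sub>0"
    and dist_nonneg: "0 \<le> d x y"
    and dist_eq_0_iff: "d x y = 0 \<longleftrightarrow> x = y"
    and dist_commute: "d x y = d y x"
    and quasi_triangle: "d x y \<le> K\<^sub>0 * (d x z + d z y)"
    and theta: "0 < \<theta>" "\<theta> \<le> 1"
    and regularity:
      "\<exists>A>0. \<forall>x y z. \<bar>d x z - d y z\<bar> \<le> A * d x y powr \<theta> * (d x z + d y z) powr (1 - \<theta>)"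
    and space_UNIV: "space M = UNIV"
    and sets_borel: "sets M = sigma_sets UNIV {U. qopen d U}"
    and ball_pos: "0 < r \<Longrightarrow> 0 < emeasure M (qball d x r)"
    and ball_finite: "0 < r \<Longrightarrow> emeasure M (qball d x r) < \<infinity>"
    and doubling:
      "\<exists>C. \<forall>x r. 0 < r \<longrightarrow> measure M (qball d x (2 * r)) \<le> C * measure M (qball d x r)"
    and annuli_nonempty: "0 < r \<Longrightarrow> r < R \<Longrightarrow> qball d x R - qball d x r \<noteq> {}"
    and reverse_doubling:
      "\<exists>\<kappa> c. 0 < \<kappa> \<and> 0 < c \<and>
         (\<forall>x y r s. 0 < r \<longrightarrow> 0 < s \<longrightarrow> qball d y s \<subseteq> qball d x r \<longrightarrow>
            measure M (qball d x r) / measure M (qball d y s) \<ge> c * (r / s) powr \<kappa>)"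
    and homogeneous:
      "\<exists>V :: real \<Rightarrow> real. mono_on {0..} V \<and> 0 \<le> V 0 \<and> (\<forall>r>0. 0 < V r) \<and>
         (\<exists>c\<^sub>1>0. \<exists>c\<^sub>2>0. \<forall>x r. 0 < r \<longrightarrow>
            c\<^sub>1 * V r \<le> measure M (qball d x r) \<and> measure M (qball d x r) \<le> c\<^sub>2 * V r)"

section \<open>Test functions and distributions\<close>

definition test_bound ::
  "('a \<Rightarrow> 'a \<Rightarrow> real) \<Rightarrow> 'a measure \<Rightarrow> real \<Rightarrow> 'a \<Rightarrow> real \<Rightarrow> real \<Rightarrow> real \<Rightarrow>
   ('a \<Rightarrow> complex) \<Rightarrow> real \<Rightarrow> bool" where
  "test_bound d M K\<^sub>0 x\<^sub>1 r \<beta> \<gamma> \<phi> C \<longleftrightarrow>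
     (\<forall>x. cmod (\<phi> x) \<le>
        C * (1 / measure M (qball d x (r + d x x\<^sub>1))) * (r / (r + d x\<^sub>1 x)) powr \<gamma>) \<and>
     (\<forall>x y. d x y \<le> (r + d x\<^sub>1 x) / (2 * K\<^sub>0) \<longrightarrow>
        cmod (\<phi> x - \<phi> y) \<le>
          C * (d x y / (r + d x\<^sub>1 x)) powr \<beta>
            * (1 / measure M (qball d x (r + d x x\<^sub>1))) * (r / (r + d x\<^sub>1 x)) powr \<gamma>)"

definition test_space ::
  "('a \<Rightarrow> 'a \<Rightarrow> real) \<Rightarrow> 'a measure \<Rightarrow> real \<Rightarrow> 'a \<Rightarrow> real \<Rightarrow> real \<Rightarrow> real \<Rightarrow>
   ('a \<Rightarrow> complex) set" where
  "test_space d M K\<^sub>0 x\<^sub>1 r \<beta> \<gamma> = {\<phi>. \<exists>C. test_bound d M K\<^sub>0 x\<^sub>1 r \<beta> \<gamma> \<phi> C}"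

text \<open>The norm is meaningful only on \<open>test_space\<close>.\<close>

definition test_norm ::
  "('a \<Rightarrow> 'a \<Rightarrow> real) \<Rightarrow> 'a measure \<Rightarrow> real \<Rightarrow> 'a \<Rightarrow> real \<Rightarrow> real \<Rightarrow> real \<Rightarrow>
   ('a \<Rightarrow> complex) \<Rightarrow> real" where
  "test_norm d M K\<^sub>0 x\<^sub>1 r \<beta> \<gamma> \<phi> = Inf {C. test_bound d M K\<^sub>0 x\<^sub>1 r \<beta> \<gamma> \<phi> C}"

text \<open>
  The closure of \<open>\<G>(\<epsilon>,\<epsilon>)\<close> in \<open>\<G>(\<beta>,\<gamma>)\<close>, where \<open>\<G>(\<beta>,\<gamma>)\<close> is based at
  \<open>x\<^sub>0\<close> with \<open>r = 1\<close>.
\<close>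

definition test_closure ::
  "('a \<Rightarrow> 'a \<Rightarrow> real) \<Rightarrow> 'a measure \<Rightarrow> real \<Rightarrow> 'a \<Rightarrow> real \<Rightarrow> real \<Rightarrow> real \<Rightarrow>
   ('a \<Rightarrow> complex) set" where
  "test_closure d M K\<^sub>0 x\<^sub>0 \<epsilon> \<beta> \<gamma> =
     {\<phi> \<in> test_space d M K\<^sub>0 x\<^sub>0 1 \<beta> \<gamma>. \<forall>\<delta>>0.
        \<exists>\<psi> \<in> test_space d M K\<^sub>0 x\<^sub>0 1 \<epsilon> \<epsilon> \<inter> test_space d M K\<^sub>0 x\<^sub>0 1 \<beta> \<gamma>.
          test_norm d M K\<^sub>0 x\<^sub>0 1 \<beta> \<gamma> (\<lambda>x. \<phi> x - \<psi> x) < \<delta>}"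

text \<open>
  Distributions are bounded complex-linear functionals on \<open>test_closure\<close>. They are represented by
  total functions whose values off \<open>test_closure\<close> are irrelevant; equality of distributions is
  therefore always stated pointwise on \<open>test_closure\<close>.
\<close>

definition distributions ::
  "('a \<Rightarrow> 'a \<Rightarrow> real) \<Rightarrow> 'a measure \<Rightarrow> real \<Rightarrow> 'a \<Rightarrow> real \<Rightarrow> real \<Rightarrow> real \<Rightarrow>
   (('a \<Rightarrow> complex) \<Rightarrow> complex) set" where
  "distributions d M K\<^sub>0 x\<^sub>0 \<epsilon> \<beta> \<gamma> =
     {f. (\<forall>\<phi> \<in> test_closure d M K\<^sub>0 x\<^sub>0 \<epsilon> \<beta> \<gamma>. \<forall>\<psi> \<in> test_closure d M K\<^sub>0 x\<^sub>0 \<epsilon> \<beta> \<gamma>.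
            f (\<lambda>x. \<phi> x + \<psi> x) = f \<phi> + f \<psi>) \<and>
         (\<forall>c. \<forall>\<phi> \<in> test_closure d M K\<^sub>0 x\<^sub>0 \<epsilon> \<beta> \<gamma>. f (\<lambda>x. c * \<phi> x) = c * f \<phi>) \<and>
         (\<exists>C. \<forall>\<phi> \<in> test_closure d M K\<^sub>0 x\<^sub>0 \<epsilon> \<beta> \<gamma>.
            cmod (f \<phi>) \<le> C * test_norm d M K\<^sub>0 x\<^sub>0 1 \<beta> \<gamma> \<phi>)}"

definition fun_distr :: "'a measure \<Rightarrow> ('a \<Rightarrow> complex) \<Rightarrow> ('a \<Rightarrow> complex) \<Rightarrow> complex" where
  "fun_distr M g \<phi> = (LINT x|M. g x * \<phi> x)"

text \<open>
  The integrability clause is needed because the Bochner integral of a non-integrable function is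
  \<open>0\<close> by convention.
\<close>

definition acts_as_distribution ::
  "('a \<Rightarrow> 'a \<Rightarrow> real) \<Rightarrow> 'a measure \<Rightarrow> real \<Rightarrow> 'a \<Rightarrow> real \<Rightarrow> real \<Rightarrow> real \<Rightarrow>
   ('a \<Rightarrow> complex) \<Rightarrow> bool" where
  "acts_as_distribution d M K\<^sub>0 x\<^sub>0 \<epsilon> \<beta> \<gamma> g \<longleftrightarrow>
     (\<forall>\<phi> \<in> test_closure d M K\<^sub>0 x\<^sub>0 \<epsilon> \<beta> \<gamma>. integrable M (\<lambda>x. g x * \<phi> x)) \<and>
     fun_distr M g \<in> distributions d M K\<^sub>0 x\<^sub>0 \<epsilon> \<beta> \<gamma>"

text \<open>Convergence of a series of functions to \<open>S\<close> in the sense of distributions.\<close>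

definition distr_sums ::
  "('a \<Rightarrow> 'a \<Rightarrow> real) \<Rightarrow> 'a measure \<Rightarrow> real \<Rightarrow> 'a \<Rightarrow> real \<Rightarrow> real \<Rightarrow> real \<Rightarrow>
   (nat \<Rightarrow> 'a \<Rightarrow> complex) \<Rightarrow> (('a \<Rightarrow> complex) \<Rightarrow> complex) \<Rightarrow> bool" where
  "distr_sums d M K\<^sub>0 x\<^sub>0 \<epsilon> \<beta> \<gamma> g S \<longleftrightarrow>
     (\<forall>i. acts_as_distribution d M K\<^sub>0 x\<^sub>0 \<epsilon> \<beta> \<gamma> (g i)) \<and>
     S \<in> distributions d M K\<^sub>0 x\<^sub>0 \<epsilon> \<beta> \<gamma> \<and>
     (\<forall>\<phi> \<in> test_closure d M K\<^sub>0 x\<^sub>0 \<epsilon> \<beta> \<gamma>. (\<lambda>i. fun_distr M (g i) \<phi>) sums S \<phi>)"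

definition grand_maximal ::
  "('a \<Rightarrow> 'a \<Rightarrow> real) \<Rightarrow> 'a measure \<Rightarrow> real \<Rightarrow> 'a \<Rightarrow> real \<Rightarrow> real \<Rightarrow> real \<Rightarrow>
   (('a \<Rightarrow> complex) \<Rightarrow> complex) \<Rightarrow> 'a \<Rightarrow> ennreal" where
  "grand_maximal d M K\<^sub>0 x\<^sub>0 \<epsilon> \<beta> \<gamma> f x =
     (SUP \<phi> \<in> {\<phi> \<in> test_closure d M K\<^sub>0 x\<^sub>0 \<epsilon> \<beta> \<gamma>. \<exists>r>0.
                 \<phi> \<in> test_space d M K\<^sub>0 x r \<beta> \<gamma> \<and> test_norm d M K\<^sub>0 x r \<beta> \<gamma> \<phi> \<le> 1}.
        ennreal (cmod (f \<phi>)))"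

section \<open>Function spaces\<close>

definition hardy_1 ::
  "('a \<Rightarrow> 'a \<Rightarrow> real) \<Rightarrow> 'a measure \<Rightarrow> real \<Rightarrow> 'a \<Rightarrow> real \<Rightarrow> real \<Rightarrow> real \<Rightarrow>
   (('a \<Rightarrow> complex) \<Rightarrow> complex) set" where
  "hardy_1 d M K\<^sub>0 x\<^sub>0 \<epsilon> \<beta> \<gamma> =
     {f \<in> distributions d M K\<^sub>0 x\<^sub>0 \<epsilon> \<beta> \<gamma>.
        grand_maximal d M K\<^sub>0 x\<^sub>0 \<epsilon> \<beta> \<gamma> f \<in> borel_measurable M \<and>
        (\<integral>\<^sup>+ x. grand_maximal d M K\<^sub>0 x\<^sub>0 \<epsilon> \<beta> \<gamma> f x \<partial>M) < \<infinity>}"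

text \<open>The function \<open>t / log (e + t)\<close>, extended by \<open>\<infinity>\<close> at \<open>\<infinity>\<close>.\<close>

definition orlicz_wp :: "ennreal \<Rightarrow> ennreal" where
  "orlicz_wp t = (if t = \<infinity> then \<infinity> else ennreal (enn2real t / ln (exp 1 + enn2real t)))"

text \<open>
  The Luxemburg norm and the Orlicz space are only applied to grand maximal functions, hence are
  defined for functions with values in \<open>[0,\<infinity>]\<close>; the infimum of the empty set is \<open>\<infinity>\<close>.
\<close>

definition orlicz_norm :: "'a measure \<Rightarrow> ('a \<Rightarrow> ennreal) \<Rightarrow> ennreal" where
  "orlicz_norm N g =
     Inf {ennreal k | k. 0 < k \<and> (\<integral>\<^sup>+ x. orlicz_wp (g x / ennreal k) \<partial>N) \<le> 1}"

definition orlicz_space :: "'a measure \<Rightarrow> ('a \<Rightarrow> ennreal) set" where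
  "orlicz_space N = {g \<in> borel_measurable N. orlicz_norm N g < \<infinity>}"

definition hardy_orlicz ::
  "('a \<Rightarrow> 'a \<Rightarrow> real) \<Rightarrow> 'a measure \<Rightarrow> real \<Rightarrow> 'a \<Rightarrow> real \<Rightarrow> real \<Rightarrow> real \<Rightarrow> 'a measure \<Rightarrow>
   (('a \<Rightarrow> complex) \<Rightarrow> complex) set" where
  "hardy_orlicz d M K\<^sub>0 x\<^sub>0 \<epsilon> \<beta> \<gamma> N =
     {f \<in> distributions d M K\<^sub>0 x\<^sub>0 \<epsilon> \<beta> \<gamma>.
        grand_maximal d M K\<^sub>0 x\<^sub>0 \<epsilon> \<beta> \<gamma> f \<in> orlicz_space N}"

definition log_weighted :: "('a \<Rightarrow> 'a \<Rightarrow> real) \<Rightarrow> 'a measure \<Rightarrow> 'a \<Rightarrow> 'a measure" where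
  "log_weighted d M x\<^sub>0 = density M (\<lambda>x. ennreal (1 / ln (exp 1 + d x\<^sub>0 x)))"

text \<open>The algebraic sum \<open>L\<^sup>1(M) + \<H>\<^sup>\<wp>(N)\<close> inside the space of distributions.\<close>

definition L1_plus_hardy_orlicz ::
  "('a \<Rightarrow> 'a \<Rightarrow> real) \<Rightarrow> 'a measure \<Rightarrow> real \<Rightarrow> 'a \<Rightarrow> real \<Rightarrow> real \<Rightarrow> real \<Rightarrow> 'a measure \<Rightarrow>
   (('a \<Rightarrow> complex) \<Rightarrow> complex) set" where
  "L1_plus_hardy_orlicz d M K\<^sub>0 x\<^sub>0 \<epsilon> \<beta> \<gamma> N =
     {P \<in> distributions d M K\<^sub>0 x\<^sub>0 \<epsilon> \<beta> \<gamma>.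
        \<exists>g f. integrable M g \<and> acts_as_distribution d M K\<^sub>0 x\<^sub>0 \<epsilon> \<beta> \<gamma> g \<and>
          f \<in> hardy_orlicz d M K\<^sub>0 x\<^sub>0 \<epsilon> \<beta> \<gamma> N \<and>
          (\<forall>\<phi> \<in> test_closure d M K\<^sub>0 x\<^sub>0 \<epsilon> \<beta> \<gamma>. P \<phi> = fun_distr M g \<phi> + f \<phi>)}"

definition mean :: "'a measure \<Rightarrow> 'a set \<Rightarrow> ('a \<Rightarrow> complex) \<Rightarrow> complex" where
  "mean M B f = (LINT x:B|M. f x) / of_real (measure M B)"

definition BMO_norm :: "('a \<Rightarrow> 'a \<Rightarrow> real) \<Rightarrow> 'a measure \<Rightarrow> ('a \<Rightarrow> complex) \<Rightarrow> ennreal" where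
  "BMO_norm d M f =
     (SUP B \<in> qballs d. ennreal ((LINT x:B|M. cmod (f x - mean M B f)) / measure M B))"

definition BMO :: "('a \<Rightarrow> 'a \<Rightarrow> real) \<Rightarrow> 'a measure \<Rightarrow> ('a \<Rightarrow> complex) set" where
  "BMO d M = {f. (\<forall>B \<in> qballs d. set_integrable M B f) \<and> BMO_norm d M f < \<infinity>}"

section \<open>Atoms and the product\<close>

definition Lq_norm :: "'a measure \<Rightarrow> ereal \<Rightarrow> ('a \<Rightarrow> complex) \<Rightarrow> ereal" where
  "Lq_norm M q f =
     (if q = \<infinity> then esssup M (\<lambda>x. ereal (cmod (f x)))
      else if integrable M (\<lambda>x. cmod (f x) powr real_of_ereal q)
      then ereal ((LINT x|M. cmod (f x) powr real_of_ereal q) powr (1 / real_of_ereal q))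
      else \<infinity>)"

definition Lq_space :: "'a measure \<Rightarrow> ereal \<Rightarrow> ('a \<Rightarrow> complex) set" where
  "Lq_space M q = {f \<in> borel_measurable M. Lq_norm M q f < \<infinity>}"

text \<open>For \<open>q = \<infinity>\<close> one has \<open>1 / q = 0\<close> in \<open>ereal\<close>, as intended in the size condition.\<close>

definition atom :: "'a measure \<Rightarrow> ereal \<Rightarrow> 'a set \<Rightarrow> ('a \<Rightarrow> complex) \<Rightarrow> bool" where
  "atom M q B a \<longleftrightarrow>
     a \<in> Lq_space M q \<and> {x. a x \<noteq> 0} \<subseteq> B \<and>
     Lq_norm M q a \<le> ereal (measure M B powr (real_of_ereal (1 / q) - 1)) \<and>
     (LINT x|M. a x) = 0"

definition atomic_decomposition ::
  "('a \<Rightarrow> 'a \<Rightarrow> real) \<Rightarrow> 'a measure \<Rightarrow> real \<Rightarrow> 'a \<Rightarrow> real \<Rightarrow> real \<Rightarrow> real \<Rightarrow> ereal \<Rightarrow>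
   (nat \<Rightarrow> complex) \<Rightarrow> (nat \<Rightarrow> 'a \<Rightarrow> complex) \<Rightarrow> (nat \<Rightarrow> 'a set) \<Rightarrow>
   (('a \<Rightarrow> complex) \<Rightarrow> complex) \<Rightarrow> bool" where
  "atomic_decomposition d M K\<^sub>0 x\<^sub>0 \<epsilon> \<beta> \<gamma> q c a B h \<longleftrightarrow>
     (\<forall>i. B i \<in> qballs d \<and> atom M q (B i) (a i)) \<and>
     summable (\<lambda>i. cmod (c i)) \<and>
     distr_sums d M K\<^sub>0 x\<^sub>0 \<epsilon> \<beta> \<gamma> (\<lambda>i x. c i * a i x) h"

text \<open>
  \<open>P\<close> is the product of \<open>b\<close> and \<open>h\<close>: for every atomic decomposition of \<open>h\<close>, with
  any exponent \<open>q \<in> (1,\<infinity>]\<close>, both series converge and their limits add up to \<open>P\<close>. In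
  particular, the product does not depend on the decomposition.
\<close>

definition is_product ::
  "('a \<Rightarrow> 'a \<Rightarrow> real) \<Rightarrow> 'a measure \<Rightarrow> real \<Rightarrow> 'a \<Rightarrow> real \<Rightarrow> real \<Rightarrow> real \<Rightarrow>
   ('a \<Rightarrow> complex) \<Rightarrow> (('a \<Rightarrow> complex) \<Rightarrow> complex) \<Rightarrow> (('a \<Rightarrow> complex) \<Rightarrow> complex) \<Rightarrow> bool" where
  "is_product d M K\<^sub>0 x\<^sub>0 \<epsilon> \<beta> \<gamma> b h P \<longleftrightarrow>
     P \<in> distributions d M K\<^sub>0 x\<^sub>0 \<epsilon> \<beta> \<gamma> \<and>
     (\<forall>q c a B. 1 < q \<longrightarrow> atomic_decomposition d M K\<^sub>0 x\<^sub>0 \<epsilon> \<beta> \<gamma> q c a B h \<longrightarrow>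
        (\<exists>S\<^sub>1 S\<^sub>2.
           distr_sums d M K\<^sub>0 x\<^sub>0 \<epsilon> \<beta> \<gamma> (\<lambda>i x. c i * (b x - mean M (B i) b) * a i x) S\<^sub>1 \<and>
           distr_sums d M K\<^sub>0 x\<^sub>0 \<epsilon> \<beta> \<gamma> (\<lambda>i x. c i * mean M (B i) b * a i x) S\<^sub>2 \<and>
           (\<forall>\<phi> \<in> test_closure d M K\<^sub>0 x\<^sub>0 \<epsilon> \<beta> \<gamma>. P \<phi> = S\<^sub>1 \<phi> + S\<^sub>2 \<phi>)))"

end

theory Submission
  imports Defs
begin

text \<open>
  Let \<open>f = \<Sum> \<lambda>\<^sub>i a\<^sub>i\<close> in \<open>L\<^sup>1\<close>. The regular part \<open>\<Sum> \<lambda>\<^sub>i (b - b\<^sub>i) a\<^sub>i\<close>, where \<open>b\<^sub>i\<close> is the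
  mean of \<open>b\<close> over the ball of \<open>a\<^sub>i\<close>, converges absolutely in \<open>L\<^sup>1\<close> by the John--Nirenberg inequality. The
  singular part \<open>\<Sum> \<lambda>\<^sub>i b\<^sub>i a\<^sub>i\<close> converges as a distribution, because \<open>b\<^sub>i\<close> grows only logarithmically in
  the radius and the position of the ball, while the pairing of an atom with a test function decays
  like a power. Its grand maximal function is at most
  \<open>\<bar>b\<bar> \<Sum> \<bar>\<lambda>\<^sub>i\<bar> a\<^sub>i\<^sup>* + \<Sum> \<bar>\<lambda>\<^sub>i\<bar> \<bar>b - b\<^sub>i\<bar> a\<^sub>i\<^sup>*\<close>; both series are integrable, the factor \<open>\<bar>b\<bar>\<close> is exponentially
  integrable, and \<open>exp L \<cdot> L\<^sup>1 \<subseteq> L\<^sup>\<wp>\<close> for the logarithmic weight.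

  The sum of the two parts does not depend on the decomposition: if \<open>T\<^sub>N b\<close> is the projection of \<open>b\<close>
  to the disc of radius \<open>N\<close>, it is the limit of \<open>\<integral> f \<cdot> T\<^sub>N b \<cdot> \<phi> d\<mu>\<close>, and \<open>f\<close> is determined almost
  everywhere by \<open>h\<close>.
\<close>

section \<open>Spaces of homogeneous type with uniform constants\<close>

text \<open>The product is not an integral: \<open>f\<close> is merely in L^1, so f times b need not
  be integrable, and neither need the series of the singular part converge in L^1. This is why
  independence of the decomposition is proved through bounded truncations of \<open>b\<close>. The
  projection onto a disc is 1-Lipschitz, so truncation does not increase the oscillation and the
  bounds on the terms are uniform in N. A second obstacle is that membership in the Hardy-Orlicz
  space includes measurability of a supremum over uncountably many test functions. It is obtained
  from lower semicontinuity, which rests on test functions being limits of functions with the faster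
  decay \<epsilon> > \<gamma>. One Vitali covering with an auxiliary measure serves the density
  statement, the John-Nirenberg inequality and the weak type bound for the maximal function of an
  atom. The powers that beat the logarithms of the means have three origins: the smoothness \<beta>
  for small balls, the decay \<gamma> for remote ones, and the exponent \<kappa> of reverse doubling
  for large ones.\<close>

lemma (in rd_space) doubling_growth:
  assumes V2: "\<And>r. 0 < r \<Longrightarrow> V (2 * r) \<le> E * V r" and E: "2 \<le> (E::real)"
    and mono: "\<And>r s. 0 < r \<Longrightarrow> r \<le> s \<Longrightarrow> V r \<le> V s" and pos: "\<And>r. 0 < r \<Longrightarrow> 0 < (V r :: real)"
    and rs: "0 < r" "r \<le> s"
  shows "V s \<le> E * (s / r) powr log 2 E * V r"
proof -
  have it: "V (2 ^ k * r) \<le> E ^ k * V r" for k :: nat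
  proof (induction k)
    case (Suc k)
    have "V (2 ^ Suc k * r) \<le> E * V (2 ^ k * r)"
      using V2[of "2 ^ k * r"] rs by (simp add: mult.assoc)
    also have "\<dots> \<le> E * (E ^ k * V r)" using Suc E by (intro mult_left_mono) auto
    finally show ?case by (simp add: mult.assoc)
  qed simp
  \<comment> \<open>Rounding the number of doublings up costs one extra doubling, which is the
    leading factor \<open>E\<close> of the bound.\<close>
  define k where "k = nat \<lceil>log 2 (s / r)\<rceil>"
  have sr: "1 \<le> s / r" using rs by simp
  then have l0: "0 \<le> log 2 (s / r)" by simp
  have k1: "log 2 (s / r) \<le> k" and k2: "real k \<le> log 2 (s / r) + 1"
    unfolding k_def using l0 by linarith+
  have "s / r = 2 powr log 2 (s / r)" using sr by simp
  also have "\<dots> \<le> 2 powr real k" using k1 by (intro powr_mono) auto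
  also have "\<dots> = 2 ^ k" by (simp add: powr_realpow)
  finally have "s \<le> 2 ^ k * r" using rs by (simp add: field_simps)
  then have "V s \<le> V (2 ^ k * r)" using rs by (intro mono) auto
  also have "\<dots> \<le> E ^ k * V r" by (rule it)
  also have "E ^ k = E powr real k" using E by (simp add: powr_realpow)
  also have "E powr real k \<le> E powr (log 2 (s / r) + 1)" using k2 E by (intro powr_mono) auto
  also have "\<dots> = E * E powr log 2 (s / r)" using E by (simp add: powr_add)
  also have "E powr log 2 (s / r) = (2 powr log 2 E) powr log 2 (s / r)" using E by simp
  also have "\<dots> = (2 powr log 2 (s / r)) powr log 2 E" by (simp add: powr_powr mult.commute)
  also have "2 powr log 2 (s / r) = s / r" using sr by simp
  finally show ?thesis using pos[OF rs(1)] by simp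
qed

text \<open>Names witnesses for the existential constants of \<open>rd_space\<close>, so that later
  constants can be defined from them. \<open>Q\<close> serves in every comparison at once, and
  \<open>V\<close> takes over from the measure of balls: since it does not see the centre, balls
  with different centres are compared through their radii alone. \<open>n\<close> and \<kappa> are
  an upper and a lower dimension.\<close>

locale hom_space = rd_space d M K \<theta> for d :: "'a \<Rightarrow> 'a \<Rightarrow> real" and M K \<theta> +
  fixes A Q \<kappa> n :: real and V :: "real \<Rightarrow> real"
  assumes A_pos: "0 < A"
    and dist_regular: "\<bar>d x z - d y z\<bar> \<le> A * d x y powr \<theta> * (d x z + d y z) powr (1 - \<theta>)"
    and Q_ge_1: "1 \<le> Q" and \<kappa>_pos: "0 < \<kappa>" and n_nonneg: "0 \<le> n"
    and V_pos: "0 < r \<Longrightarrow> 0 < V r"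
    and V_mono: "0 < r \<Longrightarrow> r \<le> s \<Longrightarrow> V r \<le> V s"
    and measure_le_V: "0 < r \<Longrightarrow> measure M (qball d x r) \<le> Q * V r"
    and V_le_measure: "0 < r \<Longrightarrow> V r \<le> Q * measure M (qball d x r)"
    and V_growth: "0 < r \<Longrightarrow> r \<le> s \<Longrightarrow> V s \<le> Q * (s / r) powr n * V r"
    and V_reverse: "0 < r \<Longrightarrow> r \<le> s \<Longrightarrow> (s / r) powr \<kappa> * V r \<le> Q * V s"

lemma (in rd_space) measure_qball_pos: "0 < r \<Longrightarrow> 0 < measure M (qball d x r)"
  using ball_pos[of r x] ball_finite[of r x] by (simp add: measure_def enn2real_positive_iff)

lemma (in rd_space) hom_space_exists: "\<exists>A Q \<kappa> n V. hom_space d M K\<^sub>0 \<theta> A Q \<kappa> n V"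
proof -
  obtain A where A: "A > 0" "\<And>x y z. \<bar>d x z - d y z\<bar> \<le> A * d x y powr \<theta> * (d x z + d y z) powr (1 - \<theta>)"
    using regularity by blast
  obtain D where D: "\<And>x r. 0 < r \<Longrightarrow> measure M (qball d x (2 * r)) \<le> D * measure M (qball d x r)"
    using doubling by blast
  obtain \<kappa> c where \<kappa>: "0 < \<kappa>" and c: "0 < c" and
    rev: "\<And>x y r s. 0 < r \<Longrightarrow> 0 < s \<Longrightarrow> qball d y s \<subseteq> qball d x r \<Longrightarrow>
            measure M (qball d x r) / measure M (qball d y s) \<ge> c * (r / s) powr \<kappa>"
    using reverse_doubling by blast
  obtain V c1 c2 where V: "mono_on {0..} V" "\<And>r. r > 0 \<Longrightarrow> 0 < V r" and c12: "c1 > 0" "c2 > 0"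
    and cV: "\<And>x r. 0 < r \<Longrightarrow> c1 * V r \<le> measure M (qball d x r)"
       "\<And>x r. 0 < r \<Longrightarrow> measure M (qball d x r) \<le> c2 * V r"
    using homogeneous by metis
  note pos = measure_qball_pos
  have Vm: "V r \<le> V s" if "0 < r" "r \<le> s" for r s using V(1) that by (auto simp: mono_on_def)
  fix x0 :: 'a
  have Vle: "V r \<le> (1 / c1) * measure M (qball d x r)" if "0 < r" for x r
    using cV(1)[OF that, of x] c12 by (simp add: field_simps)
  have "0 < D * measure M (qball d x0 1)" using D[of 1 x0] pos[of "2*1" x0] by simp
  then have D0: "0 < D" using pos[of 1 x0] by (simp add: zero_less_mult_iff)
  \<comment> \<open>Doubling passes from the measure to \<open>V\<close> at the cost of both
    comparison constants; the lower bound 2 keeps the exponent \<open>log 2 E\<close>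
    nonnegative.\<close>
  define E where "E = max 2 (D * c2 / c1)"
  have V2: "V (2 * r) \<le> E * V r" if "0 < r" for r
  proof -
    have "V (2 * r) \<le> (1 / c1) * measure M (qball d x0 (2 * r))" using that by (intro Vle) auto
    also have "\<dots> \<le> (1 / c1) * (D * (c2 * V r))"
      using D[OF that, of x0] cV(2)[OF that, of x0] c12 D0
      by (intro mult_left_mono order_trans[OF D[OF that, of x0]]) auto
    also have "\<dots> = (D * c2 / c1) * V r" by simp
    also have "\<dots> \<le> E * V r" using V(2)[OF that] by (intro mult_right_mono) (auto simp: E_def)
    finally show ?thesis .
  qed
  \<comment> \<open>The entries are what five inequalities of \<open>hom_space\<close> ask for: the
    normalisation, the two comparisons with \<open>V\<close>, the growth and the reverse
    growth.\<close>
  define Q where "Q = max 1 (max c2 (max (1 / c1) (max E (c2 / (c * c1)))))"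
  have Q: "1 \<le> Q" "c2 \<le> Q" "1 / c1 \<le> Q" "E \<le> Q" "c2 / (c * c1) \<le> Q" by (auto simp: Q_def)
  have "hom_space d M K\<^sub>0 \<theta> A Q \<kappa> (log 2 E) V"
  proof (intro hom_space.intro[OF rd_space_axioms] hom_space_axioms.intro)
    show "0 \<le> log 2 E" by (simp add: E_def)
    fix r s :: real and x :: 'a assume r: "0 < r"
    show "measure M (qball d x r) \<le> Q * V r"
      by (rule order_trans[OF cV(2)[OF r]]) (use V(2)[OF r] Q in auto)
    show "V r \<le> Q * measure M (qball d x r)"
      using Vle[OF r, of x] Q(3) mult_right_mono[of "1 / c1" Q "measure M (qball d x r)"] by simp
    assume rs: "r \<le> s"
    show "V r \<le> V s" using Vm r rs .
    have "V s \<le> E * (s / r) powr log 2 E * V r"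
      by (rule doubling_growth) (use V2 Vm V(2) r rs in \<open>auto simp: E_def\<close>)
    also have "\<dots> \<le> Q * (s / r) powr log 2 E * V r"
      using Q V(2)[OF r] by (intro mult_right_mono) auto
    finally show "V s \<le> Q * (s / r) powr log 2 E * V r" .
    have "c * (s / r) powr \<kappa> \<le> measure M (qball d x s) / measure M (qball d x r)"
      using r rs by (intro rev) (auto simp: qball_def)
    then have *: "c * ((s / r) powr \<kappa> * measure M (qball d x r)) \<le> measure M (qball d x s)"
      using pos[OF r, of x] by (simp add: field_simps)
    have "c * ((s / r) powr \<kappa> * (c1 * V r)) \<le> c2 * V s"
      using * cV(2)[of s x] r rs
        mult_left_mono[OF mult_left_mono[OF cV(1)[OF r, of x], of "(s / r) powr \<kappa>"] less_imp_le[OF c]]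
      by simp
    then have "(s / r) powr \<kappa> * V r \<le> (c2 / (c * c1)) * V s"
      using c c12 by (simp add: field_simps)
    also have "\<dots> \<le> Q * V s" using Q V(2)[of s] r rs by (intro mult_right_mono) auto
    finally show "(s / r) powr \<kappa> * V r \<le> Q * V s" .
  qed (use A \<kappa> Q V in auto)
  then show ?thesis by blast
qed

section \<open>Topology of the quasimetric and volumes of balls\<close>

context hom_space
begin

abbreviation ball where "ball \<equiv> qball d"

lemma dist_self [simp]: "d x x = 0" using dist_eq_0_iff by simp

lemma mem_ball [simp]: "y \<in> ball x r \<longleftrightarrow> d x y < r" by (simp add: qball_def)

lemma K_pos: "0 < K" using K0_ge_1 by simp

lemma dist_triangle_le: "d x z \<le> a \<Longrightarrow> d z y \<le> b \<Longrightarrow> d x y \<le> K * (a + b)"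
  using quasi_triangle[of x y z] K_pos mult_left_mono[of "d x z + d z y" "a + b" K] by linarith

lemma dist_triangle_less: "d x z < a \<Longrightarrow> d z y \<le> b \<Longrightarrow> d x y < K * (a + b)"
  using quasi_triangle[of x y z] K_pos mult_strict_left_mono[of "d x z + d z y" "a + b" K] by linarith

lemma ball_subset: "d x y \<le> a \<Longrightarrow> K * (a + r) \<le> s \<Longrightarrow> ball y r \<subseteq> ball x s"
  using dist_triangle_less[of _ y r x a] by (fastforce simp: dist_commute add.commute)

lemma ball_mono: "r \<le> s \<Longrightarrow> ball x r \<subseteq> ball x s" by auto

text \<open>The quasi-triangle inequality alone gives no continuity of the distance. In the Hoelder
  regularity, once \<open>d x z\<close> is bounded, the last factor is bounded by a constant
  absorbed in \<open>L\<close>, and \<open>d x y powr \<theta>\<close> is as small as desired.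
  Openness of balls and semicontinuity of maximal functions rest on this.\<close>

lemma dist_uniformly_continuous:
  assumes "0 < R" "0 < \<eta>"
  shows "\<exists>\<delta>>0. \<forall>x y z. d x z \<le> R \<longrightarrow> d x y < \<delta> \<longrightarrow> \<bar>d x z - d y z\<bar> \<le> \<eta>"
proof -
  define L where "L = A * (R + K * (1 + R)) powr (1 - \<theta>)"
  have pos: "0 < R + K * (1 + R)" using assms K_pos by (simp add: add_pos_pos)
  then have L: "0 < L" using A_pos by (simp add: L_def)
  define \<delta> where "\<delta> = min 1 ((\<eta> / L) powr (1 / \<theta>))"
  have \<delta>: "0 < \<delta>" using L assms by (simp add: \<delta>_def)
  have "\<bar>d x z - d y z\<bar> \<le> \<eta>" if xz: "d x z \<le> R" and xy: "d x y < \<delta>" for x y z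
  proof -
    have "d y z \<le> K * (1 + R)"
      using dist_triangle_le[of y x 1 z R] xy xz by (simp add: \<delta>_def dist_commute)
    then have "(d x z + d y z) powr (1 - \<theta>) \<le> (R + K * (1 + R)) powr (1 - \<theta>)"
      using xz theta dist_nonneg by (intro powr_mono2) (auto simp: add_nonneg_nonneg)
    moreover have "d x y powr \<theta> \<le> \<delta> powr \<theta>"
      using xy theta dist_nonneg by (intro powr_mono2) auto
    ultimately have "A * d x y powr \<theta> * (d x z + d y z) powr (1 - \<theta>)
        \<le> A * \<delta> powr \<theta> * (R + K * (1 + R)) powr (1 - \<theta>)"
      using A_pos by (intro mult_mono) auto
    also have "\<dots> = L * \<delta> powr \<theta>" by (simp add: L_def)
    also have "\<delta> powr \<theta> \<le> ((\<eta> / L) powr (1 / \<theta>)) powr \<theta>"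
      using \<delta> theta by (intro powr_mono2) (auto simp: \<delta>_def)
    also have "\<dots> = \<eta> / L" using theta assms L by (simp add: powr_powr)
    finally show ?thesis using dist_regular[of x z y] L by (simp add: mult.commute)
  qed
  then show ?thesis using \<delta> by blast
qed

lemma qopen_ball: "qopen d (ball x r)"
  unfolding qopen_def
proof
  fix y assume y: "y \<in> ball x r"
  then have r: "0 < r" using dist_nonneg[of x y] by simp
  obtain \<delta> where \<delta>: "\<delta> > 0"
    "\<And>y' z z'. d y' z \<le> r \<Longrightarrow> d y' z' < \<delta> \<Longrightarrow> \<bar>d y' z - d z' z\<bar> \<le> (r - d x y) / 2"
    using dist_uniformly_continuous[OF r, of "(r - d x y) / 2"] y by auto
  have "d x z < r" if "d y z < \<delta>" for z
    using \<delta>(2)[of y x z] that y by (auto simp: dist_commute abs_if split: if_splits)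
  then show "\<exists>s>0. ball y s \<subseteq> ball x r" using \<delta>(1) by auto
qed

lemma qopen_measurable: "qopen d U \<Longrightarrow> U \<in> sets M"
  unfolding sets_borel by (rule sigma_sets.Basic) simp

lemma sets_ball [measurable, simp]: "ball x r \<in> sets M"
  by (rule qopen_measurable[OF qopen_ball])

lemma qopen_Int: "qopen d U \<Longrightarrow> qopen d W \<Longrightarrow> qopen d (U \<inter> W)"
  unfolding qopen_def
proof
  fix x assume "\<forall>x\<in>U. \<exists>r>0. ball x r \<subseteq> U" "\<forall>x\<in>W. \<exists>r>0. ball x r \<subseteq> W" "x \<in> U \<inter> W"
  then obtain r s where "r > 0" "ball x r \<subseteq> U" "s > 0" "ball x s \<subseteq> W" by blast
  then show "\<exists>r>0. ball x r \<subseteq> U \<inter> W" by (intro exI[of _ "min r s"]) auto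
qed

lemma qopen_Union: "(\<And>U. U \<in> \<U> \<Longrightarrow> qopen d U) \<Longrightarrow> qopen d (\<Union>\<U>)"
  unfolding qopen_def by blast

lemma borel_measurable_dist [measurable]: "d x \<in> borel_measurable M"
proof (rule borel_measurableI_less)
  fix r show "{y \<in> space M. d x y < r} \<in> sets M"
    using sets_ball[of x r] by (simp add: space_UNIV qball_def)
qed

lemma emeasure_ball: "0 < r \<Longrightarrow> emeasure M (ball x r) = ennreal (measure M (ball x r))"
  using ball_finite[of r x] by (intro emeasure_eq_ennreal_measure) auto

lemma ball_empty: "r \<le> 0 \<Longrightarrow> ball x r = {}" using dist_nonneg[of x] by (auto simp: qball_def not_less intro: order_trans)

lemma emeasure_ball_finite: "emeasure M (ball x r) < \<infinity>"
  using ball_finite[of r x] ball_empty[of r x] by (cases "0 < r") auto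

lemma UN_balls: "(\<Union>k::nat. ball x (real k)) = UNIV"
  using reals_Archimedean2 by auto

sublocale sigma_finite_measure M
proof
  fix x :: 'a
  show "\<exists>A. countable A \<and> A \<subseteq> sets M \<and> \<Union> A = space M \<and> (\<forall>a\<in>A. emeasure M a \<noteq> \<infinity>)"
    using emeasure_ball_finite UN_balls[of x] unfolding space_UNIV
    by (intro exI[of _ "range (\<lambda>k::nat. ball x (real k))"]) (auto simp: less_top)
qed

lemma V_scale:
  assumes "0 < r" "0 < s" "s \<le> L * r" "1 \<le> L"
  shows "V s \<le> Q * L powr n * V r"
proof -
  have "V s \<le> V (L * r)" using assms by (intro V_mono) auto
  also have "\<dots> \<le> Q * (L * r / r) powr n * V r"
    using assms by (intro V_growth) auto
  finally show ?thesis using assms by simp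
qed

lemma measure_ball_le:
  assumes "0 < r" "0 < s" "s \<le> L * r" "1 \<le> L"
  shows "measure M (ball y s) \<le> Q ^ 3 * L powr n * measure M (ball x r)"
proof -
  have "measure M (ball y s) \<le> Q * (Q * L powr n * V r)"
    using measure_le_V[OF assms(2), of y] V_scale[OF assms] Q_ge_1
      mult_left_mono[of "V s" "Q * L powr n * V r" Q] by linarith
  also have "\<dots> \<le> Q * (Q * L powr n * (Q * measure M (ball x r)))"
    using V_le_measure[OF assms(1), of x] Q_ge_1 by (intro mult_left_mono) auto
  finally show ?thesis by (simp add: power3_eq_cube mult_ac)
qed

lemma emeasure_ball_le:
  assumes "0 < r" "s \<le> L * r" "1 \<le> L"
  shows "emeasure M (ball y s) \<le> ennreal (Q ^ 3 * L powr n) * emeasure M (ball x r)"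
proof (cases "0 < s")
  case True
  then show ?thesis using measure_ball_le[OF assms(1) True assms(2,3), of y x] assms Q_ge_1
    by (simp add: emeasure_ball ennreal_mult[symmetric] ennreal_leI)
qed (simp add: ball_empty)

text \<open>Reverse doubling against the unit radius makes \<open>V\<close> grow at least like r to
  the power \<kappa>. This bounds the radii of the balls on which a fixed L^1 function has a large
  average, as the covering lemma requires.\<close>

lemma V_unbounded: "\<exists>R>0. \<forall>r\<ge>R. T \<le> V r"
proof -
  define R where "R = max 1 ((max 1 (T * Q / V 1)) powr (1 / \<kappa>))"
  have R: "1 \<le> R" by (simp add: R_def)
  have "T \<le> V r" if r: "R \<le> r" for r
  proof -
    have "T * Q / V 1 \<le> ((max 1 (T * Q / V 1)) powr (1 / \<kappa>)) powr \<kappa>"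
      using \<kappa>_pos by (simp add: powr_powr)
    also have "\<dots> \<le> (r / 1) powr \<kappa>"
      using r \<kappa>_pos by (intro powr_mono2) (auto simp: R_def)
    finally have "T * Q \<le> (r / 1) powr \<kappa> * V 1" using V_pos[of 1] by (simp add: field_simps)
    also have "\<dots> \<le> Q * V r" using R r by (intro V_reverse) auto
    finally show ?thesis using Q_ge_1 by simp
  qed
  then show ?thesis using R by (intro exI[of _ R]) auto
qed

end

section \<open>Vitali covering\<close>

lemma emeasure_UN_le_nn_integral:
  assumes [measurable]: "\<And>i. i \<in> I \<Longrightarrow> X i \<in> sets N" and I: "countable I"
  shows "emeasure N (\<Union>i\<in>I. X i) \<le> (\<integral>\<^sup>+i. emeasure N (X i) \<partial>count_space I)"
proof -
  have "emeasure N (\<Union>i\<in>I. X i) = (\<integral>\<^sup>+x. indicator (\<Union>i\<in>I. X i) x \<partial>N)"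
    using I by (intro nn_integral_indicator[symmetric]) auto
  also have "\<dots> \<le> (\<integral>\<^sup>+x. \<integral>\<^sup>+i. indicator (X i) x \<partial>count_space I \<partial>N)"
  proof (rule nn_integral_mono)
    fix x
    show "(indicator (\<Union>i\<in>I. X i) x :: ennreal) \<le> (\<integral>\<^sup>+i. indicator (X i) x \<partial>count_space I)"
    proof (cases "x \<in> (\<Union>i\<in>I. X i)")
      case True
      then obtain j where j: "j \<in> I" "x \<in> X j" by auto
      have "(1::ennreal) = (\<integral>\<^sup>+i. indicator {j} i \<partial>count_space I)"
        using j by (subst nn_integral_indicator) auto
      also have "\<dots> \<le> (\<integral>\<^sup>+i. indicator (X i) x \<partial>count_space I)"
        using j by (intro nn_integral_mono) (auto split: split_indicator)
      finally show ?thesis using True by simp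
    qed simp
  qed
  also have "\<dots> = (\<integral>\<^sup>+i. \<integral>\<^sup>+x. indicator (X i) x \<partial>N \<partial>count_space I)"
    using I by (intro nn_integral_count_space_nn_integral) auto
  also have "\<dots> = (\<integral>\<^sup>+i. emeasure N (X i) \<partial>count_space I)"
    by (intro nn_integral_cong) auto
  finally show ?thesis .
qed

context hom_space
begin

text \<open>Zorn's lemma is applied to the disjoint subfamilies with the property that a ball meeting the
  subfamily meets a member of at least half its radius.\<close>

lemma vitali_selection:
  assumes rad: "\<And>x. x \<in> E \<Longrightarrow> 0 < r x" "\<And>x. x \<in> E \<Longrightarrow> r x \<le> R"
  shows "\<exists>F\<subseteq>E. disjoint_family_on (\<lambda>x. ball x (r x)) F \<and> (\<forall>x\<in>E. \<exists>y\<in>F. x \<in> ball y (4 * K * r y))"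
proof -
  define meets where "meets x y \<longleftrightarrow> ball x (r x) \<inter> ball y (r y) \<noteq> {}" for x y
  define \<Omega> where "\<Omega> = {F. F \<subseteq> E \<and> disjoint_family_on (\<lambda>x. ball x (r x)) F \<and>
     (\<forall>x\<in>E. (\<exists>y\<in>F. meets x y) \<longrightarrow> (\<exists>y\<in>F. meets x y \<and> r x \<le> 2 * r y))}"
  have "\<exists>F\<in>\<Omega>. \<forall>X\<in>\<Omega>. F \<subseteq> X \<longrightarrow> X = F"
  proof (rule subset_Zorn')
    fix C assume C: "subset.chain \<Omega> C"
    then have C\<Omega>: "\<And>F. F \<in> C \<Longrightarrow> F \<in> \<Omega>" by (auto simp: subset.chain_def)
    have "disjoint_family_on (\<lambda>x. ball x (r x)) (\<Union>C)"
      unfolding disjoint_family_on_def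
    proof (intro ballI impI)
      fix x y assume "x \<in> \<Union>C" "y \<in> \<Union>C" and ne: "x \<noteq> y"
      then obtain F G where FG: "F \<in> C" "G \<in> C" "x \<in> F" "y \<in> G" by auto
      then have "F \<subseteq> G \<or> G \<subseteq> F" using C by (auto simp: subset.chain_def)
      then obtain H where "H \<in> C" "x \<in> H" "y \<in> H" using FG by auto
      then show "ball x (r x) \<inter> ball y (r y) = {}"
        using C\<Omega>[of H] ne by (auto simp: \<Omega>_def disjoint_family_on_def)
    qed
    moreover have "\<exists>y\<in>\<Union>C. meets x y \<and> r x \<le> 2 * r y" if xE: "x \<in> E" and ex: "\<exists>y\<in>\<Union>C. meets x y" for x
    proof -
      obtain F y where "F \<in> C" "y \<in> F" "meets x y" using ex by auto
      then have "\<exists>y\<in>F. meets x y \<and> r x \<le> 2 * r y" using C\<Omega>[of F] xE by (auto simp: \<Omega>_def)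
      then show ?thesis using \<open>F \<in> C\<close> by blast
    qed
    moreover have "\<Union>C \<subseteq> E" using C\<Omega> by (auto simp: \<Omega>_def)
    ultimately show "\<Union>C \<in> \<Omega>" by (auto simp: \<Omega>_def)
  qed
  then obtain F where F: "F \<in> \<Omega>" and max: "\<And>X. X \<in> \<Omega> \<Longrightarrow> F \<subseteq> X \<Longrightarrow> X = F" by blast
  have self: "meets z z" if "z \<in> E" for z
  proof -
    have "z \<in> ball z (r z)" using rad(1)[OF that] by simp
    then show ?thesis unfolding meets_def by blast
  qed
  have sym: "meets x y \<longleftrightarrow> meets y x" for x y by (auto simp: meets_def)
  \<comment> \<open>A maximal \<open>F\<close> meets every ball. Were some balls missed, one with
    more than half of the supremum of the missed radii could be added: a ball that meets only the
    new member was itself missed and so has at most twice its radius.\<close>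
  define G where "G = {x \<in> E. \<forall>y\<in>F. \<not> meets x y}"
  have "G = {}"
  proof (rule ccontr)
    assume "G \<noteq> {}"
    have bdd: "bdd_above (r ` G)" using rad(2) by (auto simp: G_def bdd_above_def)
    define S where "S = Sup (r ` G)"
    have S: "r x \<le> S" if "x \<in> G" for x using bdd that by (auto simp: S_def intro: cSup_upper)
    obtain z0 where "z0 \<in> G" using \<open>G \<noteq> {}\<close> by auto
    then have "0 < S" using S[of z0] rad(1)[of z0] by (auto simp: G_def)
    then have "S / 2 < S" by simp
    then obtain z where z: "z \<in> G" "S / 2 < r z"
      using less_cSup_iff[of "r ` G" "S / 2"] bdd \<open>G \<noteq> {}\<close> by (auto simp: S_def)
    have zE: "z \<in> E" using z by (simp add: G_def)
    have "insert z F \<in> \<Omega>"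
      unfolding \<Omega>_def
    proof (intro CollectI conjI ballI impI)
      show "insert z F \<subseteq> E" using zE F by (auto simp: \<Omega>_def)
      show "disjoint_family_on (\<lambda>x. ball x (r x)) (insert z F)"
        using F z(1) by (auto simp: \<Omega>_def disjoint_family_on_def G_def meets_def)
      fix x assume x: "x \<in> E" "\<exists>y\<in>insert z F. meets x y"
      show "\<exists>y\<in>insert z F. meets x y \<and> r x \<le> 2 * r y"
      proof (cases "\<exists>y\<in>F. meets x y")
        case True then show ?thesis using F x(1) by (auto simp: \<Omega>_def)
      next
        case False
        then have "meets x z" "x \<in> G" using x by (auto simp: G_def)
        then show ?thesis using S[of x] z(2) by auto
      qed
    qed
    then have "z \<in> F" using max[of "insert z F"] by auto
    then show False using z(1) self[OF zE] by (auto simp: G_def)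
  qed
  have "\<exists>y\<in>F. x \<in> ball y (4 * K * r y)" if x: "x \<in> E" for x
  proof -
    have "\<exists>y\<in>F. meets x y" using \<open>G = {}\<close> x by (auto simp: G_def)
    then obtain y where y: "y \<in> F" "meets x y" "r x \<le> 2 * r y" using F x by (auto simp: \<Omega>_def)
    then obtain w where w: "d x w < r x" "d y w < r y" by (auto simp: meets_def)
    have "d y x < K * (r y + r x)" using dist_triangle_less[of y w "r y" x "r x"] w by (simp add: dist_commute)
    also have "\<dots> \<le> K * (4 * r y)" using y(3) K_pos rad(1)[OF x] by (intro mult_left_mono) auto
    finally show ?thesis using y(1) by (auto simp: mult_ac)
  qed
  then show ?thesis using F by (auto simp: \<Omega>_def)
qed

text \<open>Inside a fixed ball around \<open>x0\<close> the traces of disjoint balls have bounded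
  total measure, so only countably many traces have nonzero measure. Every ball has positive measure
  and is exhausted by its traces, hence is counted for some \<open>k\<close>.\<close>

lemma countable_disjoint_balls:
  assumes disj: "disjoint_family_on (\<lambda>x. ball x (r x)) F" and rad: "\<And>x. x \<in> F \<Longrightarrow> 0 < r x"
  shows "countable F"
proof -
  fix x0 :: 'a
  define f where "f k x = measure M (ball x (r x) \<inter> ball x0 (real k))" for k x
  have "countable {x \<in> F. f k x \<noteq> 0}" for k
  proof (rule summable_countable_real, rule nonneg_bdd_above_summable_on)
    show "bdd_above (sum (f k) ` {S. S \<subseteq> F \<and> finite S})"
    proof (rule bdd_aboveI2)
      fix S assume S: "S \<in> {S. S \<subseteq> F \<and> finite S}"
      have "sum (f k) S = measure M (\<Union>x\<in>S. ball x (r x) \<inter> ball x0 (real k))"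
        unfolding f_def
      proof (rule measure_finite_Union[symmetric])
        show "disjoint_family_on (\<lambda>x. ball x (r x) \<inter> ball x0 (real k)) S"
          using disj S unfolding disjoint_family_on_def by blast
        show "emeasure M (ball x (r x) \<inter> ball x0 (real k)) \<noteq> \<infinity>" for x
          using emeasure_mono[of "ball x (r x) \<inter> ball x0 (real k)" "ball x0 (real k)" M]
            emeasure_ball_finite[of x0 "real k"] by (auto simp: top_unique)
      qed (use S in auto)
      also have "\<dots> \<le> measure M (ball x0 (real k))"
        using S emeasure_ball_finite[of x0 "real k"]
        by (intro measure_mono_fmeasurable fmeasurableI) (auto intro!: sets.Int sets.finite_UN)
      finally show "sum (f k) S \<le> measure M (ball x0 (real k))" .
    qed
  qed (simp add: f_def)
  then have c: "countable (\<Union>k. {x \<in> F. f k x \<noteq> 0})" by blast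
  have "F \<subseteq> (\<Union>k. {x \<in> F. f k x \<noteq> 0})"
  proof
    fix x assume x: "x \<in> F"
    have "\<exists>k. f k x \<noteq> 0"
    proof (rule ccontr)
      assume neg: "\<nexists>k. f k x \<noteq> 0"
      have *: "emeasure M (ball x (r x) \<inter> ball x0 (real k)) = 0" for k
      proof -
        have "emeasure M (ball x (r x) \<inter> ball x0 (real k)) \<noteq> \<infinity>"
          using emeasure_mono[of "ball x (r x) \<inter> ball x0 (real k)" "ball x0 (real k)" M]
            emeasure_ball_finite[of x0 "real k"] by (auto simp: top_unique)
        then show ?thesis using neg by (simp add: emeasure_eq_ennreal_measure f_def)
      qed
      have "emeasure M (\<Union>k::nat. ball x (r x) \<inter> ball x0 (real k)) = 0"
        by (rule emeasure_UN_eq_0) (use * in auto)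
      also have "(\<Union>k::nat. ball x (r x) \<inter> ball x0 (real k)) = ball x (r x)"
        using UN_balls[of x0] by blast
      finally show False using ball_pos[OF rad[OF x], of x] by simp
    qed
    then show "x \<in> (\<Union>k. {x \<in> F. f k x \<noteq> 0})" using x by auto
  qed
  then show ?thesis using c by (rule countable_subset)
qed

text \<open>The price of dilating a ball by the Vitali factor \<open>4 * K\<close>.\<close>

definition CV :: real where "CV = Q ^ 3 * (4 * K) powr n"

lemma CV_ge_1: "1 \<le> CV"
proof -
  have "1 \<le> Q ^ 3" using Q_ge_1 by simp
  moreover have "1 \<le> (4 * K) powr n" using K0_ge_1 n_nonneg by (intro ge_one_powr_ge_zero) auto
  ultimately show ?thesis using mult_mono[of 1 "Q^3" 1 "(4 * K) powr n"] Q_ge_1 by (simp add: CV_def)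
qed

text \<open>The auxiliary measure \<nu> and the threshold \<open>t\<close> make one covering
  statement fit several maximal estimates: \<nu> is \<open>M\<close> itself for densities, and has
  the density \<open>cmod (b z - mb x R)\<close> or \<open>cmod (a z) powr q\<close> elsewhere.
  Disjointness of the undilated balls turns their sum into the measure of a union inside
  \<open>W\<close>; the dilation costs \<open>CV\<close>.\<close>

lemma vitali_covering:
  assumes rad: "\<And>x. x \<in> E \<Longrightarrow> 0 < r x" "\<And>x. x \<in> E \<Longrightarrow> r x \<le> R"
    and \<nu>: "sets \<nu> = sets M" and W: "W \<in> sets M" "\<And>x. x \<in> E \<Longrightarrow> ball x (r x) \<subseteq> W"
    and t: "\<And>x. x \<in> E \<Longrightarrow> t * emeasure M (ball x (r x)) \<le> emeasure \<nu> (ball x (r x))"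
  obtains F where "F \<subseteq> E" "countable F" "E \<subseteq> (\<Union>x\<in>F. ball x (4 * K * r x))"
    "t * (\<integral>\<^sup>+x. emeasure M (ball x (4 * K * r x)) \<partial>count_space F) \<le> ennreal CV * emeasure \<nu> W"
proof -
  obtain F where F: "F \<subseteq> E" and disj: "disjoint_family_on (\<lambda>x. ball x (r x)) F"
    and cov: "\<And>x. x \<in> E \<Longrightarrow> \<exists>y\<in>F. x \<in> ball y (4 * K * r y)"
    using vitali_selection[of E r R] rad by metis
  have cF: "countable F" using disj rad F by (intro countable_disjoint_balls) auto
  have "t * (\<integral>\<^sup>+x. emeasure M (ball x (4 * K * r x)) \<partial>count_space F)
      = (\<integral>\<^sup>+x. t * emeasure M (ball x (4 * K * r x)) \<partial>count_space F)"
    by (rule nn_integral_cmult[symmetric]) simp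
  also have "\<dots> \<le> (\<integral>\<^sup>+x. ennreal CV * emeasure \<nu> (ball x (r x)) \<partial>count_space F)"
  proof (rule nn_integral_mono)
    fix x assume "x \<in> space (count_space F)"
    then have x: "x \<in> E" using F by auto
    have "emeasure M (ball x (4 * K * r x)) \<le> ennreal CV * emeasure M (ball x (r x))"
      unfolding CV_def using K0_ge_1 rad(1)[OF x] by (intro emeasure_ball_le) auto
    then have "t * emeasure M (ball x (4 * K * r x)) \<le> ennreal CV * (t * emeasure M (ball x (r x)))"
      using mult_left_mono[of _ _ t] by (fastforce simp: mult_ac)
    also have "\<dots> \<le> ennreal CV * emeasure \<nu> (ball x (r x))"
      using t[OF x] by (intro mult_left_mono) auto
    finally show "t * emeasure M (ball x (4 * K * r x)) \<le> ennreal CV * emeasure \<nu> (ball x (r x))" .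
  qed
  also have "\<dots> = ennreal CV * (\<integral>\<^sup>+x. emeasure \<nu> (ball x (r x)) \<partial>count_space F)"
    by (rule nn_integral_cmult) simp
  also have "(\<integral>\<^sup>+x. emeasure \<nu> (ball x (r x)) \<partial>count_space F) = emeasure \<nu> (\<Union>x\<in>F. ball x (r x))"
    using cF disj \<nu> by (intro emeasure_UN_countable[symmetric]) auto
  also have "ennreal CV * \<dots> \<le> ennreal CV * emeasure \<nu> W"
    using W F \<nu> by (intro mult_left_mono emeasure_mono) auto
  finally show ?thesis using cov by (intro that[OF F cF]) auto
qed

end

section \<open>Regularity and Lebesgue density\<close>

context hom_space
begin

lemma qopen_UNIV: "qopen d UNIV" unfolding qopen_def by (auto intro: exI[of _ 1])

lemma qopen_INT_finite: "finite I \<Longrightarrow> (\<And>i. i \<in> I \<Longrightarrow> qopen d (U i)) \<Longrightarrow> qopen d (\<Inter>i\<in>I. U i)"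
  by (induction rule: finite_induct) (auto intro: qopen_UNIV qopen_Int)

lemma finite_emeasure_Int_ball: "emeasure M (S \<inter> ball x R) < \<infinity>"
proof (cases "S \<inter> ball x R \<in> sets M")
  case True
  have "emeasure M (S \<inter> ball x R) \<le> emeasure M (ball x R)" by (intro emeasure_mono) auto
  then show ?thesis using emeasure_ball_finite[of x R] by (rule le_less_trans)
qed (simp add: emeasure_notin_sets)

lemma decseq_emeasure_small:
  assumes D: "range D \<subseteq> sets M" "decseq D" "emeasure M (D 0) < \<infinity>"
    and le: "emeasure M (\<Inter>i. D i) < \<eta>"
  shows "\<exists>i::nat. emeasure M (D i) \<le> \<eta>"
proof -
  have "(\<lambda>i. emeasure M (D i)) \<longlonglongrightarrow> emeasure M (\<Inter>i. D i)"
  proof (rule Lim_emeasure_decseq[OF D(1,2)])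
    fix i
    have "emeasure M (D i) \<le> emeasure M (D 0)" using D(1) decseqD[OF D(2), of 0 i] by (intro emeasure_mono) auto
    then show "emeasure M (D i) \<noteq> \<infinity>" using D(3) by (auto simp: top_unique)
  qed
  then have "\<forall>\<^sub>F i in sequentially. emeasure M (D i) < \<eta>" using le by (rule order_tendstoD)
  then obtain i where "emeasure M (D i) < \<eta>"
    using eventually_happens'[OF sequentially_bot] by blast
  then show ?thesis using less_imp_le by blast
qed

text \<open>Induction over the sigma-algebra needs a property stable under complements, so open sets
  from outside and closed sets from inside are approximated together, with the error counted inside
  a ball of finite measure.\<close>

lemma regular_approximation:
  assumes "E \<in> sets M" "0 < \<eta>"
  shows "\<exists>U F. qopen d U \<and> qopen d (- F) \<and> F \<subseteq> E \<and> E \<subseteq> U \<and>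
    emeasure M ((U - F) \<inter> ball x R) \<le> ennreal \<eta>"
  using assms(1,2) unfolding sets_borel
proof (induction arbitrary: \<eta> rule: sigma_sets.induct)
  case (Basic U)
  then have U: "qopen d U" by simp
  \<comment> \<open>The part of \<open>U\<close> close to its complement; what remains of
    \<open>U\<close> is closed. These sets decrease to the empty set because \<open>U\<close> is
    open.\<close>
  define D where "D n = U \<inter> (\<Union>z\<in>-U. ball z (1 / real (Suc n))) \<inter> ball x R" for n
  have o: "qopen d (\<Union>z\<in>-U. ball z (1 / real (Suc n)))" for n
    using qopen_Union[of "(\<lambda>z. ball z (1 / real (Suc n))) ` (-U)"] qopen_ball by auto
  have D: "D n \<in> sets M" for n
    unfolding D_def by (intro qopen_measurable qopen_Int U o qopen_ball)
  have empty: "(\<Inter>n. D n) = {}"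
  proof (rule ccontr)
    assume "(\<Inter>n. D n) \<noteq> {}"
    then obtain y where y: "\<And>n. y \<in> D n" by auto
    then have "y \<in> U" by (auto simp: D_def)
    then obtain s where s: "s > 0" "ball y s \<subseteq> U" using U by (auto simp: qopen_def)
    then obtain n where n: "1 / real (Suc n) < s" using nat_approx_posE by metis
    obtain z where "z \<notin> U" "d z y < 1 / real (Suc n)" using y[of n] by (auto simp: D_def)
    moreover from this have "z \<in> ball y s" using n by (simp add: dist_commute)
    ultimately show False using s(2) by blast
  qed
  have "\<exists>i. emeasure M (D i) \<le> ennreal \<eta>"
  proof (rule decseq_emeasure_small)
    show "decseq D"
    proof (rule antimonoI)
      fix m n :: nat assume "m \<le> n"
      then have "1 / real (Suc n) \<le> 1 / real (Suc m)" by (intro divide_left_mono) auto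
      then show "D n \<subseteq> D m" using order.strict_trans2 by (fastforce simp: D_def)
    qed
    show "emeasure M (D 0) < \<infinity>" unfolding D_def by (rule finite_emeasure_Int_ball)
  qed (use D empty Basic in auto)
  then obtain i where "emeasure M (D i) \<le> ennreal \<eta>" by auto
  moreover have "- (\<Union>z\<in>-U. ball z (1 / real (Suc i))) \<subseteq> U"
  proof
    fix y assume y: "y \<in> - (\<Union>z\<in>-U. ball z (1 / real (Suc i)))"
    have "y \<in> ball y (1 / real (Suc i))" by simp
    then show "y \<in> U" using y by blast
  qed
  ultimately show ?case
    using o[of i] U
    by - (rule exI[of _ U], rule exI[of _ "- (\<Union>z\<in>-U. ball z (1 / real (Suc i)))"],
      auto simp: D_def Diff_eq)
next
  case Empty
  then show ?case by (intro exI[of _ "{}"]) (auto simp: qopen_UNIV, simp add: qopen_def)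
next
  case (Compl E)
  then obtain U F where "qopen d U" "qopen d (- F)" "F \<subseteq> E" "E \<subseteq> U"
    "emeasure M ((U - F) \<inter> ball x R) \<le> ennreal \<eta>" by blast
  moreover have "- F - - U = U - F" by auto
  ultimately show ?case by - (rule exI[of _ "-F"], rule exI[of _ "-U"], auto)
next
  case (Union E)
  \<comment> \<open>The errors add up to \<open>\<eta> / 2\<close>; the strict gap to \<eta> is used
    when the infinite union of closed sets is cut to a finite one.\<close>
  have "\<exists>U F. qopen d U \<and> qopen d (- F) \<and> F \<subseteq> E i \<and> E i \<subseteq> U \<and>
    emeasure M ((U - F) \<inter> ball x R) \<le> ennreal (\<eta> * (1/2) ^ (i + 2))" for i
    using Union by (intro Union.IH) auto
  then obtain U F where U: "\<And>i. qopen d (U i)" and F: "\<And>i. qopen d (- F i)"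
    and sub: "\<And>i. F i \<subseteq> E i" "\<And>i. E i \<subseteq> U i"
    and small: "\<And>i. emeasure M ((U i - F i) \<inter> ball x R) \<le> ennreal (\<eta> * (1/2) ^ (i + 2))"
    by metis
  have [measurable]: "U i \<in> sets M" "F i \<in> sets M" for i
    using qopen_measurable[OF U] sets.compl_sets[OF qopen_measurable[OF F[of i]]]
    by (auto simp: space_UNIV Compl_eq_Diff_UNIV[symmetric])
  \<comment> \<open>Finitely many of the closed sets are kept, since an infinite union need not be
    closed; continuity from above selects how many.\<close>
  define D where "D m = ((\<Union>i. U i) - (\<Union>i\<in>{..<m}. F i)) \<inter> ball x R" for m :: nat
  have "\<exists>m. emeasure M (D m) \<le> ennreal \<eta>"
  proof (rule decseq_emeasure_small)
    show "range D \<subseteq> sets M" by (auto simp: D_def)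
    show "decseq D" by (rule antimonoI) (fastforce simp: D_def)
    show "emeasure M (D 0) < \<infinity>" unfolding D_def by (rule finite_emeasure_Int_ball)
    have "emeasure M (\<Inter>m. D m) \<le> emeasure M (\<Union>i. (U i - F i) \<inter> ball x R)"
    proof (rule emeasure_mono)
      show "(\<Inter>m. D m) \<subseteq> (\<Union>i. (U i - F i) \<inter> ball x R)"
      proof
        fix y assume y: "y \<in> (\<Inter>m. D m)"
        then obtain i where "y \<in> U i" by (auto simp: D_def)
        moreover have "y \<in> D (Suc i)" using y by blast
        ultimately show "y \<in> (\<Union>i. (U i - F i) \<inter> ball x R)" by (auto simp: D_def)
      qed
    qed auto
    also have "\<dots> \<le> (\<Sum>i. emeasure M ((U i - F i) \<inter> ball x R))"
      by (rule emeasure_subadditive_countably) auto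
    also have "\<dots> \<le> (\<Sum>i. ennreal (\<eta> * (1/2) ^ (i + 2)))"
      by (intro suminf_le small) auto
    also have "\<dots> = ennreal (\<eta> / 2)"
    proof (rule suminf_ennreal_eq)
      have "(\<lambda>i. (\<eta> / 4) * (1/2) ^ i) sums ((\<eta> / 4) * (1 / (1 - 1/2)))"
        by (intro sums_mult geometric_sums) auto
      then show "(\<lambda>i. \<eta> * (1/2) ^ (i + 2)) sums (\<eta> / 2)" by (simp add: power_add field_simps)
    qed (use Union in auto)
    also have "\<dots> < ennreal \<eta>" using Union by (intro ennreal_lessI) auto
    finally show "emeasure M (\<Inter>m. D m) < ennreal \<eta>" .
  qed
  then obtain m where m: "emeasure M (D m) \<le> ennreal \<eta>" by auto
  have "qopen d (\<Union>i. U i)" using qopen_Union[of "range U"] U by auto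
  moreover have "qopen d (- (\<Union>i\<in>{..<m}. F i))"
    using qopen_INT_finite[of "{..<m}" "\<lambda>i. - F i"] F by simp
  moreover have "(\<Union>i\<in>{..<m}. F i) \<subseteq> (\<Union>i. E i)" "(\<Union>i. E i) \<subseteq> (\<Union>i. U i)" using sub by blast+
  ultimately show ?case
    using m by - (rule exI[of _ "\<Union>i. U i"], rule exI[of _ "\<Union>i\<in>{..<m}. F i"], simp add: D_def)
qed

lemma outer_regularity:
  assumes W: "W \<in> sets M" "W \<subseteq> ball x R" and \<eta>: "0 < \<eta>"
  shows "\<exists>U. qopen d U \<and> W \<subseteq> U \<and> U \<subseteq> ball x R \<and> measure M U \<le> measure M W + \<eta>"
proof -
  obtain U F where UF: "qopen d U" "qopen d (- F)" "F \<subseteq> W" "W \<subseteq> U"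
    "emeasure M ((U - F) \<inter> ball x R) \<le> ennreal \<eta>" using regular_approximation[OF W(1) \<eta>] by blast
  have [measurable]: "U \<in> sets M" "F \<in> sets M"
    using qopen_measurable[OF UF(1)] sets.compl_sets[OF qopen_measurable[OF UF(2)]]
    by (auto simp: space_UNIV Compl_eq_Diff_UNIV[symmetric])
  have fin: "emeasure M (S \<inter> ball x R) \<noteq> \<infinity>" for S using finite_emeasure_Int_ball[of S x R] by auto
  have fm: "S \<inter> ball x R \<in> fmeasurable M" if "S \<in> sets M" for S
    using that finite_emeasure_Int_ball[of S x R] by (intro fmeasurableI) auto
  have Wx: "W \<inter> ball x R = W" using W by auto
  have "measure M (U \<inter> ball x R) \<le> measure M (W \<union> (U - F) \<inter> ball x R)"
    using fm[of "W \<union> (U - F)"] W UF(3)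
    by (intro measure_mono_fmeasurable) (auto simp: Int_Un_distrib2 Wx)
  also have "\<dots> \<le> measure M W + measure M ((U - F) \<inter> ball x R)"
    using W fin[of W] fin[of "U - F"] Wx by (intro measure_Un_le) auto
  also have "measure M ((U - F) \<inter> ball x R) \<le> \<eta>"
    using UF(5) fin[of "U - F"] \<eta> by (simp add: emeasure_eq_ennreal_measure)
  finally show ?thesis
    using UF W qopen_Int[OF UF(1) qopen_ball[of x R]] by (intro exI[of _ "U \<inter> ball x R"]) auto
qed

text \<open>A weak form of Lebesgue differentiation that suffices for stopping balls. Cover the bad
  set by balls on which \<nu> is at most \<open>t\<close> times \<open>M\<close>: as \<nu> has
  density at least \<open>2 * CV * t\<close> on \<open>G\<close> and the covering loses only
  \<open>CV\<close>, the cover confines the bad set to about half the measure. Repetition forces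
  measure zero.\<close>

lemma lebesgue_density_bounded:
  assumes \<nu>: "sets \<nu> = sets M" and t: "0 < t" and \<delta>: "0 < \<delta>"
    and G[measurable]: "G \<in> sets M" and Gk: "G \<subseteq> ball x0 k"
    and dens: "\<And>S. S \<in> sets M \<Longrightarrow> S \<subseteq> G \<Longrightarrow> ennreal (2 * CV * t) * emeasure M S \<le> emeasure \<nu> S"
  shows "\<exists>N\<in>null_sets M. \<forall>x\<in>G - N. \<exists>r>0. r < \<delta> \<and> ennreal t * emeasure M (ball x r) < emeasure \<nu> (ball x r)"
proof -
  \<comment> \<open>The bad set is not known to be measurable, so the argument runs over measurable
    sets between it and \<open>G\<close>.\<close>
  define E where "E = {x \<in> G. \<forall>r>0. r < \<delta> \<longrightarrow> emeasure \<nu> (ball x r) \<le> ennreal t * emeasure M (ball x r)}"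
  have fm: "S \<in> fmeasurable M" if "S \<in> sets M" "S \<subseteq> ball x0 k" for S
    using that finite_emeasure_Int_ball[of S x0 k] by (intro fmeasurableI) (auto simp: Int_absorb2)
  have em: "emeasure M S = ennreal (measure M S)" if "S \<in> sets M" "S \<subseteq> ball x0 k" for S
    using fm[OF that] by (intro emeasure_eq_ennreal_measure) (auto simp: fmeasurable_def)
  have step: "\<exists>W'\<in>sets M. E \<subseteq> W' \<and> W' \<subseteq> G \<and> 2 * measure M W' \<le> measure M W + \<eta>"
    if W[measurable]: "W \<in> sets M" and WG: "E \<subseteq> W" "W \<subseteq> G" and \<eta>: "0 < \<eta>" for W \<eta>
  proof -
    obtain U where U: "qopen d U" "W \<subseteq> U" "U \<subseteq> ball x0 k" "measure M U \<le> measure M W + \<eta>"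
      using outer_regularity[OF W, of x0 k \<eta>] WG Gk \<eta> by auto
    have Us: "U \<in> sets M" using U(1) by (rule qopen_measurable)
    \<comment> \<open>With this bound the dilated radius \<open>4 * K * r x\<close> is still below
      \<delta>, where the inequality defining \<open>E\<close> applies.\<close>
    have "\<exists>r>0. r \<le> \<delta> / (8 * K) \<and> ball x r \<subseteq> U" if xE: "x \<in> E" for x
    proof -
      have "x \<in> U" using xE WG(1) U(2) by auto
      then obtain s where "s > 0" "ball x s \<subseteq> U" using U(1) by (auto simp: qopen_def)
      then show ?thesis
        using \<delta> K_pos by (intro exI[of _ "min s (\<delta> / (8 * K))"]) (auto intro: order_trans[OF ball_mono])
    qed
    then obtain r where r: "\<And>x. x \<in> E \<Longrightarrow> r x > 0" "\<And>x. x \<in> E \<Longrightarrow> r x \<le> \<delta> / (8 * K)"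
      "\<And>x. x \<in> E \<Longrightarrow> ball x (r x) \<subseteq> U" by metis
    obtain F where F: "F \<subseteq> E" "countable F" "E \<subseteq> (\<Union>x\<in>F. ball x (4 * K * r x))"
      "1 * (\<integral>\<^sup>+x. emeasure M (ball x (4 * K * r x)) \<partial>count_space F) \<le> ennreal CV * emeasure M U"
      by (rule vitali_covering[of E r "\<delta> / (8 * K)" M U 1]) (use r Us in auto)
    define W' where "W' = W \<inter> (\<Union>x\<in>F. ball x (4 * K * r x))"
    have UNs: "(\<Union>x\<in>F. ball x (4 * K * r x)) \<in> sets M" using F(2) by (intro sets.countable_UN') auto
    then have W': "W' \<in> sets M" unfolding W'_def by auto
    have "ennreal (2 * CV * t) * emeasure M W' \<le> emeasure \<nu> W'"
      using W' WG by (intro dens) (auto simp: W'_def)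
    also have "\<dots> \<le> emeasure \<nu> (\<Union>x\<in>F. ball x (4 * K * r x))"
      using UNs \<nu> by (intro emeasure_mono) (auto simp: W'_def)
    also have "\<dots> \<le> (\<integral>\<^sup>+x. emeasure \<nu> (ball x (4 * K * r x)) \<partial>count_space F)"
      using F(2) \<nu> by (intro emeasure_UN_le_nn_integral) auto
    also have "\<dots> \<le> (\<integral>\<^sup>+x. ennreal t * emeasure M (ball x (4 * K * r x)) \<partial>count_space F)"
    proof (rule nn_integral_mono)
      fix x assume "x \<in> space (count_space F)"
      then have x: "x \<in> E" using F by auto
      have "4 * K * r x \<le> 4 * K * (\<delta> / (8 * K))" using r(2)[OF x] K_pos by (intro mult_left_mono) auto
      also have "\<dots> < \<delta>" using K_pos \<delta> by simp
      finally show "emeasure \<nu> (ball x (4 * K * r x)) \<le> ennreal t * emeasure M (ball x (4 * K * r x))"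
        using x r(1)[OF x] K_pos by (auto simp: E_def)
    qed
    also have "\<dots> = ennreal t * (\<integral>\<^sup>+x. emeasure M (ball x (4 * K * r x)) \<partial>count_space F)"
      by (rule nn_integral_cmult) simp
    also have "\<dots> \<le> ennreal t * (ennreal CV * emeasure M U)"
      using F(4) by (intro mult_left_mono) auto
    finally have "ennreal (2 * CV * t * measure M W') \<le> ennreal (t * (CV * measure M U))"
      using em[OF W'] em[OF Us U(3)] WG Gk CV_ge_1 t
      by (simp add: W'_def le_infI1 ennreal_mult[symmetric])
    then have "2 * CV * t * measure M W' \<le> t * (CV * measure M U)"
      using t CV_ge_1 by (simp add: ennreal_le_iff)
    then have "(CV * t) * (2 * measure M W') \<le> (CV * t) * measure M U" by (simp add: mult_ac)
    then have "2 * measure M W' \<le> measure M U" using t CV_ge_1 by simp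
    then show ?thesis using W' F(3) WG U(4) by (intro bexI[of _ W']) (auto simp: W'_def)
  qed
  \<comment> \<open>A positive infimum is contradicted by \<open>step\<close>, which almost halves a
    nearly minimal set.\<close>
  define J where "J = measure M ` {W \<in> sets M. E \<subseteq> W \<and> W \<subseteq> G}"
  have Jne: "J \<noteq> {}" using G by (auto simp: J_def E_def)
  have Jb: "bdd_below J" by (auto simp: J_def bdd_below_def intro: exI[of _ 0])
  have "Inf J \<le> 0"
  proof (rule ccontr)
    assume "\<not> Inf J \<le> 0"
    then have pos: "0 < Inf J" by simp
    then obtain W where W: "W \<in> sets M" "E \<subseteq> W" "W \<subseteq> G" "measure M W < Inf J + Inf J / 2"
      using cInf_less_iff[OF Jne Jb, of "Inf J + Inf J / 2"] by (auto simp: J_def)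
    obtain W' where W': "W' \<in> sets M" "E \<subseteq> W'" "W' \<subseteq> G" "2 * measure M W' \<le> measure M W + Inf J / 4"
      using step[OF W(1-3), of "Inf J / 4"] pos by auto
    have "Inf J \<le> measure M W'" using W' Jb by (intro cInf_lower) (auto simp: J_def)
    then show False using W(4) W'(4) pos by linarith
  qed
  then have "\<exists>W\<in>sets M. E \<subseteq> W \<and> W \<subseteq> G \<and> measure M W < \<eta>" if "0 < \<eta>" for \<eta>
    using cInf_less_iff[OF Jne Jb, of \<eta>] that by (auto simp: J_def)
  then have "\<exists>W\<in>sets M. E \<subseteq> W \<and> W \<subseteq> G \<and> measure M W < 1 / real (Suc m)" for m by simp
  then obtain W where W: "\<And>m. W m \<in> sets M" "\<And>m. E \<subseteq> W m" "\<And>m. W m \<subseteq> G"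
     "\<And>m. measure M (W m) < 1 / real (Suc m)" by metis
  define N where "N = (\<Inter>m. W m)"
  have N: "N \<in> sets M" using W by (auto simp: N_def)
  have "measure M N \<le> 0"
  proof (rule ccontr)
    assume "\<not> measure M N \<le> 0"
    then obtain m where m: "1 / real (Suc m) < measure M N" using nat_approx_posE[of "measure M N"] by auto
    have "measure M N \<le> measure M (W m)"
      using N W[of m] Gk by (intro measure_mono_fmeasurable fm) (auto simp: N_def)
    then show False using m W(4)[of m] by simp
  qed
  then have "measure M N = 0" using measure_nonneg[of M N] by linarith
  then have "N \<in> null_sets M" using em[OF N] W(3)[of 0] Gk N by (auto simp: N_def)
  moreover have "E \<subseteq> N" using W by (auto simp: N_def)
  ultimately show ?thesis
    unfolding E_def by (intro bexI[of _ N] ballI) (blast intro: leI, simp)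
qed

end

section \<open>The John--Nirenberg inequality\<close>

text \<open>The tangent inequality for ln at \<open>c * u / p\<close> gives the constant
  explicitly.\<close>

lemma powr_le_exp:
  fixes p c :: real
  assumes "0 < p" "0 < c"
  obtains C where "0 < C" "\<And>u. 0 \<le> u \<Longrightarrow> u powr p \<le> C * exp (c * u)"
proof
  show "0 < exp (- p - p * ln (c / p))" by simp
  fix u :: real assume "0 \<le> u"
  show "u powr p \<le> exp (- p - p * ln (c / p)) * exp (c * u)"
  proof (cases "u = 0")
    case False
    then have u: "0 < u" using \<open>0 \<le> u\<close> by simp
    have "ln (c * u / p) \<le> c * u / p - 1" using u assms by (intro ln_le_minus_one) auto
    then have "p * (ln (c / p) + ln u) \<le> p * (c * u / p - 1)"
      using u assms ln_mult[of "c / p" u] by (intro mult_left_mono) auto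
    then have "p * ln u \<le> - p - p * ln (c / p) + c * u" using assms by (simp add: algebra_simps)
    then show ?thesis using u by (simp add: powr_def exp_add[symmetric])
  qed simp
qed

text \<open>\<open>L\<close> is any positive bound for the BMO seminorm, not the seminorm itself, so
  that the constants built from it may be divided by.\<close>

locale bmo_function = hom_space d M K \<theta> A Q \<kappa> n V
  for d :: "'a \<Rightarrow> 'a \<Rightarrow> real" and M K \<theta> A Q \<kappa> n V +
  fixes b :: "'a \<Rightarrow> complex" and L :: real
  assumes L_pos: "0 < L"
    and b_integrable: "0 < r \<Longrightarrow> set_integrable M (qball d x r) b"
    and b_oscillation: "0 < r \<Longrightarrow>
      (LINT y:qball d x r|M. cmod (b y - mean M (qball d x r) b)) \<le> L * measure M (qball d x r)"
begin

definition mb :: "'a \<Rightarrow> real \<Rightarrow> complex" where "mb x r = mean M (ball x r) b"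

definition S :: "real \<Rightarrow> real" where "S \<Lambda> = Q ^ 3 * \<Lambda> powr n"

lemma S_ge_1: "1 \<le> \<Lambda> \<Longrightarrow> 1 \<le> S \<Lambda>"
proof -
  assume "1 \<le> \<Lambda>"
  then have "1 \<le> \<Lambda> powr n" using n_nonneg by (intro ge_one_powr_ge_zero) auto
  moreover have "1 \<le> Q ^ 3" using Q_ge_1 by simp
  ultimately show ?thesis using mult_mono[of 1 "Q^3" 1 "\<Lambda> powr n"] Q_ge_1 by (simp add: S_def)
qed

lemma measure_ball_le_S: "0 < r \<Longrightarrow> 0 < s \<Longrightarrow> s \<le> \<Lambda> * r \<Longrightarrow> 1 \<le> \<Lambda> \<Longrightarrow>
    measure M (ball y s) \<le> S \<Lambda> * measure M (ball x r)"
  unfolding S_def by (rule measure_ball_le)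

lemma b_measurable [measurable]: "b \<in> borel_measurable M"
proof -
  fix x0 :: 'a
  have "(\<lambda>y. indicator (ball x0 (real (Suc k))) y *\<^sub>R b y) \<in> borel_measurable M" for k
    using b_integrable[of "real (Suc k)" x0] unfolding set_integrable_def
    by (intro borel_measurable_integrable) auto
  then show ?thesis
  proof (rule borel_measurable_LIMSEQ_metric)
    fix y
    have "\<forall>\<^sub>F k in sequentially. indicator (ball x0 (real (Suc k))) y *\<^sub>R b y = b y"
    proof -
      obtain m :: nat where "d x0 y < real m" using reals_Archimedean2 by blast
      then show ?thesis by (intro eventually_sequentiallyI[of m]) (auto split: split_indicator)
    qed
    then show "(\<lambda>k. indicator (ball x0 (real (Suc k))) y *\<^sub>R b y) \<longlonglongrightarrow> b y"
      by (rule tendsto_eventually)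
  qed
qed

lemma b_shift_integrable: "0 < r \<Longrightarrow> set_integrable M (ball x r) (\<lambda>y. b y - c)"
  using b_integrable[of r x] emeasure_ball_finite[of x r]
  by (intro set_integral_diff) (auto simp: set_integrable_def)

lemma oscillation:
  assumes "0 < r"
  shows "(\<integral>\<^sup>+y\<in>ball x r. ennreal (cmod (b y - mb x r)) \<partial>M) \<le> ennreal (L * measure M (ball x r))"
proof -
  have int: "integrable M (\<lambda>y. indicator (ball x r) y * cmod (b y - mb x r))"
    using integrable_norm[OF b_shift_integrable[OF assms, of x "mb x r", unfolded set_integrable_def]]
    by (simp add: abs_mult)
  have "(\<integral>\<^sup>+y\<in>ball x r. ennreal (cmod (b y - mb x r)) \<partial>M)
      = (\<integral>\<^sup>+y. ennreal (indicator (ball x r) y * cmod (b y - mb x r)) \<partial>M)"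
    by (intro nn_integral_cong) (auto split: split_indicator)
  also have "\<dots> = ennreal (LINT y:ball x r|M. cmod (b y - mb x r))"
    using int by (simp add: nn_integral_eq_integral set_lebesgue_integral_def)
  also have "\<dots> \<le> ennreal (L * measure M (ball x r))"
    using b_oscillation[OF assms, of x] by (intro ennreal_leI) (simp add: mb_def)
  finally show ?thesis .
qed

lemma mean_distance:
  assumes "0 < r"
  shows "ennreal (measure M (ball x r) * cmod (mb x r - c)) \<le> (\<integral>\<^sup>+y\<in>ball x r. ennreal (cmod (b y - c)) \<partial>M)"
proof -
  note pos = measure_qball_pos[OF assms, of x]
  have "(LINT y:ball x r|M. b y - c) = (LINT y:ball x r|M. b y) - (LINT y:ball x r|M. c)"
    using b_integrable[OF assms, of x] emeasure_ball_finite[of x r]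
    by (intro set_integral_diff) (auto simp: set_integrable_def)
  also have "(LINT y:ball x r|M. c) = measure M (ball x r) *\<^sub>R c"
    using emeasure_ball_finite[of x r] by (simp add: set_integral_const)
  finally have eq: "(LINT y:ball x r|M. b y - c) = measure M (ball x r) * (mb x r - c)"
    using pos by (simp add: mb_def mean_def scaleR_conv_of_real right_diff_distrib)
  have "ennreal (norm (LINT y:ball x r|M. b y - c))
      \<le> (\<integral>\<^sup>+y. ennreal (norm (indicator (ball x r) y *\<^sub>R (b y - c))) \<partial>M)"
    unfolding set_lebesgue_integral_def
    using b_shift_integrable[OF assms, of x c]
    by (intro integral_norm_bound_ennreal) (simp add: set_integrable_def)
  also have "\<dots> = (\<integral>\<^sup>+y\<in>ball x r. ennreal (cmod (b y - c)) \<partial>M)"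
    by (intro nn_integral_cong) (auto split: split_indicator)
  finally show ?thesis by (simp add: eq norm_mult)
qed

lemma mean_diff:
  assumes "0 < s" "0 < r" "ball y s \<subseteq> ball x r"
  shows "measure M (ball y s) * cmod (mb y s - mb x r) \<le> L * measure M (ball x r)"
proof -
  have "ennreal (measure M (ball y s) * cmod (mb y s - mb x r))
      \<le> (\<integral>\<^sup>+z\<in>ball y s. ennreal (cmod (b z - mb x r)) \<partial>M)"
    by (rule mean_distance[OF assms(1)])
  also have "\<dots> \<le> (\<integral>\<^sup>+z\<in>ball x r. ennreal (cmod (b z - mb x r)) \<partial>M)"
    using assms(3) by (intro nn_integral_mono) (auto split: split_indicator)
  also have "\<dots> \<le> ennreal (L * measure M (ball x r))" by (rule oscillation[OF assms(2)])
  finally show ?thesis using L_pos by (simp add: ennreal_le_iff)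
qed

lemma mean_diff_le:
  assumes "0 < s" "0 < r" "ball y s \<subseteq> ball x r" "r \<le> \<Lambda> * s" "1 \<le> \<Lambda>"
  shows "cmod (mb y s - mb x r) \<le> L * S \<Lambda>"
proof -
  have "measure M (ball y s) * cmod (mb y s - mb x r) \<le> L * measure M (ball x r)"
    by (rule mean_diff[OF assms(1-3)])
  also have "\<dots> \<le> L * (S \<Lambda> * measure M (ball y s))"
    using L_pos assms by (intro mult_left_mono measure_ball_le_S) auto
  also have "\<dots> = measure M (ball y s) * (L * S \<Lambda>)" by simp
  finally show ?thesis using measure_qball_pos[OF assms(1), of y] by simp
qed

text \<open>Stopping balls centred in \<open>ball x R\<close> may leave it, so the oscillation about
  the mean of the original ball is needed on a dilate. Changing the mean costs one more comparison
  of nested balls, which produces the square.\<close>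

lemma oscillation_dilated:
  assumes R: "0 < R" and \<Lambda>: "1 \<le> \<Lambda>"
  shows "(\<integral>\<^sup>+z\<in>ball x (\<Lambda> * R). ennreal (cmod (b z - mb x R)) \<partial>M)
    \<le> ennreal (L * (S \<Lambda> + S \<Lambda> ^ 2) * measure M (ball x R))"
proof -
  have pos: "0 < \<Lambda> * R" using assms by simp
  have sub: "ball x R \<subseteq> ball x (\<Lambda> * R)" using R \<Lambda> mult_right_mono[of 1 \<Lambda> R] by (intro ball_mono) auto
  have "(\<integral>\<^sup>+z\<in>ball x (\<Lambda> * R). ennreal (cmod (b z - mb x R)) \<partial>M)
    \<le> (\<integral>\<^sup>+z. ennreal (cmod (b z - mb x (\<Lambda> * R))) * indicator (ball x (\<Lambda> * R)) z
        + ennreal (cmod (mb x R - mb x (\<Lambda> * R))) * indicator (ball x (\<Lambda> * R)) z \<partial>M)"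
  proof (rule nn_integral_mono)
    fix z
    have "cmod (b z - mb x R) \<le> cmod (b z - mb x (\<Lambda> * R)) + cmod (mb x R - mb x (\<Lambda> * R))"
      using norm_triangle_ineq4[of "b z - mb x (\<Lambda> * R)" "mb x R - mb x (\<Lambda> * R)"] by simp
    then show "ennreal (cmod (b z - mb x R)) * indicator (ball x (\<Lambda> * R)) z
      \<le> ennreal (cmod (b z - mb x (\<Lambda> * R))) * indicator (ball x (\<Lambda> * R)) z
        + ennreal (cmod (mb x R - mb x (\<Lambda> * R))) * indicator (ball x (\<Lambda> * R)) z"
      by (auto split: split_indicator simp: ennreal_plus[symmetric] ennreal_leI simp del: ennreal_plus)
  qed
  also have "\<dots> = (\<integral>\<^sup>+z\<in>ball x (\<Lambda> * R). ennreal (cmod (b z - mb x (\<Lambda> * R))) \<partial>M)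
        + ennreal (cmod (mb x R - mb x (\<Lambda> * R))) * emeasure M (ball x (\<Lambda> * R))"
    by (subst nn_integral_add) (auto simp: nn_integral_cmult)
  also have "\<dots> \<le> ennreal (L * measure M (ball x (\<Lambda> * R))) + ennreal (L * S \<Lambda>) * emeasure M (ball x (\<Lambda> * R))"
    using assms pos sub
    by (intro add_mono oscillation mult_right_mono ennreal_leI mean_diff_le) auto
  also have "\<dots> = ennreal ((L + L * S \<Lambda>) * measure M (ball x (\<Lambda> * R)))"
    using pos L_pos S_ge_1[OF \<Lambda>]
    by (simp add: emeasure_ball ennreal_mult[symmetric] ennreal_plus[symmetric] distrib_right del: ennreal_plus)
  also have "\<dots> \<le> ennreal ((L + L * S \<Lambda>) * (S \<Lambda> * measure M (ball x R)))"
    using assms pos L_pos S_ge_1[OF \<Lambda>]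
    by (intro ennreal_leI mult_left_mono measure_ball_le_S) auto
  also have "(L + L * S \<Lambda>) * (S \<Lambda> * measure M (ball x R)) = L * (S \<Lambda> + S \<Lambda> ^ 2) * measure M (ball x R)"
    by (simp add: algebra_simps power2_eq_square)
  finally show ?thesis .
qed

text \<open>The level at which the Vitali cover by dilated stopping balls has at most half the
  measure of the original ball: \<open>CV\<close> is the cost of covering, the bracket with
  \<open>L\<close> bounds the oscillation on the \<open>2 * K\<close> dilate, and 2 is the
  halving.\<close>

definition jn_level :: real where "jn_level = 2 * CV * (S (2 * K) + S (2 * K) ^ 2) * L"
text \<open>The extra factor is the one demanded by \<open>lebesgue_density_bounded\<close>: where
  the oscillation exceeds \<open>jn_scale\<close>, almost every point has small balls of average
  above \<open>jn_level\<close>.\<close>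

definition jn_scale :: real where "jn_scale = 2 * CV * jn_level"

lemma jn_level_pos: "0 < jn_level"
  using S_ge_1[of "2 * K"] K0_ge_1 CV_ge_1 L_pos by (auto simp: jn_level_def intro!: mult_pos_pos add_pos_pos)

lemma jn_level_le_scale: "jn_level \<le> jn_scale"
  using mult_right_mono[of 1 "2 * CV" jn_level] CV_ge_1 jn_level_pos by (simp add: jn_scale_def)

lemma jn_scale_pos: "0 < jn_scale" using jn_level_pos jn_level_le_scale by linarith

text \<open>The stopping ball at \<open>y\<close>: up to a factor the largest one on which the average of \<open>\<bar>b - b\<^sub>B\<bar>\<close>
  exceeds the level, so that the average over its dilate no longer does.\<close>

lemma john_nirenberg_radii:
  fixes x R
  defines "\<nu> \<equiv> density M (\<lambda>z. ennreal (cmod (b z - mb x R)))"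
  assumes R: "0 < R" and y: "y \<in> ball x R"
    and ex: "\<exists>r>0. r < R \<and> ennreal jn_level * emeasure M (ball y r) < emeasure \<nu> (ball y r)"
  shows "\<exists>r>0. 4 * K * r \<le> R \<and> ball y r \<subseteq> ball x (2 * K * R) \<and>
    ennreal jn_level * emeasure M (ball y r) \<le> emeasure \<nu> (ball y r) \<and>
    cmod (mb y (4 * K * r) - mb x R) \<le> jn_level"
proof -
  define P where "P r \<longleftrightarrow> 0 < r \<and> r \<le> R \<and> ennreal jn_level * emeasure M (ball y r) < emeasure \<nu> (ball y r)" for r
  have \<nu>: "emeasure \<nu> (ball z r) = (\<integral>\<^sup>+z\<in>ball z r. ennreal (cmod (b z - mb x R)) \<partial>M)" for z r
    unfolding \<nu>_def by (rule emeasure_density) auto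
  have bdd: "bdd_above (Collect P)" by (auto simp: bdd_above_def P_def)
  have ne: "Collect P \<noteq> {}" using ex by (auto simp: P_def intro: less_imp_le)
  define s where "s = Sup (Collect P)"
  have s: "r \<le> s" if "P r" for r using that bdd by (auto simp: s_def intro: cSup_upper)
  obtain r0 where "P r0" using ne by auto
  then have "0 < s" using s[of r0] by (auto simp: P_def)
  then have "s / 2 < s" by simp
  \<comment> \<open>More than half of the supremum is enough: \<open>4 * K\<close> exceeds 2, so the
    dilated radius lies beyond \<open>s\<close>.\<close>
  then obtain r where r: "P r" "s / 2 < r"
    using less_cSup_iff[OF ne bdd, of "s / 2"] by (auto simp: s_def)
  have r0: "0 < r" "r \<le> R" using r by (auto simp: P_def)
  have sub: "ball y r \<subseteq> ball x (2 * K * R)"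
    using y r0 K_pos by (intro ball_subset[of x y R]) auto
  have big: "emeasure \<nu> (ball x (2 * K * R)) \<le> ennreal (jn_level / (2 * CV) * measure M (ball x R))"
    using oscillation_dilated[OF R, of "2 * K" x] K0_ge_1 CV_ge_1
    by (simp add: \<nu> jn_level_def mult_ac)
  \<comment> \<open>Ensures that \<open>P (4 * K * r)\<close> fails because of the average and not
    because of the bound on the radius. Otherwise \<open>ball y r\<close> would carry a fixed share
    of \<open>ball x R\<close>, and its average could not exceed the level.\<close>
  have le: "4 * K * r \<le> R"
  proof (rule ccontr)
    assume "\<not> ?thesis"
    then have "measure M (ball x R) \<le> CV * measure M (ball y r)"
      unfolding CV_def using r0 K0_ge_1 R by (intro measure_ball_le) auto
    then have "jn_level / (2 * CV) * measure M (ball x R) \<le> jn_level / (2 * CV) * (CV * measure M (ball y r))"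
      using CV_ge_1 jn_level_pos by (intro mult_left_mono) auto
    also have "\<dots> \<le> jn_level * measure M (ball y r)"
      using CV_ge_1 jn_level_pos measure_nonneg[of M "ball y r"] by simp
    finally have "emeasure \<nu> (ball x (2 * K * R)) \<le> ennreal (jn_level * measure M (ball y r))"
      using big by (meson ennreal_leI order_trans)
    moreover have "emeasure \<nu> (ball y r) \<le> emeasure \<nu> (ball x (2 * K * R))"
      using sub by (intro emeasure_mono) (auto simp: \<nu>_def)
    ultimately show False using r(1) jn_level_pos r0
      by (auto simp: P_def emeasure_ball ennreal_mult[symmetric] dest: order.trans)
  qed
  have "s < 4 * K * r" using r(2) r0 K0_ge_1 mult_right_mono[of 2 "4 * K" r] by linarith
  then have "\<not> P (4 * K * r)" using s[of "4 * K * r"] by auto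
  moreover have K4: "0 < 4 * K * r" using K_pos r0 by simp
  ultimately have "emeasure \<nu> (ball y (4 * K * r)) \<le> ennreal jn_level * emeasure M (ball y (4 * K * r))"
    using le by (auto simp: P_def not_less)
  then have "ennreal (measure M (ball y (4 * K * r)) * cmod (mb y (4 * K * r) - mb x R))
      \<le> ennreal (jn_level * measure M (ball y (4 * K * r)))"
    using mean_distance[OF K4, of y "mb x R"] K4 jn_level_pos
    unfolding \<nu> emeasure_ball[OF K4] by (simp add: ennreal_mult less_imp_le)
  then have "measure M (ball y (4 * K * r)) * cmod (mb y (4 * K * r) - mb x R)
      \<le> measure M (ball y (4 * K * r)) * jn_level"
    using jn_level_pos by (simp add: ennreal_le_iff mult_ac)
  then have "cmod (mb y (4 * K * r) - mb x R) \<le> jn_level"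
    using measure_qball_pos[OF K4, of y] by simp
  then show ?thesis using r(1) le sub by (auto simp: P_def intro!: exI[of _ r])
qed

lemma level_set_measurable: "{z \<in> ball x r. c < cmod (b z - c')} \<in> sets M"
proof -
  have meas: "{z \<in> space M. c < cmod (b z - c')} \<in> sets M" by measurable
  have eq: "{z \<in> ball x r. c < cmod (b z - c')} = ball x r \<inter> {z \<in> space M. c < cmod (b z - c')}"
    by (auto simp: space_UNIV)
  show ?thesis unfolding eq by (rule sets.Int[OF sets_ball meas])
qed

text \<open>Calderon-Zygmund stopping: almost all of the level set lies in dilated stopping balls
  whose own means differ from the mean of the large ball by at most \<open>jn_level\<close>.
  Lowering the level by \<open>jn_scale\<close> pays for this change of mean, so the induction
  hypothesis applies on each of these balls, and their total measure is at most half.\<close>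

lemma john_nirenberg:
  "0 < R \<Longrightarrow> emeasure M {z \<in> ball x R. real k * jn_scale < cmod (b z - mb x R)}
    \<le> ennreal ((1/2) ^ k) * emeasure M (ball x R)"
proof (induction k arbitrary: x R)
  case 0
  show ?case by (simp, intro emeasure_mono) auto
next
  case (Suc k)
  define \<nu> where "\<nu> = density M (\<lambda>z. ennreal (cmod (b z - mb x R)))"
  have \<nu>s: "sets \<nu> = sets M" by (simp add: \<nu>_def)
  note meas = level_set_measurable
  define E where "E = {z \<in> ball x R. real (Suc k) * jn_scale < cmod (b z - mb x R)}"
  define G where "G = {z \<in> ball x R. jn_scale < cmod (b z - mb x R)}"
  have "1 * jn_scale \<le> real (Suc k) * jn_scale"
    using jn_scale_pos by (intro mult_right_mono) auto
  then have EG: "E \<subseteq> G"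
    unfolding E_def G_def by (auto simp del: of_nat_Suc)
  have "\<exists>N\<in>null_sets M. \<forall>z\<in>G - N. \<exists>r>0. r < R \<and> ennreal jn_level * emeasure M (ball z r) < emeasure \<nu> (ball z r)"
  proof (rule lebesgue_density_bounded[OF \<nu>s jn_level_pos Suc.prems])
    show "G \<in> sets M" "G \<subseteq> ball x R" unfolding G_def by (rule meas) auto
    fix T assume T: "T \<in> sets M" "T \<subseteq> G"
    have "ennreal (2 * CV * jn_level) * emeasure M T = (\<integral>\<^sup>+z. ennreal (2 * CV * jn_level) * indicator T z \<partial>M)"
      using T by (simp add: nn_integral_cmult)
    also have "\<dots> \<le> (\<integral>\<^sup>+z\<in>T. ennreal (cmod (b z - mb x R)) \<partial>M)"
      using T by (intro nn_integral_mono) (auto split: split_indicator simp: G_def jn_scale_def intro!: ennreal_leI)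
    also have "\<dots> = emeasure \<nu> T" unfolding \<nu>_def using T by (intro emeasure_density[symmetric]) auto
    finally show "ennreal (2 * CV * jn_level) * emeasure M T \<le> emeasure \<nu> T" .
  qed
  then obtain N where N: "N \<in> null_sets M" and
    dens: "\<And>z. z \<in> G - N \<Longrightarrow> \<exists>r>0. r < R \<and> ennreal jn_level * emeasure M (ball z r) < emeasure \<nu> (ball z r)"
    by blast
  have "\<exists>r>0. 4 * K * r \<le> R \<and> ball y r \<subseteq> ball x (2 * K * R) \<and>
      ennreal jn_level * emeasure M (ball y r) \<le> emeasure \<nu> (ball y r) \<and>
      cmod (mb y (4 * K * r) - mb x R) \<le> jn_level" if "y \<in> E - N" for y
  proof -
    have "y \<in> G - N" "y \<in> ball x R" using that EG by (auto simp: E_def)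
    then show ?thesis
      using john_nirenberg_radii[OF Suc.prems, of y x] dens[of y] unfolding \<nu>_def by blast
  qed
  then obtain r where r: "\<And>y. y \<in> E - N \<Longrightarrow> 0 < r y" "\<And>y. y \<in> E - N \<Longrightarrow> 4 * K * r y \<le> R"
    "\<And>y. y \<in> E - N \<Longrightarrow> ball y (r y) \<subseteq> ball x (2 * K * R)"
    "\<And>y. y \<in> E - N \<Longrightarrow> ennreal jn_level * emeasure M (ball y (r y)) \<le> emeasure \<nu> (ball y (r y))"
    "\<And>y. y \<in> E - N \<Longrightarrow> cmod (mb y (4 * K * r y) - mb x R) \<le> jn_level"
    by metis
  have rR: "r y \<le> R / (4 * K)" if "y \<in> E - N" for y
    using r(2)[OF that] K_pos by (simp add: field_simps)
  obtain F where F: "F \<subseteq> E - N" "countable F" "E - N \<subseteq> (\<Union>y\<in>F. ball y (4 * K * r y))"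
    "ennreal jn_level * (\<integral>\<^sup>+y. emeasure M (ball y (4 * K * r y)) \<partial>count_space F)
      \<le> ennreal CV * emeasure \<nu> (ball x (2 * K * R))"
    by (rule vitali_covering[of "E - N" r "R / (4 * K)" \<nu> "ball x (2 * K * R)" "ennreal jn_level"])
      (use r rR \<nu>s in auto)
  have part: "emeasure M (E \<inter> ball y (4 * K * r y)) \<le> ennreal ((1/2) ^ k) * emeasure M (ball y (4 * K * r y))"
    if "y \<in> F" for y
  proof -
    have y: "y \<in> E - N" using that F by auto
    have "E \<inter> ball y (4 * K * r y) \<subseteq> {z \<in> ball y (4 * K * r y). real k * jn_scale < cmod (b z - mb y (4 * K * r y))}"
    proof
      fix z assume z: "z \<in> E \<inter> ball y (4 * K * r y)"
      have "cmod (b z - mb x R) \<le> cmod (b z - mb y (4 * K * r y)) + cmod (mb y (4 * K * r y) - mb x R)"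
        using norm_triangle_ineq[of "b z - mb y (4 * K * r y)" "mb y (4 * K * r y) - mb x R"] by simp
      moreover have "real (Suc k) * jn_scale < cmod (b z - mb x R)" using z by (simp add: E_def)
      ultimately show "z \<in> {z \<in> ball y (4 * K * r y). real k * jn_scale < cmod (b z - mb y (4 * K * r y))}"
        using z r(5)[OF y] jn_level_le_scale by (auto simp: algebra_simps)
    qed
    then have "emeasure M (E \<inter> ball y (4 * K * r y)) \<le>
        emeasure M {z \<in> ball y (4 * K * r y). real k * jn_scale < cmod (b z - mb y (4 * K * r y))}"
      by (intro emeasure_mono meas)
    also have "\<dots> \<le> ennreal ((1/2) ^ k) * emeasure M (ball y (4 * K * r y))"
      using r(1)[OF y] K_pos by (intro Suc.IH) auto
    finally show ?thesis .
  qed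
  have Em: "E \<in> sets M" unfolding E_def by (rule meas)
  have "ennreal jn_level * (\<integral>\<^sup>+y. emeasure M (ball y (4 * K * r y)) \<partial>count_space F)
      \<le> ennreal CV * ennreal (L * (S (2 * K) + S (2 * K) ^ 2) * measure M (ball x R))"
    by (rule order_trans[OF F(4)], rule mult_left_mono)
      (use oscillation_dilated[OF Suc.prems, of "2 * K" x] K0_ge_1 in \<open>auto simp: \<nu>_def emeasure_density\<close>)
  also have "\<dots> = ennreal jn_level * ennreal (measure M (ball x R) / 2)"
    using CV_ge_1 L_pos S_ge_1[of "2 * K"] K0_ge_1
    by (simp add: jn_level_def ennreal_mult[symmetric] mult_ac)
  finally have half: "(\<integral>\<^sup>+y. emeasure M (ball y (4 * K * r y)) \<partial>count_space F) \<le> ennreal (measure M (ball x R) / 2)"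
    using jn_level_pos by (simp add: ennreal_mult_le_mult_iff)
  have "emeasure M E = emeasure M (E - N)"
    using N Em by (simp add: emeasure_Diff_null_set)
  also have "\<dots> \<le> emeasure M (\<Union>y\<in>F. E \<inter> ball y (4 * K * r y))"
    using F Em by (intro emeasure_mono sets.countable_UN') auto
  also have "\<dots> \<le> (\<integral>\<^sup>+y. emeasure M (E \<inter> ball y (4 * K * r y)) \<partial>count_space F)"
    using F Em by (intro emeasure_UN_le_nn_integral) auto
  also have "\<dots> \<le> (\<integral>\<^sup>+y. ennreal ((1/2) ^ k) * emeasure M (ball y (4 * K * r y)) \<partial>count_space F)"
    using part by (intro nn_integral_mono) auto
  also have "\<dots> = ennreal ((1/2) ^ k) * (\<integral>\<^sup>+y. emeasure M (ball y (4 * K * r y)) \<partial>count_space F)"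
    by (rule nn_integral_cmult) simp
  also have "\<dots> \<le> ennreal ((1/2) ^ k) * ennreal (measure M (ball x R) / 2)"
    by (intro mult_left_mono half) auto
  also have "\<dots> = ennreal ((1/2) ^ Suc k) * emeasure M (ball x R)"
    using Suc.prems by (simp add: emeasure_ball ennreal_mult[symmetric])
  finally show ?case unfolding E_def .
qed

text \<open>Chosen so that the exponential grows by the factor 3/2 per step of
  \<open>jn_scale\<close>, while the level sets shrink by 1/2; the resulting ratio is 3/4.\<close>

definition jn_exp :: real where "jn_exp = ln (3/2) / jn_scale"

lemma jn_exp_pos: "0 < jn_exp" using jn_scale_pos by (simp add: jn_exp_def)

text \<open>Summation over the level sets: 7 is 1 for the ball itself plus the geometric series
  (3/2) / (1 - 3/4) = 6.\<close>

lemma exp_integrability: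
  assumes R: "0 < R"
  shows "(\<integral>\<^sup>+z\<in>ball x R. ennreal (exp (jn_exp * cmod (b z - mb x R))) \<partial>M) \<le> 7 * emeasure M (ball x R)"
proof -
  define E where "E k = {z \<in> ball x R. real k * jn_scale < cmod (b z - mb x R)}" for k :: nat
  have [measurable]: "E k \<in> sets M" for k unfolding E_def by (rule level_set_measurable)
  have "(\<integral>\<^sup>+z\<in>ball x R. ennreal (exp (jn_exp * cmod (b z - mb x R))) \<partial>M)
    \<le> (\<integral>\<^sup>+z. indicator (ball x R) z + (\<Sum>k. ennreal ((3/2) ^ Suc k) * indicator (E k) z) \<partial>M)"
  proof (rule nn_integral_mono)
    fix z
    define u where "u = cmod (b z - mb x R)"
    show "ennreal (exp (jn_exp * cmod (b z - mb x R))) * indicator (ball x R) z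
      \<le> indicator (ball x R) z + (\<Sum>k. ennreal ((3/2) ^ Suc k) * indicator (E k) z)"
    proof (cases "z \<in> ball x R \<and> 0 < u")
      case True
      \<comment> \<open>The ceiling minus 1 is the last level strictly below \<open>u\<close>, as
        the sets \<open>E k\<close> are defined by a strict inequality.\<close>
      define k where "k = nat (\<lceil>u / jn_scale\<rceil> - 1)"
      have "0 < u / jn_scale" using True jn_scale_pos by simp
      then have "real k < u / jn_scale" "u / jn_scale \<le> real (Suc k)"
        unfolding k_def by linarith+
      then have k: "real k * jn_scale < u" "u \<le> real (Suc k) * jn_scale"
        using jn_scale_pos by (auto simp: field_simps)
      have "jn_exp * u \<le> jn_exp * (real (Suc k) * jn_scale)"
        using k(2) jn_exp_pos by (intro mult_left_mono) auto
      also have "\<dots> = real (Suc k) * ln (3/2)" using jn_scale_pos by (simp add: jn_exp_def)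
      finally have "exp (jn_exp * u) \<le> exp (real (Suc k) * ln (3/2))" by simp
      also have "\<dots> = (3/2) ^ Suc k" by (subst exp_of_nat_mult) simp
      finally have "ennreal (exp (jn_exp * u)) \<le> (\<Sum>i\<in>{k}. ennreal ((3/2) ^ Suc i) * indicator (E i) z)"
        using k(1) True by (auto simp: E_def u_def intro!: ennreal_leI)
      also have "\<dots> \<le> (\<Sum>i. ennreal ((3/2) ^ Suc i) * indicator (E i) z)"
        by (rule sum_le_suminf) auto
      finally show ?thesis using True by (simp add: u_def add_increasing)
    next
      case False
      then have "z \<notin> ball x R \<or> u = 0" by (auto simp: u_def)
      then show ?thesis by (auto simp: u_def split: split_indicator)
    qed
  qed
  also have "\<dots> = emeasure M (ball x R) + (\<Sum>k. ennreal ((3/2) ^ Suc k) * emeasure M (E k))"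
    by (subst nn_integral_add) (auto simp: nn_integral_suminf nn_integral_cmult)
  also have "(\<Sum>k. ennreal ((3/2) ^ Suc k) * emeasure M (E k))
     \<le> (\<Sum>k. ennreal ((3/2) ^ Suc k) * (ennreal ((1/2) ^ k) * emeasure M (ball x R)))"
    unfolding E_def by (intro suminf_le mult_left_mono john_nirenberg R) auto
  also have "\<dots> = (\<Sum>k. ennreal ((3/2) * (3/4) ^ k) * emeasure M (ball x R))"
  proof (rule suminf_cong)
    fix k
    have "(3/4::real) ^ k = (3/2) ^ k * (1/2) ^ k" by (simp flip: power_mult_distrib)
    then have "(3/2) ^ Suc k * (1/2) ^ k = (3/2) * (3/4::real) ^ k" by simp
    then show "ennreal ((3/2) ^ Suc k) * (ennreal ((1/2) ^ k) * emeasure M (ball x R))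
      = ennreal ((3/2) * (3/4) ^ k) * emeasure M (ball x R)"
      by (simp only: mult.assoc[symmetric] ennreal_mult[symmetric] zero_le_power zero_le_divide_iff
          zero_le_numeral zero_le_one simp_thms)
  qed
  also have "\<dots> = (\<Sum>k. ennreal ((3/2) * (3/4) ^ k)) * emeasure M (ball x R)"
    by (rule ennreal_suminf_multc)
  also have "(\<Sum>k. ennreal ((3/2) * (3/4) ^ k)) = ennreal 6"
  proof (rule suminf_ennreal_eq)
    have "(\<lambda>k. (3/2) * (3/4) ^ k) sums ((3/2) * (1 / (1 - 3/4 :: real)))"
      by (intro sums_mult geometric_sums) auto
    then show "(\<lambda>k. (3/2) * (3/4) ^ k) sums (6 :: real)" by simp
  qed auto
  finally show ?thesis using distrib_right[of "1::ennreal" 6 "emeasure M (ball x R)"] by simp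
qed

section \<open>Logarithmic growth of means\<close>

lemma mean_diff_concentric:
  assumes "0 < r" "r \<le> s"
  shows "cmod (mb x s - mb x r) \<le> L * S 2 / ln 2 * (1 + ln (s / r))"
proof -
  have it: "cmod (mb x (2 ^ k * r) - mb x r) \<le> real k * (L * S 2)" for k :: nat
  proof (induction k)
    case (Suc k)
    have "cmod (mb x (2 ^ k * r) - mb x (2 ^ Suc k * r)) \<le> L * S 2"
      using assms by (intro mean_diff_le) (auto intro!: ball_mono)
    then have "cmod (mb x (2 ^ Suc k * r) - mb x (2 ^ k * r)) \<le> L * S 2"
      by (simp add: norm_minus_commute)
    then show ?case
      using Suc norm_triangle_ineq[of "mb x (2 ^ Suc k * r) - mb x (2 ^ k * r)" "mb x (2 ^ k * r) - mb x r"]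
      by (simp add: algebra_simps)
  qed simp
  have sr: "1 \<le> s / r" using assms by simp
  \<comment> \<open>Rounded down, so that the dyadic ball lies inside the ball of radius
    \<open>s\<close> and is at most a factor 2 smaller; one more comparison of nested balls
    finishes.\<close>
  define k where "k = nat \<lfloor>log 2 (s / r)\<rfloor>"
  have "0 \<le> log 2 (s / r)" using sr by simp
  then have k: "real k \<le> log 2 (s / r)" "log 2 (s / r) < real k + 1" unfolding k_def by linarith+
  have e: "s / r = 2 powr log 2 (s / r)" using sr by simp
  have "2 ^ k = 2 powr real k" by (simp add: powr_realpow)
  also have "\<dots> \<le> s / r" by (subst e) (use k in \<open>auto intro: powr_mono\<close>)
  finally have lo: "2 ^ k * r \<le> s" using assms by (simp add: field_simps)
  have "s / r \<le> 2 powr (real k + 1)" by (subst e) (use k in \<open>auto intro!: powr_mono\<close>)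
  also have "\<dots> = 2 * 2 ^ k" by (simp add: powr_add powr_realpow)
  finally have hi: "s \<le> 2 * (2 ^ k * r)" using assms by (simp add: field_simps)
  have "cmod (mb x (2 ^ k * r) - mb x s) \<le> L * S 2"
    using assms lo hi by (intro mean_diff_le ball_mono) auto
  then have "cmod (mb x s - mb x (2 ^ k * r)) \<le> L * S 2" by (simp add: norm_minus_commute)
  then have "cmod (mb x s - mb x r) \<le> (real k + 1) * (L * S 2)"
    using it[of k] norm_triangle_ineq[of "mb x s - mb x (2 ^ k * r)" "mb x (2 ^ k * r) - mb x r"]
    by (simp add: algebra_simps)
  also have "\<dots> \<le> ((1 + ln (s / r)) / ln 2) * (L * S 2)"
  proof (rule mult_right_mono)
    have "ln 2 \<le> (1::real)" using ln_le_minus_one[of 2] by simp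
    then have "1 \<le> 1 / ln (2::real)" by (subst le_divide_eq_1_pos) auto
    moreover have "(1 + ln (s / r)) / ln 2 = 1 / ln 2 + log 2 (s / r)" by (simp add: log_def add_divide_distrib)
    ultimately show "real k + 1 \<le> (1 + ln (s / r)) / ln 2" using k(1) by linarith
  qed (use L_pos S_ge_1[of 2] in auto)
  finally show ?thesis by (simp add: mult_ac)
qed

text \<open>The chain of means leads from \<open>ball x r\<close> to \<open>ball x s\<close>, into
  \<open>ball x0 (2 * K * s)\<close>, down to \<open>ball x0 s\<close> and on to the unit ball at
  \<open>x0\<close>. Logarithms arise only from the two long changes of radius at a fixed centre;
  the other links cost constants.\<close>

lemma mean_growth:
  fixes x0 :: 'a
  shows "\<exists>C>0. \<forall>x r s. 0 < r \<longrightarrow> r \<le> s \<longrightarrow> 1 \<le> s \<longrightarrow> d x0 x \<le> s \<longrightarrow>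
    cmod (mb x r) \<le> C * (1 + ln (s / r) + ln s)"
proof -
  define C1 where "C1 = L * S 2 / ln 2"
  define C where "C = cmod (mb x0 1) + 2 * C1 + 2 * L * S (2 * K)"
  have C1: "0 < C1" using L_pos S_ge_1[of 2] by (simp add: C1_def)
  have S2: "0 < L * S (2 * K)" using L_pos S_ge_1[of "2 * K"] K0_ge_1 by simp
  have "cmod (mb x r) \<le> C * (1 + ln (s / r) + ln s)"
    if r: "0 < r" "r \<le> s" and s: "1 \<le> s" "d x0 x \<le> s" for x r s
  proof -
    have l: "0 \<le> ln (s / r)" "0 \<le> ln s" using r s by auto
    have "cmod (mb x s - mb x r) \<le> C1 * (1 + ln (s / r))"
      unfolding C1_def by (rule mean_diff_concentric[OF r])
    moreover have "cmod (mb x0 s - mb x0 1) \<le> C1 * (1 + ln (s / 1))"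
      unfolding C1_def using s by (intro mean_diff_concentric) auto
    moreover have "cmod (mb x s - mb x0 (2 * K * s)) \<le> L * S (2 * K)"
      using s K_pos K0_ge_1 by (intro mean_diff_le ball_subset[of x0 x s]) auto
    moreover have "cmod (mb x0 s - mb x0 (2 * K * s)) \<le> L * S (2 * K)"
      using s K_pos K0_ge_1 mult_right_mono[of 1 "2 * K" s] by (intro mean_diff_le ball_mono) auto
    moreover have "cmod (mb x r) \<le> cmod (mb x s - mb x r) + cmod (mb x s - mb x0 (2 * K * s))
        + cmod (mb x0 s - mb x0 (2 * K * s)) + cmod (mb x0 s - mb x0 1) + cmod (mb x0 1)"
    proof -
      have "mb x r = - (mb x s - mb x r) + (mb x s - mb x0 (2 * K * s))
        - (mb x0 s - mb x0 (2 * K * s)) + (mb x0 s - mb x0 1) + mb x0 1" by simp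
      then show ?thesis
        by (smt (verit, best) norm_minus_cancel norm_triangle_ineq norm_triangle_ineq4)
    qed
    ultimately have "cmod (mb x r) \<le> cmod (mb x0 1) * 1 + C1 * (2 + ln (s / r) + ln s) + 2 * (L * S (2 * K)) * 1"
      by (simp add: algebra_simps)
    also have "\<dots> \<le> cmod (mb x0 1) * (1 + ln (s / r) + ln s) + C1 * (2 * (1 + ln (s / r) + ln s))
        + 2 * (L * S (2 * K)) * (1 + ln (s / r) + ln s)"
      using l C1 S2 by (intro add_mono mult_left_mono) auto
    also have "\<dots> = C * (1 + ln (s / r) + ln s)" by (simp add: C_def algebra_simps)
    finally show ?thesis .
  qed
  moreover have "0 < C" using C1 S2 by (auto simp: C_def intro: add_nonneg_pos)
  ultimately show ?thesis by blast
qed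

end

section \<open>Test functions\<close>

text \<open>Lets a family of bounds pass to the infimum, so that the infimum defining a test norm is
  itself an admissible bound.\<close>

lemma le_Inf_mult:
  fixes u X :: real
  assumes "T \<noteq> {}" "\<And>C. C \<in> T \<Longrightarrow> u \<le> C * X" "0 \<le> X"
  shows "u \<le> Inf T * X"
proof (cases "X = 0")
  case True
  then show ?thesis using assms(1,2) by auto
next
  case False
  then have "0 < X" using assms by simp
  then have "u / X \<le> Inf T" using assms by (intro cInf_greatest) (auto simp: field_simps)
  then show ?thesis using \<open>0 < X\<close> by (simp add: field_simps)
qed

context hom_space
begin

text \<open>The size profile common to both conditions on test functions: up to constants an
  L^1-normalised bump at \<open>x\<close> of scale \<open>r\<close> with tail exponent
  \<open>g\<close>.\<close>

definition tw :: "real \<Rightarrow> 'a \<Rightarrow> real \<Rightarrow> 'a \<Rightarrow> real" where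
  "tw g x r y = 1 / measure M (ball y (r + d x y)) * (r / (r + d x y)) powr g"

abbreviation tb where "tb \<equiv> test_bound d M K"

lemma test_bound_iff: "tb x r a g \<phi> C \<longleftrightarrow> (\<forall>y. cmod (\<phi> y) \<le> C * tw g x r y) \<and>
   (\<forall>y z. d y z \<le> (r + d x y) / (2 * K) \<longrightarrow>
      cmod (\<phi> y - \<phi> z) \<le> C * ((d y z / (r + d x y)) powr a * tw g x r y))"
  unfolding test_bound_def tw_def by (simp add: dist_commute[of _ x] mult.assoc)

lemma test_boundI:
  assumes "\<And>y. cmod (\<phi> y) \<le> C * tw g x r y"
    "\<And>y z. d y z \<le> (r + d x y) / (2 * K) \<Longrightarrow>
      cmod (\<phi> y - \<phi> z) \<le> C * ((d y z / (r + d x y)) powr a * tw g x r y)"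
  shows "tb x r a g \<phi> C"
  using assms by (simp add: test_bound_iff)

lemma test_bound_size: "tb x r a g \<phi> C \<Longrightarrow> cmod (\<phi> y) \<le> C * tw g x r y"
  by (simp add: test_bound_iff)

lemma test_bound_diff: "tb x r a g \<phi> C \<Longrightarrow> d y z \<le> (r + d x y) / (2 * K) \<Longrightarrow>
      cmod (\<phi> y - \<phi> z) \<le> C * ((d y z / (r + d x y)) powr a * tw g x r y)"
  by (simp add: test_bound_iff)

lemma radius_pos: "0 < r \<Longrightarrow> 0 < r + d x y" using dist_nonneg[of x y] by simp

lemma tw_pos: "0 < r \<Longrightarrow> 0 < tw g x r y"
  unfolding tw_def using radius_pos[of r x y] measure_qball_pos[of "r + d x y" y] by simp

lemma tw_nonneg: "0 < r \<Longrightarrow> 0 \<le> tw g x r y" using tw_pos less_imp_le by blast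

lemma tw_le_V: "0 < r \<Longrightarrow> tw g x r y \<le> Q * (r / (r + d x y)) powr g / V (r + d x y)"
proof -
  assume r: "0 < r"
  note p = radius_pos[OF r, of x y]
  have "1 / measure M (ball y (r + d x y)) \<le> Q / V (r + d x y)"
    using V_le_measure[OF p, of y] V_pos[OF p] measure_qball_pos[OF p, of y] by (simp add: field_simps)
  then show ?thesis unfolding tw_def
    using mult_right_mono[of _ _ "(r / (r + d x y)) powr g"] by fastforce
qed

lemma tw_le: "0 < r \<Longrightarrow> 0 < g \<Longrightarrow> tw g x r y \<le> Q / V r"
proof -
  assume r: "0 < r" and g: "0 < g"
  note p = radius_pos[OF r, of x y]
  have "tw g x r y \<le> Q * (r / (r + d x y)) powr g / V (r + d x y)" by (rule tw_le_V[OF r])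
  also have "\<dots> \<le> Q * 1 / V r"
    using p r g Q_ge_1 V_pos[OF r] V_mono[OF r, of "r + d x y"] dist_nonneg[of x y]
    by (intro frac_le mult_left_mono powr_le1) auto
  finally show ?thesis by simp
qed

lemma test_bound_nonneg: "0 < r \<Longrightarrow> tb x r a g \<phi> C \<Longrightarrow> 0 \<le> C"
  using test_bound_size[of x r a g \<phi> C x] tw_pos[of r g x x] order_trans[OF norm_ge_zero[of "\<phi> x"]]
  by (fastforce simp: zero_le_mult_iff)

lemma test_bound_mono:
  assumes r: "0 < r" and \<phi>: "tb x r a g \<phi> C" and C: "C \<le> C'"
  shows "tb x r a g \<phi> C'"
proof (rule test_boundI)
  fix y
  show "cmod (\<phi> y) \<le> C' * tw g x r y"
    using test_bound_size[OF \<phi>, of y] mult_right_mono[OF C tw_nonneg[OF r, of g x y]] by linarith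
  fix z assume z: "d y z \<le> (r + d x y) / (2 * K)"
  have "0 \<le> (d y z / (r + d x y)) powr a * tw g x r y" using tw_nonneg[OF r] by simp
  from mult_right_mono[OF C this]
  show "cmod (\<phi> y - \<phi> z) \<le> C' * ((d y z / (r + d x y)) powr a * tw g x r y)"
    using test_bound_diff[OF \<phi> z] by linarith
qed

lemma test_bound_test_norm:
  assumes r: "0 < r" and \<phi>: "\<phi> \<in> test_space d M K x r a g"
  shows "tb x r a g \<phi> (test_norm d M K x r a g \<phi>)"
proof -
  have ne: "{C. tb x r a g \<phi> C} \<noteq> {}" using \<phi> by (auto simp: test_space_def)
  show ?thesis unfolding test_norm_def
    using tw_nonneg[OF r, of g x] ne
    by (intro test_boundI le_Inf_mult) (auto dest: test_bound_size test_bound_diff)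
qed

lemma test_norm_le: "0 < r \<Longrightarrow> tb x r a g \<phi> C \<Longrightarrow> test_norm d M K x r a g \<phi> \<le> C"
  unfolding test_norm_def
  by (rule cInf_lower) (auto simp: bdd_below_def intro: exI[of _ 0] test_bound_nonneg)

lemma test_norm_nonneg: "0 < r \<Longrightarrow> \<phi> \<in> test_space d M K x r a g \<Longrightarrow> 0 \<le> test_norm d M K x r a g \<phi>"
  using test_bound_nonneg test_bound_test_norm by blast

lemma test_bound_add:
  assumes "tb x r a g \<phi> C" "tb x r a g \<psi> C'"
  shows "tb x r a g (\<lambda>y. \<phi> y + \<psi> y) (C + C')"
proof (rule test_boundI)
  fix y
  show "cmod (\<phi> y + \<psi> y) \<le> (C + C') * tw g x r y"
    using norm_triangle_ineq[of "\<phi> y" "\<psi> y"] assms[THEN test_bound_size, of y]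
    by (simp add: distrib_right)
  fix z assume z: "d y z \<le> (r + d x y) / (2 * K)"
  have "cmod (\<phi> y + \<psi> y - (\<phi> z + \<psi> z)) \<le> cmod (\<phi> y - \<phi> z) + cmod (\<psi> y - \<psi> z)"
    using norm_triangle_ineq[of "\<phi> y - \<phi> z" "\<psi> y - \<psi> z"] by (simp add: algebra_simps)
  then show "cmod (\<phi> y + \<psi> y - (\<phi> z + \<psi> z)) \<le> (C + C') * ((d y z / (r + d x y)) powr a * tw g x r y)"
    using assms[THEN test_bound_diff, OF z] by (simp add: distrib_right)
qed

lemma test_bound_cmult:
  assumes "tb x r a g \<phi> C"
  shows "tb x r a g (\<lambda>y. c * \<phi> y) (cmod c * C)"
proof (rule test_boundI)
  fix y
  show "cmod (c * \<phi> y) \<le> (cmod c * C) * tw g x r y"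
    using mult_left_mono[OF test_bound_size[OF assms, of y], of "cmod c"] by (simp add: norm_mult mult.assoc)
  fix z assume z: "d y z \<le> (r + d x y) / (2 * K)"
  show "cmod (c * \<phi> y - c * \<phi> z) \<le> (cmod c * C) * ((d y z / (r + d x y)) powr a * tw g x r y)"
    using mult_left_mono[OF test_bound_diff[OF assms z], of "cmod c"]
    by (simp add: norm_mult mult.assoc right_diff_distrib[symmetric])
qed

lemma test_bound_minus:
  assumes "tb x r a g \<phi> C" "tb x r a g \<psi> C'"
  shows "tb x r a g (\<lambda>y. \<phi> y - \<psi> y) (C + C')"
  using test_bound_add[OF assms(1) test_bound_cmult[OF assms(2), of "-1"]] by simp

lemma test_bound_sup: "0 < r \<Longrightarrow> 0 < g \<Longrightarrow> tb x r a g \<phi> C \<Longrightarrow> cmod (\<phi> y) \<le> C * (Q / V r)"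
  using test_bound_size[of x r a g \<phi> C y] tw_le[of r g x y] test_bound_nonneg[of r x a g \<phi> C]
    mult_left_mono[of "tw g x r y" "Q / V r" C] by linarith

text \<open>The Hoelder condition at the local scale \<open>r + d x y\<close> is continuity for the
  quasimetric topology, whose open sets generate the sigma-algebra.\<close>

lemma test_bound_measurable:
  assumes r: "0 < r" and a: "0 < a" and \<phi>: "tb x r a g \<phi> C"
  shows "\<phi> \<in> borel_measurable M"
proof (rule borel_measurableI)
  fix U :: "complex set" assume U: "open U"
  have "qopen d (\<phi> -` U)" unfolding qopen_def
  proof
    fix y assume "y \<in> \<phi> -` U"
    then obtain e where e: "e > 0" "\<And>w. cmod (\<phi> y - w) < e \<Longrightarrow> w \<in> U"
      using U by (auto simp: open_dist dist_norm norm_minus_commute)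
    define W where "W = C * tw g x r y"
    have W: "0 \<le> W" using test_bound_nonneg[OF r \<phi>] tw_nonneg[OF r, of g x y] by (simp add: W_def)
    define \<rho> where "\<rho> = r + d x y"
    have \<rho>: "0 < \<rho>" unfolding \<rho>_def by (rule radius_pos[OF r])
    define \<delta> where "\<delta> = min (\<rho> / (2 * K)) (\<rho> * (e / (W + 1)) powr (1 / a))"
    have \<delta>: "0 < \<delta>" using \<rho> K_pos e W by (simp add: \<delta>_def)
    have "z \<in> \<phi> -` U" if z: "z \<in> ball y \<delta>" for z
    proof -
      have "d y z \<le> \<rho> / (2 * K)" using z by (simp add: \<delta>_def)
      then have "cmod (\<phi> y - \<phi> z) \<le> C * ((d y z / \<rho>) powr a * tw g x r y)"
        using test_bound_diff[OF \<phi>, of y z] by (simp add: \<rho>_def)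
      also have "\<dots> = W * (d y z / \<rho>) powr a" by (simp add: W_def)
      also have "\<dots> \<le> W * (e / (W + 1))"
      proof (rule mult_left_mono[OF _ W])
        have "d y z / \<rho> \<le> (e / (W + 1)) powr (1 / a)" using z \<rho> by (simp add: \<delta>_def field_simps)
        then have "(d y z / \<rho>) powr a \<le> ((e / (W + 1)) powr (1 / a)) powr a"
          using a \<rho> dist_nonneg by (intro powr_mono2) auto
        then show "(d y z / \<rho>) powr a \<le> e / (W + 1)" using a e W by (simp add: powr_powr)
      qed
      also have "\<dots> < e" using e W by (simp add: field_simps)
      finally show ?thesis using e(2) by simp
    qed
    then show "\<exists>s>0. ball y s \<subseteq> \<phi> -` U" using \<delta> by blast
  qed
  then show "\<phi> -` U \<inter> space M \<in> sets M" using qopen_measurable by (simp add: space_UNIV)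
qed

text \<open>The tool for integrals of bump-like functions. On the annulus of radius R the decay of
  \<open>w\<close> contributes the power -g of R and the growth of \<nu> the power \<eta>, while the
  volumes \<open>V R\<close> cancel; \<eta> < g leaves a geometric series of ratio
  \<open>2 powr (\<eta> - g)\<close>. The measure \<nu> may carry an atom, an oscillation of
  \<open>b\<close> or an exponential as its density.\<close>

lemma annuli_integral:
  assumes \<nu>: "sets \<nu> = sets M" and \<rho>: "0 < \<rho>" and \<eta>: "0 \<le> \<eta>" "\<eta> < g"
    and N: "0 \<le> N" and s: "0 \<le> s"
    and w: "\<And>y. w y \<le> N * (\<rho> / (\<rho> + d x y)) powr g / V (\<rho> + d x y)"
    and ball: "\<And>R. \<rho> \<le> R \<Longrightarrow> emeasure \<nu> (ball x R) \<le> ennreal (s * (R / \<rho>) powr \<eta> * V R)"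
  shows "(\<integral>\<^sup>+y. ennreal (w y) \<partial>\<nu>) \<le> ennreal (Q * 2 powr (g + n) / (1 - 2 powr (\<eta> - g)) * s * N)"
proof -
  define R where "R k = 2 ^ k * \<rho>" for k :: nat
  have R: "0 < R k" "\<rho> \<le> R k" for k using \<rho> mult_right_mono[of 1 "2 ^ k" \<rho>] by (auto simp: R_def)
  define c where "c k = N * 2 powr g * (2 powr (-g)) ^ k * Q * 2 powr n / V (R k)" for k
  have c: "0 \<le> c k" for k using N Q_ge_1 V_pos[OF R(1)[of k]] by (simp add: c_def)
  have "(\<integral>\<^sup>+y. ennreal (w y) \<partial>\<nu>) \<le> (\<integral>\<^sup>+y. (\<Sum>k. ennreal (c k) * indicator (ball x (R k)) y) \<partial>\<nu>)"
  proof (rule nn_integral_mono)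
    fix y
    have "\<exists>k. d x y < R k"
      using real_arch_pow[of 2 "d x y / \<rho>"] \<rho> by (auto simp: R_def field_simps)
    \<comment> \<open>The least dyadic ball that contains \<open>y\<close>. By minimality
      \<open>\<rho> + d x y\<close> is at least half its radius; for k = 0 this holds
      trivially.\<close>
    define k where "k = (LEAST k. d x y < R k)"
    have k: "d x y < R k" unfolding k_def using \<open>\<exists>k. d x y < R k\<close> by (rule LeastI_ex)
    have lo: "R k / 2 \<le> \<rho> + d x y"
    proof (cases k)
      case 0 then show ?thesis using \<rho> dist_nonneg[of x y] by (simp add: R_def)
    next
      case (Suc j)
      then have "\<not> d x y < R j" using not_less_Least[of j "\<lambda>k. d x y < R k"] by (simp add: k_def)
      then show ?thesis using \<rho> Suc by (simp add: R_def)
    qed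
    have "w y \<le> N * (\<rho> / (\<rho> + d x y)) powr g / V (\<rho> + d x y)" by (rule w)
    also have "\<dots> \<le> N * (\<rho> / (R k / 2)) powr g / (V (R k) / (Q * 2 powr n))"
    proof (rule frac_le)
      have "\<rho> / (\<rho> + d x y) \<le> \<rho> / (R k / 2)" using lo R(1)[of k] \<rho> by (intro divide_left_mono) (auto simp: add_pos_nonneg dist_nonneg)
      then show "N * (\<rho> / (\<rho> + d x y)) powr g \<le> N * (\<rho> / (R k / 2)) powr g"
        using N \<rho> \<eta> dist_nonneg[of x y] by (intro mult_left_mono powr_mono2) auto
      have "V (R k) \<le> Q * 2 powr n * V (\<rho> + d x y)"
        using lo R(1)[of k] radius_pos[OF \<rho>, of x y] by (intro V_scale) auto
      then show "V (R k) / (Q * 2 powr n) \<le> V (\<rho> + d x y)" using Q_ge_1 by (simp add: field_simps)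
      show "0 < V (R k) / (Q * 2 powr n)" using V_pos[OF R(1)[of k]] Q_ge_1 by simp
    qed (use N in auto)
    also have "\<dots> = c k"
    proof -
      have "\<rho> / (R k / 2) = 2 * (1 / 2) ^ k" using \<rho> by (simp add: R_def power_one_over field_simps)
      also have "\<dots> powr g = 2 powr g * ((1 / 2) ^ k) powr g" by (simp add: powr_mult)
      also have "((1 / 2 :: real) ^ k) powr g = (2 powr (-g)) ^ k"
      proof -
        have "(1 / 2 :: real) ^ k = 2 powr (- real k)"
          by (simp add: powr_minus_divide powr_realpow power_one_over)
        moreover have "(2 powr (-g)) ^ k = 2 powr (-g * real k)"
          by (simp add: powr_realpow[symmetric] powr_powr)
        ultimately show ?thesis by (simp only: powr_powr mult_minus_left mult.commute[of g])
      qed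
      finally show ?thesis by (simp add: c_def)
    qed
    finally have "ennreal (w y) \<le> (\<Sum>i\<in>{k}. ennreal (c i) * indicator (ball x (R i)) y)"
      using k by (simp add: ennreal_leI)
    also have "\<dots> \<le> (\<Sum>i. ennreal (c i) * indicator (ball x (R i)) y)" by (rule sum_le_suminf) auto
    finally show "ennreal (w y) \<le> (\<Sum>i. ennreal (c i) * indicator (ball x (R i)) y)" .
  qed
  also have "\<dots> = (\<Sum>k. ennreal (c k) * emeasure \<nu> (ball x (R k)))"
    using \<nu> by (subst nn_integral_suminf) (auto simp: nn_integral_cmult)
  also have "\<dots> \<le> (\<Sum>k. ennreal (c k) * ennreal (s * (R k / \<rho>) powr \<eta> * V (R k)))"
    using R by (intro suminf_le mult_left_mono ball) auto
  also have "\<dots> = (\<Sum>k. ennreal (N * 2 powr g * Q * 2 powr n * s * (2 powr (\<eta> - g)) ^ k))"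
  proof (rule suminf_cong)
    fix k
    have "(R k / \<rho>) powr \<eta> = (2 powr \<eta>) ^ k"
      using \<rho> by (simp add: R_def powr_realpow[symmetric] powr_powr mult.commute)
    then have "c k * (s * (R k / \<rho>) powr \<eta> * V (R k))
        = N * 2 powr g * Q * 2 powr n * s * ((2 powr (-g)) ^ k * (2 powr \<eta>) ^ k)"
      using V_pos[OF R(1)[of k]] by (simp add: c_def)
    also have "(2 powr (-g)) ^ k * (2 powr \<eta>) ^ k = (2 powr (\<eta> - g)) ^ k"
      by (simp add: power_mult_distrib[symmetric] powr_add[symmetric])
    finally have eq: "c k * (s * (R k / \<rho>) powr \<eta> * V (R k))
        = N * 2 powr g * Q * 2 powr n * s * (2 powr (\<eta> - g)) ^ k" .
    have "0 \<le> s * (R k / \<rho>) powr \<eta> * V (R k)" using s V_pos[OF R(1)[of k]] by simp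
    then show "ennreal (c k) * ennreal (s * (R k / \<rho>) powr \<eta> * V (R k))
        = ennreal (N * 2 powr g * Q * 2 powr n * s * (2 powr (\<eta> - g)) ^ k)"
      by (simp only: eq ennreal_mult[symmetric, OF c[of k]])
  qed
  also have "\<dots> = ennreal (N * 2 powr g * Q * 2 powr n * s * (1 / (1 - 2 powr (\<eta> - g))))"
  proof (rule suminf_ennreal_eq)
    have "2 powr (\<eta> - g) < 2 powr (0::real)" using \<eta> by (intro powr_less_mono) auto
    then show "(\<lambda>k. N * 2 powr g * Q * 2 powr n * s * (2 powr (\<eta> - g)) ^ k)
        sums (N * 2 powr g * Q * 2 powr n * s * (1 / (1 - 2 powr (\<eta> - g))))"
      by (intro sums_mult geometric_sums) auto
  qed (use N Q_ge_1 s in auto)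
  also have "N * 2 powr g * Q * 2 powr n * s * (1 / (1 - 2 powr (\<eta> - g)))
      = Q * 2 powr (g + n) / (1 - 2 powr (\<eta> - g)) * s * N"
    by (simp add: powr_add)
  finally show ?thesis .
qed

text \<open>\<open>L\<close> depends on the radii and on the bound \<open>D\<close> for the distance
  of the base points only, so it stays the same while the base point moves.\<close>

lemma comparable_radii:
  assumes r: "0 < r" "0 < r'" and D: "0 \<le> D"
  obtains L where "1 \<le> L" "r \<le> L * r'"
    "\<And>x x' y. d x x' \<le> D \<Longrightarrow> r + d x y \<le> L * (r' + d x' y)"
    "\<And>x x' y. d x x' \<le> D \<Longrightarrow> r' + d x' y \<le> L * (r + d x y)"
proof -
  define m where "m = min r r'"
  define L where "L = K + (r + r' + K * D) / m"
  have m: "0 < m" "m \<le> r" "m \<le> r'" using r by (auto simp: m_def)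
  have KD: "0 \<le> K * D" using K_pos D by simp
  have Lm: "(r + r' + K * D) \<le> (L - K) * m" using m by (simp add: L_def)
  have KL: "K \<le> L" using r KD m by (simp add: L_def)
  have main: "s + d x y \<le> L * (s' + d x' y)" if "d x x' \<le> D" "s \<le> r + r'" "m \<le> s'" for s s' x x' y
  proof -
    have "d x y \<le> K * (D + d x' y)" using that by (intro dist_triangle_le) auto
    then have "s + d x y \<le> (r + r' + K * D) + K * d x' y" using that by (simp add: distrib_left)
    also have "\<dots> \<le> (L - K) * m + K * d x' y" using Lm by simp
    also have "\<dots> \<le> L * s' + L * d x' y"
    proof (rule add_mono)
      have "(L - K) * m \<le> L * m" using m K_pos by (intro mult_right_mono) auto
      also have "\<dots> \<le> L * s'" using that KL K_pos by (intro mult_left_mono) auto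
      finally show "(L - K) * m \<le> L * s'" .
    qed (use KL dist_nonneg in \<open>auto intro: mult_right_mono\<close>)
    finally show ?thesis by (simp add: distrib_left)
  qed
  show ?thesis
  proof
    show "1 \<le> L" using KL K0_ge_1 by simp
    have "r \<le> (L - K) * m" using Lm r KD by linarith
    also have "\<dots> \<le> L * r'" using m KL K_pos by (intro mult_mono) auto
    finally show "r \<le> L * r'" .
    show "r + d x y \<le> L * (r' + d x' y)" if "d x x' \<le> D" for x x' y
      using main[OF that, of r r' y] m r by simp
    show "r' + d x' y \<le> L * (r + d x y)" if "d x x' \<le> D" for x x' y
      using main[of x' x r' r y] that m r by (simp add: dist_commute)
  qed
qed

text \<open>Comparable scales make the size profiles comparable. Smoothness is delicate only for
  pairs that are close at the new scale but not at the old one: there the two size bounds replace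
  the missing Hoelder bound, because \<open>d y z\<close> is at least a fixed fraction of the
  scale.\<close>

lemma test_bound_change_base:
  assumes L: "1 \<le> L" and a: "0 < a" and g: "0 < g"
  obtains P where "0 < P" "\<And>x x' r r' \<phi> C. 0 < r \<Longrightarrow> 0 < r' \<Longrightarrow> r \<le> L * r' \<Longrightarrow>
    (\<And>y. r + d x y \<le> L * (r' + d x' y)) \<Longrightarrow> (\<And>y. r' + d x' y \<le> L * (r + d x y)) \<Longrightarrow>
    tb x r a g \<phi> C \<Longrightarrow> tb x' r' a g \<phi> (P * C)"
proof -
  \<comment> \<open>\<open>P1\<close> compares the size profiles. \<open>P2\<close> collects the
    Hoelder factor and, in its bracket, the sum of the size bounds at the two points of a
    pair.\<close>
  define P1 where "P1 = Q ^ 3 * L powr n * (L\<^sup>2) powr g"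
  define P2 where "P2 = (1 + Q ^ 3 * (2 * K) powr n * (2 * K) powr g) * (2 * K * L) powr a"
  have Q3: "1 \<le> Q ^ 3" using Q_ge_1 by simp
  have K2: "1 \<le> 2 * K" using K0_ge_1 by simp
  have KL: "1 \<le> 2 * K * L" using K2 L mult_mono[of 1 "2 * K" 1 L] by simp
  have P1: "0 < P1" using Q3 L Q_ge_1 by (auto simp: P1_def intro!: mult_pos_pos)
  have q: "0 \<le> Q ^ 3 * (2 * K) powr n * (2 * K) powr g" using Q_ge_1 by simp
  have La: "L powr a \<le> (2 * K * L) powr a"
    using a L K2 mult_right_mono[of 1 "2 * K" L] by (intro powr_mono2) auto
  have "1 \<le> L powr a" using L a by (intro ge_one_powr_ge_zero) auto
  then have P2: "1 \<le> P2" "L powr a \<le> P2"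
    using q La mult_mono[of 1 "1 + Q ^ 3 * (2 * K) powr n * (2 * K) powr g" _ "(2 * K * L) powr a"]
    unfolding P2_def by (fastforce)+
  show ?thesis
  proof
    show "0 < P1 * P2" using P1 P2 by simp
    fix x x' r r' \<phi> C
    assume r: "0 < r" "0 < r'" "r \<le> L * r'" and R: "\<And>y. r + d x y \<le> L * (r' + d x' y)"
      "\<And>y. r' + d x' y \<le> L * (r + d x y)" and \<phi>: "tb x r a g \<phi> C"
    have C: "0 \<le> C" using test_bound_nonneg[OF r(1) \<phi>] .
    have tw: "tw g x r y \<le> P1 * tw g x' r' y" for y
    proof -
      note p = radius_pos[OF r(1), of x y] radius_pos[OF r(2), of x' y]
      have "measure M (ball y (r' + d x' y)) \<le> Q ^ 3 * L powr n * measure M (ball y (r + d x y))"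
        using p R(2)[of y] L by (intro measure_ball_le) auto
      then have 1: "1 / measure M (ball y (r + d x y)) \<le> Q ^ 3 * L powr n * (1 / measure M (ball y (r' + d x' y)))"
        using measure_qball_pos[OF p(1), of y] measure_qball_pos[OF p(2), of y] by (simp add: field_simps)
      have "r / (r + d x y) \<le> L * r' / ((r' + d x' y) / L)"
        using r p R(2)[of y] L by (intro frac_le) (auto simp: field_simps)
      then have "r / (r + d x y) \<le> L\<^sup>2 * (r' / (r' + d x' y))" by (simp add: power2_eq_square mult_ac)
      then have "(r / (r + d x y)) powr g \<le> (L\<^sup>2 * (r' / (r' + d x' y))) powr g"
        using r p g by (intro powr_mono2) auto
      then have 2: "(r / (r + d x y)) powr g \<le> (L\<^sup>2) powr g * (r' / (r' + d x' y)) powr g"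
        by (simp only: powr_mult)
      show ?thesis unfolding tw_def P1_def using mult_mono[OF 1 2] Q_ge_1 by (simp add: mult_ac)
    qed
    have size: "cmod (\<phi> y) \<le> C * (P1 * tw g x' r' y)" for y
      using test_bound_size[OF \<phi>, of y] mult_left_mono[OF tw[of y] C] by linarith
    show "tb x' r' a g \<phi> (P1 * P2 * C)"
    proof (rule test_boundI)
      fix y
      define X where "X = C * P1 * tw g x' r' y"
      have X: "0 \<le> X" using C P1 tw_nonneg[OF r(2)] by (simp add: X_def)
      note p = radius_pos[OF r(1), of x y] radius_pos[OF r(2), of x' y]
      have "cmod (\<phi> y) \<le> X * 1" using size[of y] by (simp add: X_def mult_ac)
      also have "\<dots> \<le> X * P2" using P2 X by (intro mult_left_mono) auto
      finally show "cmod (\<phi> y) \<le> P1 * P2 * C * tw g x' r' y" by (simp add: X_def mult_ac)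
      fix z assume z: "d y z \<le> (r' + d x' y) / (2 * K)"
      show "cmod (\<phi> y - \<phi> z) \<le> P1 * P2 * C * ((d y z / (r' + d x' y)) powr a * tw g x' r' y)"
      proof (cases "d y z \<le> (r + d x y) / (2 * K)")
        case True
        have "d y z / (r + d x y) \<le> L * (d y z / (r' + d x' y))"
          using mult_left_mono[OF R(2)[of y] dist_nonneg[of y z]] p by (simp add: field_simps)
        then have "(d y z / (r + d x y)) powr a \<le> (L * (d y z / (r' + d x' y))) powr a"
          using p a dist_nonneg by (intro powr_mono2) auto
        also have "\<dots> = L powr a * (d y z / (r' + d x' y)) powr a" by (simp only: powr_mult)
        also have "\<dots> \<le> P2 * (d y z / (r' + d x' y)) powr a" using P2 by (intro mult_right_mono) auto
        finally have "C * ((d y z / (r + d x y)) powr a * tw g x r y)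
          \<le> C * ((P2 * (d y z / (r' + d x' y)) powr a) * (P1 * tw g x' r' y))"
          using C tw[of y] P2 tw_nonneg[OF r(1), of g x y] by (intro mult_left_mono mult_mono) auto
        then show ?thesis using test_bound_diff[OF \<phi> True] by (simp add: mult_ac)
      next
        case False
        have far: "(r' + d x' y) / (2 * K) \<le> r' + d x' z"
        proof -
          have "d x' y \<le> K * (d x' z + (r' + d x' y) / (2 * K))"
            using z by (intro dist_triangle_le) (auto simp: dist_commute)
          also have "\<dots> = K * d x' z + (r' + d x' y) / 2" using K_pos by (simp add: field_simps)
          finally have "d x' y \<le> K * d x' z + (r' + d x' y) / 2" .
          then have "(r' + d x' y) / 2 \<le> r' + K * d x' z"
            using r(2) by (simp add: add_divide_distrib)
          also have "\<dots> \<le> K * (r' + d x' z)"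
            using K0_ge_1 r mult_right_mono[of 1 K r'] by (simp add: distrib_left)
          finally show ?thesis using K_pos by (simp add: field_simps)
        qed
        note pz = radius_pos[OF r(2), of x' z]
        have twz: "tw g x' r' z \<le> Q ^ 3 * (2 * K) powr n * (2 * K) powr g * tw g x' r' y"
        proof -
          have "measure M (ball y (r' + d x' y)) \<le> Q ^ 3 * (2 * K) powr n * measure M (ball z (r' + d x' z))"
            using p pz far K2 K_pos by (intro measure_ball_le) (auto simp: field_simps)
          then have 1: "1 / measure M (ball z (r' + d x' z)) \<le> Q ^ 3 * (2 * K) powr n * (1 / measure M (ball y (r' + d x' y)))"
            using measure_qball_pos[OF pz, of z] measure_qball_pos[OF p(2), of y] by (simp add: field_simps)
          have "r' / (r' + d x' z) \<le> r' / ((r' + d x' y) / (2 * K))"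
            using r p pz far K_pos by (intro divide_left_mono) auto
          then have "(r' / (r' + d x' z)) powr g \<le> ((2 * K) * (r' / (r' + d x' y))) powr g"
            using r pz g by (intro powr_mono2) (auto simp: mult_ac)
          then have 2: "(r' / (r' + d x' z)) powr g \<le> (2 * K) powr g * (r' / (r' + d x' y)) powr g"
            by (simp only: powr_mult)
          show ?thesis unfolding tw_def using mult_mono[OF 1 2] Q_ge_1 by (simp add: mult_ac)
        qed
        have "cmod (\<phi> y - \<phi> z) \<le> cmod (\<phi> y) + cmod (\<phi> z)" by (rule norm_triangle_ineq4)
        also have "\<dots> \<le> C * (P1 * tw g x' r' y)
            + C * (P1 * (Q ^ 3 * (2 * K) powr n * (2 * K) powr g * tw g x' r' y))"
          by (rule add_mono[OF size order_trans[OF size mult_left_mono[OF mult_left_mono[OF twz less_imp_le[OF P1]] C]]])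
        also have "\<dots> = X * (1 + Q ^ 3 * (2 * K) powr n * (2 * K) powr g)" by (simp add: X_def algebra_simps)
        also have "\<dots> \<le> X * (P2 * (d y z / (r' + d x' y)) powr a)"
        proof (rule mult_left_mono[OF _ X])
          have "(r' + d x' y) \<le> L * (r + d x y)" by (rule R)
          also have "\<dots> \<le> L * (2 * K * d y z)"
            using False K_pos L by (intro mult_left_mono) (auto simp: field_simps)
          finally have "1 \<le> 2 * K * L * (d y z / (r' + d x' y))" using p by (simp add: field_simps)
          then have "1 \<le> (2 * K * L * (d y z / (r' + d x' y))) powr a"
            using a by (intro ge_one_powr_ge_zero) auto
          then have "1 \<le> (2 * K * L) powr a * (d y z / (r' + d x' y)) powr a" by (simp only: powr_mult)
          then show "1 + Q ^ 3 * (2 * K) powr n * (2 * K) powr g \<le> P2 * (d y z / (r' + d x' y)) powr a"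
            using q mult_left_mono[of 1 "(2 * K * L) powr a * (d y z / (r' + d x' y)) powr a"
                "1 + Q ^ 3 * (2 * K) powr n * (2 * K) powr g"]
            by (simp add: P2_def mult.assoc)
        qed
        finally show ?thesis by (simp add: X_def mult_ac)
      qed
    qed
  qed
qed

end

section \<open>Lower semicontinuity of grand maximal functions\<close>

locale test_setting = hom_space d M K \<theta> A Q \<kappa> n V
  for d :: "'a \<Rightarrow> 'a \<Rightarrow> real" and M K \<theta> A Q \<kappa> n V +
  fixes x0 :: 'a and \<epsilon> \<beta> \<gamma> :: real
  assumes \<beta>: "0 < \<beta>" "\<beta> < \<epsilon>" and \<gamma>: "0 < \<gamma>" "\<gamma> < \<epsilon>" and \<epsilon>_le: "\<epsilon> \<le> \<theta>"
begin

abbreviation "TS \<equiv> test_space d M K x0 1 \<beta> \<gamma>"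
abbreviation "TE \<equiv> test_space d M K x0 1 \<epsilon> \<epsilon>"
abbreviation "TC \<equiv> test_closure d M K x0 \<epsilon> \<beta> \<gamma>"
abbreviation "TN \<equiv> test_norm d M K x0 1 \<beta> \<gamma>"
abbreviation "DD \<equiv> distributions d M K x0 \<epsilon> \<beta> \<gamma>"
abbreviation "GM \<equiv> grand_maximal d M K x0 \<epsilon> \<beta> \<gamma>"

lemma \<epsilon>_pos: "0 < \<epsilon>" using \<beta> by simp

lemma test_closure_bound: "\<phi> \<in> TC \<Longrightarrow> tb x0 1 \<beta> \<gamma> \<phi> (TN \<phi>)"
  by (rule test_bound_test_norm) (auto simp: test_closure_def)

lemma test_norm_zero: "TN (\<lambda>x. 0) \<le> 0"
  using test_norm_le[of 1 x0 \<beta> \<gamma> "\<lambda>x. 0" 0] by (auto simp: test_bound_iff)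

lemma test_space_minus: "\<phi> \<in> test_space d M K x r a g \<Longrightarrow> \<psi> \<in> test_space d M K x r a g \<Longrightarrow>
   (\<lambda>x. \<phi> x - \<psi> x) \<in> test_space d M K x r a g"
  using test_bound_minus by (fastforce simp: test_space_def)

lemma test_space_cmult: "\<phi> \<in> test_space d M K x r a g \<Longrightarrow> (\<lambda>x. c * \<phi> x) \<in> test_space d M K x r a g"
  using test_bound_cmult by (fastforce simp: test_space_def)

lemma test_closure_regular: "\<psi> \<in> TE \<inter> TS \<Longrightarrow> \<psi> \<in> TC"
  using test_norm_zero by (auto simp: test_closure_def intro!: bexI[of _ \<psi>])

lemma test_closure_minus_regular:
  assumes "\<phi> \<in> TC" "\<psi> \<in> TE \<inter> TS"
  shows "(\<lambda>x. \<phi> x - \<psi> x) \<in> TC"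
  unfolding test_closure_def
proof (intro CollectI conjI allI impI)
  show "(\<lambda>x. \<phi> x - \<psi> x) \<in> TS" using assms by (auto simp: test_closure_def intro: test_space_minus)
  fix \<delta> :: real assume "0 < \<delta>"
  then obtain \<zeta> where \<zeta>: "\<zeta> \<in> TE \<inter> TS" "TN (\<lambda>x. \<phi> x - \<zeta> x) < \<delta>"
    using assms(1) by (auto simp: test_closure_def)
  have "(\<lambda>x. \<zeta> x - \<psi> x) \<in> TE \<inter> TS" using \<zeta>(1) assms(2) by (auto intro: test_space_minus)
  moreover have "TN (\<lambda>x. \<phi> x - \<psi> x - (\<zeta> x - \<psi> x)) < \<delta>" using \<zeta>(2) by simp
  ultimately show "\<exists>\<zeta>\<in>TE \<inter> TS. TN (\<lambda>x. \<phi> x - \<psi> x - \<zeta> x) < \<delta>" by (rule bexI[where x = "\<lambda>x. \<zeta> x - \<psi> x", rotated])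
qed

lemma distribution_add: "f \<in> DD \<Longrightarrow> \<phi> \<in> TC \<Longrightarrow> \<psi> \<in> TC \<Longrightarrow> f (\<lambda>x. \<phi> x + \<psi> x) = f \<phi> + f \<psi>"
  by (simp add: distributions_def)

lemma distribution_cmult: "f \<in> DD \<Longrightarrow> \<phi> \<in> TC \<Longrightarrow> f (\<lambda>x. c * \<phi> x) = c * f \<phi>"
  by (simp add: distributions_def)

lemma distribution_bound: "f \<in> DD \<Longrightarrow> \<exists>C. \<forall>\<phi>\<in>TC. cmod (f \<phi>) \<le> C * TN \<phi>"
  by (simp add: distributions_def)

text \<open>A test function that decays faster than required satisfies the far-away part of every nearby
  test bound with room to spare; in the bounded remaining region the jump of the centre is absorbed
  by shrinking the radius.\<close>

lemma test_bound_perturb: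
  assumes r: "0 < r" and T: "1 < T" and \<psi>: "\<psi> \<in> TE" and \<psi>r: "tb x r \<beta> \<gamma> \<psi> (sqrt T)"
  shows "\<exists>\<delta>>0. \<exists>r'>0. \<forall>x'. d x x' < \<delta> \<longrightarrow> tb x' r' \<beta> \<gamma> \<psi> T"
proof -
  \<comment> \<open>The slack is split evenly: one factor \<open>T1\<close> is the test bound of
    \<psi> at the old base, the other pays for shrinking the radius to \<open>r'\<close>, chosen
    with \<open>(r / r') powr \<gamma> = T1\<close>.\<close>
  define T1 where "T1 = sqrt T"
  have T1: "1 < T1" "T1 * T1 = T" using T by (auto simp: T1_def)
  define r' where "r' = r * T1 powr (- 1 / \<gamma>)"
  have r': "0 < r'" using r T1 by (simp add: r'_def)
  have rr: "(r / r') powr \<gamma> = T1"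
    using r T1 \<gamma> by (simp add: r'_def powr_powr powr_divide powr_minus field_simps)
  have "T1 powr (- 1 / \<gamma>) < T1 powr 0" using T1 \<gamma> by (intro powr_less_mono) auto
  then have r'r: "r' < r" using r T1 by (simp add: r'_def)
  obtain C1 where C1: "tb x0 1 \<epsilon> \<epsilon> \<psi> C1" using \<psi> by (auto simp: test_space_def)
  define D where "D = K * (d x0 x + 1)"
  have D: "0 \<le> D" using K_pos dist_nonneg[of x0 x] by (simp add: D_def)
  have Dx: "d x0 x' \<le> D" if "d x x' < 1" for x'
    unfolding D_def using that by (intro dist_triangle_le) auto
  obtain L where L: "1 \<le> L" "1 \<le> L * r'" "\<And>x x' y. d x x' \<le> D \<Longrightarrow> 1 + d x y \<le> L * (r' + d x' y)"
    "\<And>x x' y. d x x' \<le> D \<Longrightarrow> r' + d x' y \<le> L * (1 + d x y)"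
    using comparable_radii[OF zero_less_one r' D] by blast
  obtain P where P: "0 < P" "\<And>x x' r r' \<phi> C. 0 < r \<Longrightarrow> 0 < r' \<Longrightarrow> r \<le> L * r' \<Longrightarrow>
    (\<And>y. r + d x y \<le> L * (r' + d x' y)) \<Longrightarrow> (\<And>y. r' + d x' y \<le> L * (r + d x y)) \<Longrightarrow>
    tb x r \<epsilon> \<epsilon> \<phi> C \<Longrightarrow> tb x' r' \<epsilon> \<epsilon> \<phi> (P * C)"
    using test_bound_change_base[OF L(1) \<epsilon>_pos \<epsilon>_pos] by blast
  define C2 where "C2 = P * C1"
  have C2: "tb x' r' \<epsilon> \<epsilon> \<psi> C2" if "d x x' < 1" for x'
    unfolding C2_def by (rule P(2)[OF zero_less_one r' L(2) L(3) L(4) C1]) (rule Dx[OF that])+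
  have C20: "0 \<le> C2" using test_bound_nonneg[OF zero_less_one C1] P by (simp add: C2_def)
  \<comment> \<open>Beyond this scale the surplus power \<open>\<epsilon> - \<gamma>\<close> of
    \<open>r' / R\<close> outweighs the uncontrolled constant \<open>C2\<close>.\<close>
  define \<rho> where "\<rho> = r' * (max 1 (C2 / T)) powr (1 / (\<epsilon> - \<gamma>))"
  have \<rho>: "0 < \<rho>" using r' by (simp add: \<rho>_def)
  have far: "C2 * (r' / R) powr \<epsilon> \<le> T * (r' / R) powr \<gamma>" if R: "\<rho> \<le> R" for R
  proof -
    have R0: "0 < R" using R \<rho> by simp
    have "(r' / R) powr (\<epsilon> - \<gamma>) \<le> (r' / \<rho>) powr (\<epsilon> - \<gamma>)"
      using R \<rho> r' \<gamma> by (intro powr_mono2 divide_left_mono) auto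
    also have "\<dots> = 1 / max 1 (C2 / T)"
      using r' \<gamma> by (simp add: \<rho>_def powr_divide powr_powr)
    finally have "C2 * (r' / R) powr (\<epsilon> - \<gamma>) \<le> C2 * (1 / max 1 (C2 / T))" using C20 by (rule mult_left_mono)
    also have "\<dots> \<le> T" using T C20 by (simp add: divide_le_eq max_def field_simps)
    finally have "C2 * (r' / R) powr (\<epsilon> - \<gamma>) * (r' / R) powr \<gamma> \<le> T * (r' / R) powr \<gamma>"
      by (rule mult_right_mono) simp
    then show ?thesis using r' R0 by (simp add: mult.assoc powr_add[symmetric])
  qed
  have "0 < K * (1 + \<rho>)" "0 < r - r'" using K_pos \<rho> r'r by simp_all
  then obtain \<delta>' where \<delta>': "0 < \<delta>'" "\<And>x y z. d x z \<le> K * (1 + \<rho>) \<Longrightarrow> d x y < \<delta>' \<Longrightarrow> \<bar>d x z - d y z\<bar> \<le> r - r'"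
    using dist_uniformly_continuous by blast
  have "tb x' r' \<beta> \<gamma> \<psi> T" if x': "d x x' < min \<delta>' 1" for x'
  proof -
    have near: "tw \<gamma> x r y \<le> T1 * tw \<gamma> x' r' y" "r' + d x' y \<le> r + d x y" if y: "r' + d x' y < \<rho>" for y
    proof -
      have "d x y \<le> K * (1 + \<rho>)" using x' y r' by (intro dist_triangle_le[of x x']) auto
      then have "\<bar>d x y - d x' y\<bar> \<le> r - r'" using x' by (intro \<delta>') auto
      then show R: "r' + d x' y \<le> r + d x y" by linarith
      note p = radius_pos[OF r', of x' y] radius_pos[OF r, of x y]
      have "1 / measure M (ball y (r + d x y)) \<le> 1 / measure M (ball y (r' + d x' y))"
        using p R measure_qball_pos[OF p(1), of y] emeasure_ball_finite[of y]
        by (intro divide_left_mono measure_mono_fmeasurable fmeasurableI ball_mono mult_pos_pos measure_qball_pos) auto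
      moreover have "(r / (r + d x y)) powr \<gamma> \<le> (r / r' * (r' / (r' + d x' y))) powr \<gamma>"
        using r r' p R \<gamma> by (intro powr_mono2) (auto intro: divide_left_mono)
      then have "(r / (r + d x y)) powr \<gamma> \<le> T1 * (r' / (r' + d x' y)) powr \<gamma>"
        unfolding powr_mult rr .
      ultimately show "tw \<gamma> x r y \<le> T1 * tw \<gamma> x' r' y"
        unfolding tw_def using mult_mono by fastforce
    qed
    have x'1: "d x x' < 1" using x' by simp
    have farw: "C2 * tw \<epsilon> x' r' y \<le> T * tw \<gamma> x' r' y" if "\<rho> \<le> r' + d x' y" for y
      unfolding tw_def using far[OF that] mult_left_mono[of _ _ "1 / measure M (ball y (r' + d x' y))"]
      by (fastforce simp: mult_ac)
    show ?thesis
    proof (rule test_boundI)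
      fix y
      show "cmod (\<psi> y) \<le> T * tw \<gamma> x' r' y"
      proof (cases "r' + d x' y < \<rho>")
        case True
        have "cmod (\<psi> y) \<le> T1 * tw \<gamma> x r y" unfolding T1_def by (rule test_bound_size[OF \<psi>r])
        also have "\<dots> \<le> T1 * (T1 * tw \<gamma> x' r' y)" using T1 near(1)[OF True] by (intro mult_left_mono) auto
        finally show ?thesis using T1(2) by (simp add: mult.assoc[symmetric])
      next
        case False
        then show ?thesis using test_bound_size[OF C2[OF x'1], of y] farw[of y] by linarith
      qed
      fix z assume z: "d y z \<le> (r' + d x' y) / (2 * K)"
      note p = radius_pos[OF r', of x' y] radius_pos[OF r, of x y]
      show "cmod (\<psi> y - \<psi> z) \<le> T * ((d y z / (r' + d x' y)) powr \<beta> * tw \<gamma> x' r' y)"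
      proof (cases "r' + d x' y < \<rho>")
        case True
        have z': "d y z \<le> (r + d x y) / (2 * K)"
          using order_trans[OF z] near(2)[OF True] K_pos by (simp add: divide_right_mono)
        have "(d y z / (r + d x y)) powr \<beta> \<le> (d y z / (r' + d x' y)) powr \<beta>"
          using near(2)[OF True] p \<beta> dist_nonneg[of y z] by (intro powr_mono2 divide_left_mono) auto
        then have "T1 * ((d y z / (r + d x y)) powr \<beta> * tw \<gamma> x r y)
          \<le> T1 * ((d y z / (r' + d x' y)) powr \<beta> * (T1 * tw \<gamma> x' r' y))"
          using T1 near(1)[OF True] tw_nonneg[OF r, of \<gamma> x y] by (intro mult_left_mono mult_mono) auto
        also have "\<dots> = T * ((d y z / (r' + d x' y)) powr \<beta> * tw \<gamma> x' r' y)" using T1(2) by (simp add: mult_ac)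
        finally show ?thesis using test_bound_diff[OF \<psi>r z'] by (simp add: T1_def)
      next
        case False
        have "d y z / (r' + d x' y) \<le> 1"
          using z p K0_ge_1 dist_nonneg[of y z] order_trans[OF z, of "r' + d x' y"]
          by (simp add: divide_le_eq mult_le_cancel_left1)
        \<comment> \<open>The ratio is at most 1, so the larger Hoelder exponent gives the smaller
          power.\<close>
        then have "(d y z / (r' + d x' y)) powr \<epsilon> \<le> (d y z / (r' + d x' y)) powr \<beta>"
          using \<beta> p dist_nonneg[of y z] by (intro powr_mono') auto
        then have "(d y z / (r' + d x' y)) powr \<epsilon> * (C2 * tw \<epsilon> x' r' y)
            \<le> (d y z / (r' + d x' y)) powr \<beta> * (T * tw \<gamma> x' r' y)"
          by (rule mult_mono[OF _ farw]) (use False C20 tw_nonneg[OF r', of \<epsilon> x' y] in auto)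
        then show ?thesis using test_bound_diff[OF C2[OF x'1] z] by (simp add: mult_ac)
      qed
    qed
  qed
  then show ?thesis using \<delta>'(1) r' by (intro exI[of _ "min \<delta>' 1"]) auto
qed

lemma grand_maximal_greater:
  assumes "a < GM f x"
  obtains \<phi> r \<alpha> where "\<phi> \<in> TC" "0 < r" "tb x r \<beta> \<gamma> \<phi> 1" "a = ennreal \<alpha>" "0 \<le> \<alpha>" "\<alpha> < cmod (f \<phi>)"
proof -
  obtain \<phi> r where \<phi>: "\<phi> \<in> TC" "r > 0" "\<phi> \<in> test_space d M K x r \<beta> \<gamma>" "test_norm d M K x r \<beta> \<gamma> \<phi> \<le> 1"
    "a < ennreal (cmod (f \<phi>))" using assms unfolding grand_maximal_def less_SUP_iff by blast
  moreover obtain \<alpha> where "a = ennreal \<alpha>" "0 \<le> \<alpha>" using \<phi>(5) by (cases a) auto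
  moreover have "tb x r \<beta> \<gamma> \<phi> 1" using test_bound_mono[OF \<phi>(2) test_bound_test_norm[OF \<phi>(2,3)] \<phi>(4)] .
  ultimately show ?thesis using that by (auto simp: ennreal_less_iff)
qed

lemma grand_maximal_upper:
  assumes "\<phi> \<in> TC" "0 < r" "tb x r \<beta> \<gamma> \<phi> 1"
  shows "ennreal (cmod (f \<phi>)) \<le> GM f x"
  unfolding grand_maximal_def
  using assms test_norm_le[OF assms(2,3)] by (intro SUP_upper) (auto simp: test_space_def)

lemma grand_maximal_le:
  assumes "\<And>\<phi> r. \<phi> \<in> TC \<Longrightarrow> 0 < r \<Longrightarrow> tb x r \<beta> \<gamma> \<phi> 1 \<Longrightarrow> ennreal (cmod (f \<phi>)) \<le> u"
  shows "GM f x \<le> u"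
proof (rule ccontr)
  assume "\<not> ?thesis"
  then have "u < GM f x" by simp
  then obtain \<phi> r \<alpha> where *: "\<phi> \<in> TC" "0 < r" "tb x r \<beta> \<gamma> \<phi> 1" "u = ennreal \<alpha>" "0 \<le> \<alpha>" "\<alpha> < cmod (f \<phi>)"
    by (rule grand_maximal_greater)
  then show False using assms[OF *(1-3)] by (simp add: ennreal_le_iff)
qed

text \<open>Openness of the level sets makes the supremum over uncountably many test functions
  measurable. A nearly extremal \<phi> is replaced by a regular \<psi>, to which
  \<open>test_bound_perturb\<close> applies when the base point moves. The losses in the pairing and
  in the test bound are kept within the strict gap between \<open>a\<close> and the pairing with
  \<phi>.\<close>

lemma grand_maximal_lower_semicontinuous:
  assumes f: "f \<in> DD"
  shows "qopen d {x. a < GM f x}"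
  unfolding qopen_def
proof
  fix x assume "x \<in> {x. a < GM f x}"
  then have "a < GM f x" by simp
  then obtain \<phi> r \<alpha> where \<phi>: "\<phi> \<in> TC" and r: "0 < r" and \<phi>r: "tb x r \<beta> \<gamma> \<phi> 1"
    and \<alpha>: "a = ennreal \<alpha>" "0 \<le> \<alpha>" "\<alpha> < cmod (f \<phi>)" by (rule grand_maximal_greater)
  define m where "m = cmod (f \<phi>)"
  \<comment> \<open>Larger than 1, yet \<open>\<alpha> * T\<close> stays below \<open>m\<close>: the
    rescaling by \<open>1 / T\<close> that restores the test bound 1 keeps the pairing above
    \<alpha>.\<close>
  define T where "T = 2 * m / (m + \<alpha>)"
  have m: "0 < m" "\<alpha> < m" using \<alpha> by (auto simp: m_def)
  then have "\<alpha> * m < m * m" by (intro mult_strict_right_mono) auto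
  then have T: "1 < T" "\<alpha> * T < m" using m \<alpha>(2) by (auto simp: T_def field_simps)
  obtain Cf0 where Cf0: "\<And>\<phi>. \<phi> \<in> TC \<Longrightarrow> cmod (f \<phi>) \<le> Cf0 * TN \<phi>"
    using f unfolding distributions_def by blast
  define Cf where "Cf = max 1 Cf0"
  have Cf: "0 < Cf" by (simp add: Cf_def)
  obtain L where L: "1 \<le> L" "1 \<le> L * r" "\<And>xa x' y. d xa x' \<le> d x0 x \<Longrightarrow> 1 + d xa y \<le> L * (r + d x' y)"
    "\<And>xa x' y. d xa x' \<le> d x0 x \<Longrightarrow> r + d x' y \<le> L * (1 + d xa y)"
    using comparable_radii[OF zero_less_one r dist_nonneg[of x0 x]] by blast
  obtain P where P: "0 < P" "\<And>x x' r r' \<phi> C. 0 < r \<Longrightarrow> 0 < r' \<Longrightarrow> r \<le> L * r' \<Longrightarrow>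
    (\<And>y. r + d x y \<le> L * (r' + d x' y)) \<Longrightarrow> (\<And>y. r' + d x' y \<le> L * (r + d x y)) \<Longrightarrow>
    tb x r \<beta> \<gamma> \<phi> C \<Longrightarrow> tb x' r' \<beta> \<gamma> \<phi> (P * C)"
    using test_bound_change_base[OF L(1) \<beta>(1) \<gamma>(1)] by blast
  have T1: "1 < sqrt T" using T by simp
  \<comment> \<open>The first entry lets the pairing drop by at most half of
    \<open>m - \<alpha> * T\<close>, the second keeps the test bound of \<psi> at \<open>x\<close>
    at most \<open>sqrt T\<close>.\<close>
  define \<delta> where "\<delta> = min ((m - \<alpha> * T) / (2 * Cf)) ((sqrt T - 1) / P)"
  have \<delta>: "0 < \<delta>" using T T1 Cf P by (simp add: \<delta>_def)
  obtain \<psi> where \<psi>: "\<psi> \<in> TE \<inter> TS" "TN (\<lambda>x. \<phi> x - \<psi> x) < \<delta>" using \<phi> \<delta> by (auto simp: test_closure_def)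
  have diff: "(\<lambda>x. \<phi> x - \<psi> x) \<in> TC" by (rule test_closure_minus_regular[OF \<phi> \<psi>(1)])
  have \<psi>TC: "\<psi> \<in> TC" by (rule test_closure_regular[OF \<psi>(1)])
  have diffr: "tb x r \<beta> \<gamma> (\<lambda>x. \<phi> x - \<psi> x) (P * TN (\<lambda>x. \<phi> x - \<psi> x))"
    by (rule P(2)[OF zero_less_one r L(2) L(3) L(4) test_closure_bound[OF diff]]) auto
  have "P * TN (\<lambda>x. \<phi> x - \<psi> x) \<le> P * ((sqrt T - 1) / P)"
    using \<psi>(2) P by (intro mult_left_mono) (auto simp: \<delta>_def)
  then have "1 + P * TN (\<lambda>x. \<phi> x - \<psi> x) \<le> sqrt T" using P by simp
  then have \<psi>r: "tb x r \<beta> \<gamma> \<psi> (sqrt T)"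
    using test_bound_mono[OF r test_bound_minus[OF \<phi>r diffr], of "sqrt T"] by simp
  obtain \<delta>' r' where \<delta>': "\<delta>' > 0" "r' > 0" "\<And>x'. d x x' < \<delta>' \<Longrightarrow> tb x' r' \<beta> \<gamma> \<psi> T"
    using test_bound_perturb[OF r T(1) _ \<psi>r] \<psi>(1) by blast
  have "m \<le> cmod (f \<psi>) + cmod (f (\<lambda>x. \<phi> x - \<psi> x))"
    using distribution_add[OF f diff \<psi>TC] norm_triangle_ineq[of "f (\<lambda>x. \<phi> x - \<psi> x)" "f \<psi>"]
    by (simp add: m_def)
  moreover have "cmod (f (\<lambda>x. \<phi> x - \<psi> x)) \<le> Cf * \<delta>"
  proof -
    have "0 \<le> TN (\<lambda>x. \<phi> x - \<psi> x)" using diff by (intro test_norm_nonneg) (auto simp: test_closure_def)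
    then have "Cf0 * TN (\<lambda>x. \<phi> x - \<psi> x) \<le> Cf * TN (\<lambda>x. \<phi> x - \<psi> x)" by (intro mult_right_mono) (auto simp: Cf_def)
    also have "\<dots> \<le> Cf * \<delta>" using \<psi>(2) Cf by (intro mult_left_mono) auto
    finally show ?thesis using Cf0[OF diff] by linarith
  qed
  moreover have "Cf * \<delta> \<le> Cf * ((m - \<alpha> * T) / (2 * Cf))" using Cf by (intro mult_left_mono) (auto simp: \<delta>_def)
  ultimately have big: "\<alpha> * T < cmod (f \<psi>)" using Cf T(2) by simp
  define \<zeta> where "\<zeta> = (\<lambda>x. complex_of_real (1 / T) * \<psi> x)"
  have \<zeta>: "\<zeta> \<in> TC" unfolding \<zeta>_def using \<psi>(1) by (intro test_closure_regular IntI test_space_cmult) blast+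
  have f\<zeta>: "\<alpha> < cmod (f \<zeta>)"
  proof -
    have "f \<zeta> = complex_of_real (1 / T) * f \<psi>" unfolding \<zeta>_def by (rule distribution_cmult[OF f \<psi>TC])
    then have "cmod (f \<zeta>) = cmod (f \<psi>) / T" using T(1) by (simp add: norm_divide)
    moreover have "\<alpha> < cmod (f \<psi>) / T" using big T(1) by (simp add: pos_less_divide_eq)
    ultimately show ?thesis by simp
  qed
  have "ball x \<delta>' \<subseteq> {x. a < GM f x}"
  proof
    fix x' assume "x' \<in> ball x \<delta>'"
    then have "tb x' r' \<beta> \<gamma> \<psi> T" using \<delta>' by simp
    from test_bound_cmult[OF this, of "complex_of_real (1 / T)"] have "tb x' r' \<beta> \<gamma> \<zeta> 1"
      using T(1) by (simp add: \<zeta>_def norm_divide)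
    then have "ennreal (cmod (f \<zeta>)) \<le> GM f x'" using \<zeta> \<delta>'(2) by (intro grand_maximal_upper)
    moreover have "a < ennreal (cmod (f \<zeta>))" using f\<zeta> \<alpha> by (simp add: ennreal_less_iff)
    ultimately show "x' \<in> {x. a < GM f x}" by simp
  qed
  then show "\<exists>s>0. ball x s \<subseteq> {x. a < GM f x}" using \<delta>'(1) by blast
qed

lemma grand_maximal_measurable [measurable]: "f \<in> DD \<Longrightarrow> GM f \<in> borel_measurable M"
  by (rule borel_measurableI_greater)
    (use grand_maximal_lower_semicontinuous qopen_measurable in \<open>auto simp: space_UNIV\<close>)

lemma test_closure_sup: "\<phi> \<in> TC \<Longrightarrow> cmod (\<phi> y) \<le> Q / V 1 * TN \<phi>"
  using test_bound_sup[OF zero_less_one \<gamma>(1) test_closure_bound, of \<phi> y] by (simp add: mult.commute)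

lemma test_closure_measurable: "\<phi> \<in> TC \<Longrightarrow> \<phi> \<in> borel_measurable M"
  by (rule test_bound_measurable[OF zero_less_one \<beta>(1) test_closure_bound])

lemma test_norm_TC_nonneg: "\<phi> \<in> TC \<Longrightarrow> 0 \<le> TN \<phi>"
  by (rule test_norm_nonneg) (auto simp: test_closure_def)

lemma integrable_mult_test:
  assumes "integrable M g" "\<phi> \<in> TC"
  shows "integrable M (\<lambda>x. g x * \<phi> x)"
    "(LINT x|M. cmod (g x * \<phi> x)) \<le> (LINT x|M. cmod (g x)) * (Q / V 1 * TN \<phi>)"
proof -
  have [measurable]: "\<phi> \<in> borel_measurable M" "g \<in> borel_measurable M"
    using test_closure_measurable assms by auto
  have b: "cmod (g x * \<phi> x) \<le> cmod (g x) * (Q / V 1 * TN \<phi>)" for x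
    using mult_left_mono[OF test_closure_sup[OF assms(2), of x] norm_ge_zero[of "g x"]] by (simp add: norm_mult)
  have i: "integrable M (\<lambda>x. cmod (g x) * (Q / V 1 * TN \<phi>))" using assms(1) by simp
  show 1: "integrable M (\<lambda>x. g x * \<phi> x)"
  proof (rule Bochner_Integration.integrable_bound[OF i])
    show "AE x in M. norm (g x * \<phi> x) \<le> norm (cmod (g x) * (Q / V 1 * TN \<phi>))"
      using b by (intro AE_I2 order_trans[OF b]) (simp only: real_norm_def abs_ge_self)
  qed measurable
  have "(LINT x|M. cmod (g x * \<phi> x)) \<le> (LINT x|M. cmod (g x) * (Q / V 1 * TN \<phi>))"
    using 1 i b by (intro integral_mono) auto
  then show "(LINT x|M. cmod (g x * \<phi> x)) \<le> (LINT x|M. cmod (g x)) * (Q / V 1 * TN \<phi>)" by simp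
qed

lemma distributionI:
  assumes "\<And>\<phi> \<psi>. \<phi> \<in> TC \<Longrightarrow> \<psi> \<in> TC \<Longrightarrow> f (\<lambda>x. \<phi> x + \<psi> x) = f \<phi> + f \<psi>"
    "\<And>c \<phi>. \<phi> \<in> TC \<Longrightarrow> f (\<lambda>x. c * \<phi> x) = c * f \<phi>"
    "\<And>\<phi>. \<phi> \<in> TC \<Longrightarrow> cmod (f \<phi>) \<le> C * TN \<phi>"
  shows "f \<in> DD"
  unfolding distributions_def by (intro CollectI conjI ballI allI exI[of _ C] assms)

lemma fun_distr_add: "integrable M g \<Longrightarrow> \<phi> \<in> TC \<Longrightarrow> \<psi> \<in> TC \<Longrightarrow>
    fun_distr M g (\<lambda>x. \<phi> x + \<psi> x) = fun_distr M g \<phi> + fun_distr M g \<psi>"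
  using integrable_mult_test(1)[of g \<phi>] integrable_mult_test(1)[of g \<psi>]
  by (simp add: fun_distr_def distrib_left)

lemma fun_distr_cmult: "fun_distr M g (\<lambda>x. c * \<phi> x) = c * fun_distr M g \<phi>"
proof -
  have "(\<lambda>x. g x * (c * \<phi> x)) = (\<lambda>x. c * (g x * \<phi> x))" by (auto simp: mult_ac)
  then show ?thesis by (simp add: fun_distr_def)
qed

lemma fun_distr_bound: "integrable M g \<Longrightarrow> \<phi> \<in> TC \<Longrightarrow>
    cmod (fun_distr M g \<phi>) \<le> (LINT x|M. cmod (g x)) * (Q / V 1 * TN \<phi>)"
  unfolding fun_distr_def
  using integrable_mult_test[of g \<phi>] integral_norm_bound[of M "\<lambda>x. g x * \<phi> x"] by linarith

lemma integrable_acts_as_distribution: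
  assumes "integrable M g"
  shows "acts_as_distribution d M K x0 \<epsilon> \<beta> \<gamma> g"
  unfolding acts_as_distribution_def
proof (intro conjI ballI)
  show "fun_distr M g \<in> DD"
    by (rule distributionI[of _ "(LINT x|M. cmod (g x)) * (Q / V 1)"])
      (use assms fun_distr_add fun_distr_cmult fun_distr_bound in \<open>auto simp: mult.assoc\<close>)
qed (rule integrable_mult_test(1)[OF assms])

end

section \<open>Separation by test functions\<close>

context hom_space
begin

text \<open>In the regularity condition the second factor grows with the distances, so it gives no
  global Hoelder bound. After truncation a difference is nonzero only if one distance is below 1;
  for \<open>y\<close> and \<open>y'\<close> at distance below 1 the other is then at most
  \<open>2 * K\<close>, which bounds that factor. Remote \<open>y\<close> and \<open>y'\<close> are
  trivial.\<close>

lemma truncated_dist_holder: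
  assumes k: "1 \<le> (k::real)"
  shows "\<exists>H>0. \<forall>y y' z. \<bar>min 1 (k * d y z) - min 1 (k * d y' z)\<bar> \<le> H * d y y' powr \<theta>"
proof -
  define H where "H = 1 + k * A * (4 * K) powr (1 - \<theta>)"
  have H: "1 \<le> H" "k * A * (4 * K) powr (1 - \<theta>) \<le> H" using k A_pos by (auto simp: H_def)
  have "\<bar>min 1 (k * d y z) - min 1 (k * d y' z)\<bar> \<le> H * d y y' powr \<theta>" for y y' z
  proof (cases "1 \<le> d y y'")
    case True
    have "0 \<le> k * d y z" "0 \<le> k * d y' z" using k dist_nonneg by auto
    then have "\<bar>min 1 (k * d y z) - min 1 (k * d y' z)\<bar> \<le> 1" by linarith
    also have "\<dots> \<le> 1 * d y y' powr \<theta>" using True theta by (simp add: ge_one_powr_ge_zero)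
    also have "\<dots> \<le> H * d y y' powr \<theta>" using H by (intro mult_right_mono) auto
    finally show ?thesis .
  next
    case near: False
    show ?thesis
    proof (cases "1 \<le> k * d y z \<and> 1 \<le> k * d y' z")
      case True
      then show ?thesis using H by (simp add: min_def)
    next
      case False
      have one: "a \<le> 1" if "\<not> 1 \<le> k * a" "0 \<le> a" for a
        using that k mult_right_mono[of 1 k a] by linarith
      have "d y z \<le> 2 * K \<and> d y' z \<le> 2 * K"
      proof (cases "1 \<le> k * d y z")
        case True
        then have z: "d y' z \<le> 1" using False one dist_nonneg by blast
        have "d y z \<le> K * (1 + 1)" using near z by (intro dist_triangle_le) auto
        then show ?thesis using z K0_ge_1 by simp
      next
        case False
        then have z: "d y z \<le> 1" using one dist_nonneg by blast
        have "d y' z \<le> K * (1 + 1)" using near z by (intro dist_triangle_le[of y' y]) (auto simp: dist_commute)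
        then show ?thesis using z K0_ge_1 by simp
      qed
      then have s: "(d y z + d y' z) powr (1 - \<theta>) \<le> (4 * K) powr (1 - \<theta>)"
        using theta dist_nonneg[of y z] dist_nonneg[of y' z] by (intro powr_mono2) auto
      have "\<bar>min 1 (k * d y z) - min 1 (k * d y' z)\<bar> \<le> \<bar>k * d y z - k * d y' z\<bar>"
        by (auto simp: min_def)
      also have "\<dots> = k * \<bar>d y z - d y' z\<bar>" using k by (simp add: abs_mult right_diff_distrib[symmetric])
      also have "\<dots> \<le> k * (A * d y y' powr \<theta> * (d y z + d y' z) powr (1 - \<theta>))"
        using k dist_regular by (intro mult_left_mono) auto
      also have "\<dots> \<le> k * (A * d y y' powr \<theta> * (4 * K) powr (1 - \<theta>))"
        using k A_pos s by (intro mult_left_mono) auto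
      also have "\<dots> = (k * A * (4 * K) powr (1 - \<theta>)) * d y y' powr \<theta>" by simp
      also have "\<dots> \<le> H * d y y' powr \<theta>" using H by (intro mult_right_mono) auto
      finally show ?thesis .
    qed
  qed
  then show ?thesis using H(1) by (intro exI[of _ H]) auto
qed

text \<open>A Hoelder function that vanishes off \<open>U\<close> and tends to the indicator of
  \<open>U\<close> when \<open>U\<close> is open and proper. All members of the infimum satisfy the
  same Hoelder bound, hence so does the infimum.\<close>

definition cutoff :: "'a set \<Rightarrow> nat \<Rightarrow> 'a \<Rightarrow> real" where
  "cutoff U k y = (INF z\<in>-U. min 1 (real (Suc k) * d y z))"

lemma cutoff_bdd: "bdd_below ((\<lambda>z. min 1 (real (Suc k) * d y z)) ` S)"
  using dist_nonneg by (intro bdd_belowI2[of _ 0]) auto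

lemma cutoff_range: "U \<noteq> UNIV \<Longrightarrow> 0 \<le> cutoff U k y \<and> cutoff U k y \<le> 1"
proof -
  assume "U \<noteq> UNIV"
  then obtain z where z: "z \<in> -U" by auto
  have "cutoff U k y \<le> min 1 (real (Suc k) * d y z)"
    unfolding cutoff_def using cutoff_bdd z by (intro cINF_lower) auto
  moreover have "0 \<le> cutoff U k y"
    unfolding cutoff_def using z dist_nonneg by (intro cINF_greatest) auto
  ultimately show ?thesis by simp
qed

lemma cutoff_outside: "y \<notin> U \<Longrightarrow> cutoff U k y = 0"
proof -
  assume y: "y \<notin> U"
  then have "cutoff U k y \<le> min 1 (real (Suc k) * d y y)"
    unfolding cutoff_def using cutoff_bdd by (intro cINF_lower) auto
  moreover have "0 \<le> cutoff U k y" using cutoff_range[of U k y] y by blast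
  ultimately show ?thesis by simp
qed

lemma cutoff_tendsto:
  assumes U: "qopen d U" "U \<noteq> UNIV"
  shows "(\<lambda>k. cutoff U k y) \<longlonglongrightarrow> indicator U y"
proof (cases "y \<in> U")
  case True
  then obtain s where s: "s > 0" "ball y s \<subseteq> U" using U by (auto simp: qopen_def)
  obtain N :: nat where N: "1 / s < real N" using reals_Archimedean2 by blast
  have "cutoff U k y = 1" if "N \<le> k" for k
  proof -
    have "1 \<le> cutoff U k y" unfolding cutoff_def
    proof (rule cINF_greatest)
      fix z assume "z \<in> -U"
      then have "s \<le> d y z" using s by (metis ComplD mem_ball not_less subsetD)
      then have "1 / s * s \<le> real (Suc k) * d y z"
        using N that s by (intro mult_mono) auto
      then show "1 \<le> min 1 (real (Suc k) * d y z)" using s by simp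
    qed (use U in auto)
    then show ?thesis using cutoff_range[OF U(2), of k y] by simp
  qed
  then have "\<forall>\<^sub>F k in sequentially. cutoff U k y = 1" by (rule eventually_sequentiallyI)
  then show ?thesis using True by (simp add: tendsto_eventually)
qed (simp add: cutoff_outside)

lemma cutoff_holder:
  assumes "U \<noteq> UNIV"
  shows "\<exists>H>0. \<forall>y y'. \<bar>cutoff U k y - cutoff U k y'\<bar> \<le> H * d y y' powr \<theta>"
proof -
  obtain H where H: "H > 0" "\<And>y y' z. \<bar>min 1 (real (Suc k) * d y z) - min 1 (real (Suc k) * d y' z)\<bar> \<le> H * d y y' powr \<theta>"
    using truncated_dist_holder[of "real (Suc k)"] by auto
  have *: "cutoff U k y - H * d y y' powr \<theta> \<le> cutoff U k y'" for y y'
    unfolding cutoff_def[of U k y']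
  proof (rule cINF_greatest)
    fix z assume z: "z \<in> -U"
    have "cutoff U k y \<le> min 1 (real (Suc k) * d y z)"
      unfolding cutoff_def using cutoff_bdd z by (intro cINF_lower) auto
    then show "cutoff U k y - H * d y y' powr \<theta> \<le> min 1 (real (Suc k) * d y' z)"
      using H(2)[of y z y'] by linarith
  qed (use assms in auto)
  have "\<bar>cutoff U k y - cutoff U k y'\<bar> \<le> H * d y y' powr \<theta>" for y y'
    using *[of y y'] *[of y' y] by (simp add: dist_commute abs_le_iff)
  then show ?thesis using H(1) by auto
qed

lemma holder_compact_support_test_bound:
  assumes u: "\<And>y. 0 \<le> u y" "\<And>y. u y \<le> 1" "\<And>y y'. \<bar>u y - u y'\<bar> \<le> H * d y y' powr \<theta>"
    and supp: "\<And>y. y \<notin> ball x R \<Longrightarrow> u y = 0" and R: "0 < R" and H: "0 < H"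
    and e: "0 < e" "e \<le> \<theta>" and g: "0 < g"
  shows "\<exists>C. tb x 1 e g (\<lambda>y. complex_of_real (u y)) C"
proof -
  define R1 where "R1 = 2 * K * R + 1"
  have "1 * R \<le> (2 * K) * R" using K0_ge_1 R by (intro mult_right_mono) auto
  then have R1: "R \<le> R1" by (simp add: R1_def)
  define w where "w = 1 / (Q * V (1 + R1)) * (1 / (1 + R1)) powr g"
  have p: "0 < 1 + R1" using R R1 by simp
  have w: "0 < w" using p Q_ge_1 V_pos[OF p] by (simp add: w_def)
  have tww: "w \<le> tw g x 1 y" if "d x y \<le> R1" for y
  proof -
    note q = radius_pos[OF zero_less_one, of x y]
    have "measure M (ball y (1 + d x y)) \<le> Q * V (1 + R1)"
    proof (rule order_trans[OF measure_le_V[OF q]])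
      show "Q * V (1 + d x y) \<le> Q * V (1 + R1)"
        using V_mono[OF q, of "1 + R1"] that Q_ge_1 by (intro mult_left_mono) auto
    qed
    then have "1 / (Q * V (1 + R1)) \<le> 1 / measure M (ball y (1 + d x y))"
      using measure_qball_pos[OF q, of y] by (intro divide_left_mono) auto
    moreover have "(1 / (1 + R1)) powr g \<le> (1 / (1 + d x y)) powr g"
      using q that g p by (intro powr_mono2 divide_left_mono) auto
    ultimately show ?thesis unfolding w_def tw_def by (rule mult_mono) auto
  qed
  define C where "C = 1 / w + H * (1 + R1) powr \<theta> / w"
  have C: "1 / w \<le> C" "H * (1 + R1) powr \<theta> / w \<le> C" using w H by (auto simp: C_def)
  then have C0: "0 \<le> C" using w by (meson divide_nonneg_pos le_less order_trans zero_le_one)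
  have Cw: "1 \<le> C * w" "H * (1 + R1) powr \<theta> \<le> C * w" using C w by (auto simp: divide_le_eq)
  have "tb x 1 e g (\<lambda>y. complex_of_real (u y)) C"
  proof (rule test_boundI)
    fix y
    show "cmod (complex_of_real (u y)) \<le> C * tw g x 1 y"
    proof (cases "y \<in> ball x R")
      case True
      have "u y \<le> 1" by (rule u)
      also have "\<dots> \<le> C * w" by (rule Cw)
      also have "\<dots> \<le> C * tw g x 1 y" using True R1 C0 by (intro mult_left_mono tww) auto
      finally show ?thesis using u(1)[of y] by simp
    qed (use supp C0 tw_nonneg[OF zero_less_one] in auto)
    fix z assume z: "d y z \<le> (1 + d x y) / (2 * K)"
    show "cmod (complex_of_real (u y) - complex_of_real (u z)) \<le> C * ((d y z / (1 + d x y)) powr e * tw g x 1 y)"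
    proof (cases "d x y \<le> R1")
      case True
      note q = radius_pos[OF zero_less_one, of x y]
      have "(1 + d x y) / (2 * K) \<le> (1 + d x y) / 1" using q K0_ge_1 by (intro divide_left_mono) auto
      then have dz: "d y z \<le> 1 + R1" using z True by simp
      have eq: "d y z = (d y z / (1 + d x y)) * (1 + d x y)" using q by simp
      have "d y z powr \<theta> = d y z powr (\<theta> - e) * d y z powr e" by (simp add: powr_add[symmetric])
      also have "\<dots> \<le> (1 + R1) powr (\<theta> - e) * ((d y z / (1 + d x y)) powr e * (1 + R1) powr e)"
      proof (rule mult_mono)
        show "d y z powr (\<theta> - e) \<le> (1 + R1) powr (\<theta> - e)" using dz e dist_nonneg by (intro powr_mono2) auto
        have "d y z powr e = (d y z / (1 + d x y)) powr e * (1 + d x y) powr e" by (subst eq, simp only: powr_mult)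
        also have "\<dots> \<le> (d y z / (1 + d x y)) powr e * (1 + R1) powr e"
          using True e q by (intro mult_left_mono powr_mono2) auto
        finally show "d y z powr e \<le> (d y z / (1 + d x y)) powr e * (1 + R1) powr e" .
      qed auto
      also have "\<dots> = (1 + R1) powr \<theta> * (d y z / (1 + d x y)) powr e" by (simp add: powr_diff p less_imp_neq[symmetric])
      finally have "H * d y z powr \<theta> \<le> H * ((1 + R1) powr \<theta> * (d y z / (1 + d x y)) powr e)"
        using H by (intro mult_left_mono) auto
      also have "\<dots> = (H * (1 + R1) powr \<theta>) * (d y z / (1 + d x y)) powr e" by simp
      also have "\<dots> \<le> (C * tw g x 1 y) * (d y z / (1 + d x y)) powr e"
        using order_trans[OF Cw(2) mult_left_mono[OF tww[OF True] C0]] by (intro mult_right_mono) auto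
      finally have "\<bar>u y - u z\<bar> \<le> C * ((d y z / (1 + d x y)) powr e * tw g x 1 y)"
        using u(3)[of y z] by (simp add: mult_ac)
      then show ?thesis by (simp flip: of_real_diff)
    next
      case False
      then have "y \<notin> ball x R" using R1 by auto
      moreover have "z \<notin> ball x R"
      proof
        assume "z \<in> ball x R"
        then have "d x y \<le> K * (R + (1 + d x y) / (2 * K))"
          using z by (intro dist_triangle_le[of x z]) (auto simp: dist_commute)
        also have "\<dots> = K * R + (1 + d x y) / 2" using K_pos by (simp add: field_simps)
        finally have "d x y \<le> R1" by (simp add: R1_def field_simps)
        then show False using False by simp
      qed
      ultimately show ?thesis using supp C0 tw_nonneg[OF zero_less_one, of g x y] by simp
    qed
  qed
  then show ?thesis by blast
qed

end

context test_setting
begin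

text \<open>A bounded set misses a point because annuli are nonempty, so the cutoffs of
  \<open>U\<close> are available; dominated convergence carries the vanishing pairings to the
  indicator.\<close>

lemma test_separation_open_bounded:
  assumes f: "integrable M f" and z: "\<And>\<phi>. \<phi> \<in> TC \<Longrightarrow> fun_distr M f \<phi> = 0"
    and U: "qopen d U" "U \<subseteq> ball x0 R"
  shows "set_lebesgue_integral M U f = 0"
proof (cases "0 < R")
  case False
  then have "U = {}" using U ball_empty[of R x0] by auto
  then show ?thesis by (simp add: set_lebesgue_integral_def)
next
  case R: True
  have ne: "U \<noteq> UNIV" using annuli_nonempty[of R "R + 1" x0] R U by auto
  have Um: "U \<in> sets M" using U(1) by (rule qopen_measurable)
  have fm[measurable]: "f \<in> borel_measurable M" using f by auto
  have uTC: "(\<lambda>y. complex_of_real (cutoff U k y)) \<in> TC" for k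
  proof -
    obtain H where H: "H > 0" "\<And>y y'. \<bar>cutoff U k y - cutoff U k y'\<bar> \<le> H * d y y' powr \<theta>"
      using cutoff_holder[OF ne] by blast
    have supp: "cutoff U k y = 0" if "y \<notin> ball x0 R" for y using U(2) cutoff_outside that by blast
    have *: "\<exists>C. tb x0 1 e g (\<lambda>y. complex_of_real (cutoff U k y)) C" if "0 < e" "e \<le> \<theta>" "0 < g" for e g
      by (rule holder_compact_support_test_bound[OF _ _ H(2) supp R H(1) that])
        (use cutoff_range[OF ne] in auto)
    show ?thesis
      using *[of \<epsilon> \<epsilon>] *[of \<beta> \<gamma>] \<beta> \<gamma> \<epsilon>_le
      by (intro test_closure_regular) (auto simp: test_space_def)
  qed
  have "(\<lambda>k. LINT y|M. f y * complex_of_real (cutoff U k y)) \<longlonglongrightarrow> (LINT y|M. f y * complex_of_real (indicator U y))"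
  proof (rule integral_dominated_convergence[where w = "\<lambda>y. cmod (f y)"])
    show "(\<lambda>y. f y * complex_of_real (cutoff U k y)) \<in> borel_measurable M" for k
      using test_closure_measurable[OF uTC[of k]] by measurable
    show "(\<lambda>y. f y * complex_of_real (indicator U y)) \<in> borel_measurable M" using Um by measurable
    show "AE y in M. (\<lambda>k. f y * complex_of_real (cutoff U k y)) \<longlonglongrightarrow> f y * complex_of_real (indicator U y)"
      by (intro AE_I2 tendsto_mult tendsto_const tendsto_of_real cutoff_tendsto U(1) ne)
    show "AE y in M. cmod (f y * complex_of_real (cutoff U k y)) \<le> cmod (f y)" for k
      using cutoff_range[OF ne, of k] by (intro AE_I2) (simp add: norm_mult mult_left_le)
  qed (use f in auto)
  then have "(\<lambda>k. 0::complex) \<longlonglongrightarrow> (LINT y|M. f y * complex_of_real (indicator U y))"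
    using z[OF uTC] by (simp add: fun_distr_def)
  then have "(LINT y|M. f y * complex_of_real (indicator U y)) = 0" by (simp add: LIMSEQ_const_iff)
  then show ?thesis by (simp add: set_lebesgue_integral_def scaleR_conv_of_real mult.commute)
qed

text \<open>Vanishing integrals pass from bounded open sets to open sets by exhaustion, and to Borel
  sets by the pi-lambda argument, open sets being stable under intersection.\<close>

lemma test_separation:
  assumes f: "integrable M f" and z: "\<And>\<phi>. \<phi> \<in> TC \<Longrightarrow> fun_distr M f \<phi> = 0"
  shows "AE x in M. f x = 0"
proof (rule density_zero[OF f])
  have fm[measurable]: "f \<in> borel_measurable M" using f by auto
  have si: "set_integrable M S f" if "S \<in> sets M" for S
    using f that by (simp add: set_integrable_def integrable_mult_indicator)
  have open0: "set_lebesgue_integral M U f = 0" if U: "qopen d U" for U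
  proof -
    have Um: "U \<in> sets M" using U by (rule qopen_measurable)
    have "(\<lambda>k. LINT y|M. indicator (U \<inter> ball x0 (real k)) y *\<^sub>R f y) \<longlonglongrightarrow> (LINT y|M. indicator U y *\<^sub>R f y)"
    proof (rule integral_dominated_convergence[where w = "\<lambda>y. cmod (f y)"])
      have "(\<lambda>k. indicator (U \<inter> ball x0 (real k)) y *\<^sub>R f y) \<longlonglongrightarrow> indicator U y *\<^sub>R f y" for y
      proof (rule tendsto_eventually)
        obtain N :: nat where "d x0 y < real N" using reals_Archimedean2 by blast
        then show "\<forall>\<^sub>F k in sequentially. indicator (U \<inter> ball x0 (real k)) y *\<^sub>R f y = indicator U y *\<^sub>R f y"
          by (intro eventually_sequentiallyI[of N]) (auto split: split_indicator)
      qed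
      then show "AE y in M. (\<lambda>k. indicator (U \<inter> ball x0 (real k)) y *\<^sub>R f y) \<longlonglongrightarrow> indicator U y *\<^sub>R f y" by simp
    qed (use f Um in \<open>auto split: split_indicator\<close>)
    moreover have "(LINT y|M. indicator (U \<inter> ball x0 (real k)) y *\<^sub>R f y) = 0" for k
      using test_separation_open_bounded[OF f z qopen_Int[OF U qopen_ball], of x0 "real k" "real k"]
      by (simp add: set_lebesgue_integral_def)
    ultimately show ?thesis by (simp add: set_lebesgue_integral_def LIMSEQ_const_iff)
  qed
  fix S assume S: "S \<in> sets M"
  have "S \<in> sigma_sets UNIV {U. qopen d U}" using S by (simp add: sets_borel)
  have "Int_stable {U. qopen d U}" by (auto simp: Int_stable_def qopen_Int)
  moreover have "{U. qopen d U} \<subseteq> Pow UNIV" by simp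
  ultimately show "set_lebesgue_integral M S f = 0"
    using \<open>S \<in> sigma_sets UNIV {U. qopen d U}\<close>
  proof (induction rule: sigma_sets_induct_disjoint)
    case (basic A) then show ?case using open0 by simp
  next
    case (compl A)
    then have A: "A \<in> sets M" by (simp add: sets_borel)
    have "set_lebesgue_integral M (A \<union> (UNIV - A)) f = set_lebesgue_integral M A f + set_lebesgue_integral M (UNIV - A) f"
      using A sets.compl_sets[OF A] by (intro set_integral_Un si) (auto simp: space_UNIV)
    moreover have "A \<union> (UNIV - A) = UNIV" by auto
    ultimately show ?case using open0[OF qopen_UNIV] compl by simp
  next
    case (union X)
    then have X: "X i \<in> sets M" for i by (auto simp: sets_borel)
    have "(LINT y:(\<Union>i. X i)|M. f y) = (\<Sum>i. LINT y:X i|M. f y)"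
      using X union(1) by (intro lebesgue_integral_countable_add si) (auto simp: disjoint_family_on_def)
    then show ?case using union by simp
  qed (simp_all add: set_lebesgue_integral_def)
qed

end

section \<open>Atoms with a finite exponent\<close>

context hom_space
begin

text \<open>An atom with finite exponent, normalised without roots: \<open>\<parallel>a\<parallel>\<^sub>q\<^sup>q \<le> \<mu>(B)\<^sup>1\<^sup>-\<^sup>q\<close>.\<close>

definition q_atom :: "real \<Rightarrow> 'a \<Rightarrow> real \<Rightarrow> ('a \<Rightarrow> complex) \<Rightarrow> bool" where
  "q_atom q x r a \<longleftrightarrow> 0 < r \<and> a \<in> borel_measurable M \<and> (\<forall>y. y \<notin> ball x r \<longrightarrow> a y = 0) \<and>
     (\<integral>\<^sup>+y. ennreal (cmod (a y) powr q) \<partial>M) \<le> ennreal (measure M (ball x r) powr (1 - q)) \<and>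
     (LINT y|M. a y) = 0"

text \<open>An atom with exponent \<infinity> is handled as one with exponent 2: its squared modulus
  is at most \<open>m powr (-2)\<close> almost everywhere on a ball of measure \<open>m\<close>. The
  later estimates can then be stated for finite exponents.\<close>

lemma atom_imp_q_atom:
  assumes a: "atom M q (ball x r) a" and q: "1 < q" and r: "0 < r"
  shows "q_atom (if q = \<infinity> then 2 else real_of_ereal q) x r a"
proof -
  define m where "m = measure M (ball x r)"
  have m: "0 < m" using measure_qball_pos[OF r] by (simp add: m_def)
  have am[measurable]: "a \<in> borel_measurable M" and supp: "\<And>y. y \<notin> ball x r \<Longrightarrow> a y = 0"
    and size: "Lq_norm M q a \<le> ereal (m powr (real_of_ereal (1 / q) - 1))" and int: "(LINT y|M. a y) = 0"
    using a unfolding atom_def Lq_space_def m_def by auto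
  show ?thesis
  proof (cases "q = \<infinity>")
    case True
    have "AE y in M. ereal (cmod (a y)) \<le> esssup M (\<lambda>y. ereal (cmod (a y)))" by (rule esssup_AE)
    then have "AE y in M. ennreal (cmod (a y) powr 2) \<le> ennreal (m powr (-2)) * indicator (ball x r) y"
    proof eventually_elim
      case (elim y)
      have "ereal (cmod (a y)) \<le> ereal (m powr (real_of_ereal (1 / q) - 1))"
        by (rule order_trans[OF elim order_trans[OF _ size]]) (simp add: Lq_norm_def True)
      then have "cmod (a y) \<le> m powr (-1)" by (simp add: True)
      then have "cmod (a y) powr 2 \<le> (m powr (-1)) powr 2" by (intro powr_mono2) auto
      also have "\<dots> = m powr (-2)" by (simp only: powr_powr) simp
      finally show ?case using supp[of y] by (auto split: split_indicator intro: ennreal_leI)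
    qed
    then have "(\<integral>\<^sup>+y. ennreal (cmod (a y) powr 2) \<partial>M) \<le> (\<integral>\<^sup>+y. ennreal (m powr (-2)) * indicator (ball x r) y \<partial>M)"
      by (rule nn_integral_mono_AE)
    also have "\<dots> = ennreal (m powr (-2) * m)"
      using r by (simp add: nn_integral_cmult emeasure_ball m_def ennreal_mult)
    also have "m powr (-2) * m = m powr (1 - 2)" using m by (simp add: powr_mult_base mult.commute)
    finally show ?thesis using am supp int r True by (auto simp: q_atom_def m_def)
  next
    case False
    then obtain p where p: "q = ereal p" using q by (cases q) auto
    then have p1: "1 < p" using q by simp
    define J where "J = (LINT y|M. cmod (a y) powr p)"
    have i: "integrable M (\<lambda>y. cmod (a y) powr p)" and J: "J powr (1 / p) \<le> m powr (1 / p - 1)"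
      using size p p1 by (auto simp: Lq_norm_def J_def one_ereal_def split: if_splits)
    have J0: "0 \<le> J" unfolding J_def by (intro integral_nonneg_AE) auto
    have "J = (J powr (1 / p)) powr p" using J0 p1 by (simp add: powr_powr)
    also have "\<dots> \<le> (m powr (1 / p - 1)) powr p" using J p1 by (intro powr_mono2) auto
    also have "\<dots> = m powr (1 - p)" using p1 by (simp add: powr_powr left_diff_distrib)
    finally have "J \<le> m powr (1 - p)" .
    moreover have "(\<integral>\<^sup>+y. ennreal (cmod (a y) powr p) \<partial>M) = ennreal J"
      unfolding J_def by (rule nn_integral_eq_integral[OF i]) auto
    ultimately show ?thesis using am supp int r p by (auto simp: q_atom_def m_def intro: ennreal_leI)
  qed
qed

text \<open>A substitute for Hoelder's inequality with a free threshold: either \<open>s\<close> is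
  at most \<open>T / m\<close>, or the factor \<open>(s * m / T) powr (q - 1)\<close> is at least
  1.\<close>

lemma atom_split:
  assumes T: "0 < (T::real)" and m: "0 < m" and q: "1 < q" and s: "0 \<le> s"
  shows "s \<le> T / m + T powr (1 - q) * m powr (q - 1) * s powr q"
proof (cases "s * m \<le> T")
  case True
  then have "s \<le> T / m" using m by (simp add: field_simps)
  then show ?thesis by (simp add: add_increasing2)
next
  case False
  then have s: "0 < s" using s T m by (cases "s = 0") auto
  have "s * (T powr (q - 1)) \<le> s * ((s * m) powr (q - 1))"
    using False T q s by (intro mult_left_mono powr_mono2) auto
  also have "\<dots> = m powr (q - 1) * (s powr 1 * s powr (q - 1))" using s m by (simp add: powr_mult)
  also have "s powr 1 * s powr (q - 1) = s powr q" by (simp only: powr_add[symmetric]) simp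
  finally have "s * T powr (q - 1) * T powr (1 - q) \<le> m powr (q - 1) * s powr q * T powr (1 - q)"
    by (intro mult_right_mono) auto
  moreover have "T powr (q - 1) * T powr (1 - q) = 1" using T by (simp add: powr_add[symmetric])
  ultimately have "s \<le> T powr (1 - q) * m powr (q - 1) * s powr q" by (simp add: mult_ac)
  then show ?thesis using T m by (simp add: add_increasing)
qed

text \<open>Interpolates between the integral of \<phi> over the ball and its sup bound
  \<open>W\<close>; the threshold \<open>T\<close> sets the balance. The value 1 gives the L^1 bound
  of an atom, and \<open>m powr (1/2)\<close> the decay of pairings on large balls.\<close>

lemma q_atom_weighted:
  assumes a: "q_atom q x r a" and q: "1 < q" and T: "0 < T" and m: "m = measure M (ball x r)"
    and \<phi>[measurable]: "\<phi> \<in> borel_measurable M" and W: "\<And>y. \<phi> y \<le> ennreal W" "0 \<le> W"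
  shows "(\<integral>\<^sup>+y. \<phi> y * ennreal (cmod (a y)) \<partial>M) \<le> ennreal (T / m) * (\<integral>\<^sup>+y\<in>ball x r. \<phi> y \<partial>M) + ennreal (W * T powr (1 - q))"
proof -
  have r: "0 < r" and am[measurable]: "a \<in> borel_measurable M" and supp: "\<And>y. y \<notin> ball x r \<Longrightarrow> a y = 0"
    and size: "(\<integral>\<^sup>+y. ennreal (cmod (a y) powr q) \<partial>M) \<le> ennreal (m powr (1 - q))"
    using a by (auto simp: q_atom_def m)
  have m0: "0 < m" using measure_qball_pos[OF r] by (simp add: m)
  have "(\<integral>\<^sup>+y. \<phi> y * ennreal (cmod (a y)) \<partial>M) \<le> (\<integral>\<^sup>+y. ennreal (T / m) * (\<phi> y * indicator (ball x r) y)
      + ennreal (W * (T powr (1 - q) * m powr (q - 1))) * ennreal (cmod (a y) powr q) \<partial>M)"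
  proof (rule nn_integral_mono)
    fix y
    show "\<phi> y * ennreal (cmod (a y)) \<le> ennreal (T / m) * (\<phi> y * indicator (ball x r) y)
      + ennreal (W * (T powr (1 - q) * m powr (q - 1))) * ennreal (cmod (a y) powr q)"
    proof (cases "y \<in> ball x r")
      case True
      have "\<phi> y * ennreal (cmod (a y)) \<le> \<phi> y * ennreal (T / m + T powr (1 - q) * m powr (q - 1) * cmod (a y) powr q)"
        by (intro mult_left_mono ennreal_leI atom_split T m0 q) auto
      also have "\<dots> = \<phi> y * ennreal (T / m) + \<phi> y * ennreal (T powr (1 - q) * m powr (q - 1) * cmod (a y) powr q)"
        using T m0 by (simp add: ennreal_plus distrib_left)
      also have "\<dots> \<le> \<phi> y * ennreal (T / m) + ennreal W * ennreal (T powr (1 - q) * m powr (q - 1) * cmod (a y) powr q)"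
        by (intro add_left_mono mult_right_mono W) auto
      finally show ?thesis using True W by (simp add: ennreal_mult mult_ac)
    qed (use supp in auto)
  qed
  also have "\<dots> = ennreal (T / m) * (\<integral>\<^sup>+y\<in>ball x r. \<phi> y \<partial>M)
      + ennreal (W * (T powr (1 - q) * m powr (q - 1))) * (\<integral>\<^sup>+y. ennreal (cmod (a y) powr q) \<partial>M)"
    by (subst nn_integral_add) (auto simp: nn_integral_cmult)
  also have "\<dots> \<le> ennreal (T / m) * (\<integral>\<^sup>+y\<in>ball x r. \<phi> y \<partial>M)
      + ennreal (W * (T powr (1 - q) * m powr (q - 1))) * ennreal (m powr (1 - q))"
    by (intro add_left_mono mult_left_mono size) auto
  also have "ennreal (W * (T powr (1 - q) * m powr (q - 1))) * ennreal (m powr (1 - q)) = ennreal (W * T powr (1 - q))"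
    using W m0 by (simp add: ennreal_mult[symmetric] powr_add[symmetric] mult.assoc)
  finally show ?thesis .
qed

lemma q_atom_L1:
  assumes a: "q_atom q x r a" and q: "1 < q"
  shows "(\<integral>\<^sup>+y. ennreal (cmod (a y)) \<partial>M) \<le> 2" and "integrable M a"
proof -
  have r: "0 < r" and am: "a \<in> borel_measurable M" using a by (auto simp: q_atom_def)
  have m0: "0 < measure M (ball x r)" using measure_qball_pos[OF r] .
  have "(\<integral>\<^sup>+y. 1 * ennreal (cmod (a y)) \<partial>M)
      \<le> ennreal (1 / measure M (ball x r)) * (\<integral>\<^sup>+y\<in>ball x r. 1 \<partial>M) + ennreal (1 * 1 powr (1 - q))"
    by (rule q_atom_weighted[OF a q zero_less_one refl]) auto
  also have "\<dots> = 2" using r m0 by (simp add: emeasure_ball ennreal_mult[symmetric])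
  finally show *: "(\<integral>\<^sup>+y. ennreal (cmod (a y)) \<partial>M) \<le> 2" by simp
  then show "integrable M a" using am
    by (intro integrableI_bounded) (auto intro: le_less_trans)
qed

end

section \<open>Grand maximal functions of atoms\<close>

lemma young_le:
  assumes p: "1 < (p::real)" and u: "0 \<le> u" "0 \<le> t"
  shows "u * t \<le> u powr (p / (p - 1)) + t powr p"
proof (cases "u \<le> t powr (p - 1)")
  case True
  have "u * t \<le> t powr (p - 1) * t" using True u by (intro mult_right_mono) auto
  also have "\<dots> = t powr p" using u by (cases "t = 0") (auto simp: powr_mult_base[symmetric] mult.commute powr_diff)
  finally show ?thesis by (simp add: add_increasing)
next
  case False
  then have u0: "0 < u" using u by (cases "u = 0") auto
  have "t = (t powr (p - 1)) powr (1 / (p - 1))" using p u by (simp add: powr_powr)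
  also have "\<dots> \<le> u powr (1 / (p - 1))" using False p by (intro powr_mono2) auto
  finally have "u * t \<le> u powr 1 * u powr (1 / (p - 1))" using u by (simp add: mult_left_mono)
  also have "\<dots> = u powr (1 + 1 / (p - 1))" by (simp only: powr_add)
  also have "1 + 1 / (p - 1) = p / (p - 1)" using p by (simp add: field_simps)
  finally show ?thesis by (simp add: add_increasing2)
qed

text \<open>Young's inequality with the power of \<open>g\<close> replaced by a sum over dyadic
  levels: \<open>g\<close> may be infinite, and it will be known through the measures of its level
  sets. The summand 1 accounts for values of \<open>g\<close> up to 1.\<close>

lemma young_dyadic_levels:
  assumes p: "1 < (p::real)" and u: "0 \<le> u"
  shows "ennreal u * g \<le> ennreal (u powr (p / (p - 1))) + 1
    + (\<Sum>k. ennreal (2 powr (p * real (Suc k))) * of_bool (ennreal (2 ^ k) < g))"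
proof (cases "g = \<infinity>")
  case True
  have "ennreal (real N) \<le> (\<Sum>k. ennreal (2 powr (p * real (Suc k))) * of_bool (ennreal (2 ^ k) < g))" for N
  proof -
    have "ennreal (real N) = (\<Sum>k<N. ennreal 1)" by (simp add: ennreal_of_nat_eq_real_of_nat)
    also have "\<dots> \<le> (\<Sum>k<N. ennreal (2 powr (p * real (Suc k))) * of_bool (ennreal (2 ^ k) < g))"
      using True p by (intro sum_mono) (auto intro!: ge_one_powr_ge_zero)
    also have "\<dots> \<le> (\<Sum>k. ennreal (2 powr (p * real (Suc k))) * of_bool (ennreal (2 ^ k) < g))"
      by (rule sum_le_suminf) auto
    finally show ?thesis .
  qed
  then have "of_nat N \<le> (\<Sum>k. ennreal (2 powr (p * real (Suc k))) * of_bool (ennreal (2 ^ k) < g))" for N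
    by (simp only: ennreal_of_nat_eq_real_of_nat)
  then have "\<not> (\<Sum>k. ennreal (2 powr (p * real (Suc k))) * of_bool (ennreal (2 ^ k) < g)) < \<infinity>"
    using ennreal_Ex_less_of_nat by (metis infinity_ennreal_def not_le)
  then have "(\<Sum>k. ennreal (2 powr (p * real (Suc k))) * of_bool (ennreal (2 ^ k) < g)) = \<infinity>"
    by - (rule ccontr, auto simp: less_top)
  then show ?thesis by simp
next
  case False
  then obtain t where t: "g = ennreal t" "0 \<le> t" by (cases g) auto
  have tp: "ennreal (t powr p) \<le> 1 + (\<Sum>k. ennreal (2 powr (p * real (Suc k))) * of_bool (ennreal (2 ^ k) < g))"
  proof (cases "t \<le> 1")
    case True
    then have "t powr p \<le> 1" using t p by (intro powr_le1) auto
    then show ?thesis by (simp add: add_increasing2)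
  next
    case False
    define k where "k = nat (\<lceil>log 2 t\<rceil> - 1)"
    have "0 < log 2 t" using False by simp
    then have k: "real k < log 2 t" "log 2 t \<le> real (Suc k)" unfolding k_def by linarith+
    have "2 ^ k < t" using k(1) False by (simp add: less_log_iff powr_realpow)
    then have lt: "ennreal (2 ^ k) < g" using t by (simp add: ennreal_less_iff)
    have "t \<le> 2 powr real (Suc k)" using k(2) False by (subst (asm) log_le_iff) auto
    then have "t powr p \<le> (2 powr real (Suc k)) powr p" using t p by (intro powr_mono2) auto
    also have "\<dots> = 2 powr (p * real (Suc k))" by (simp only: powr_powr mult.commute)
    finally have "ennreal (t powr p) \<le> (\<Sum>i\<in>{k}. ennreal (2 powr (p * real (Suc i))) * of_bool (ennreal (2 ^ i) < g))"
      using lt by (simp add: ennreal_leI)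
    also have "\<dots> \<le> (\<Sum>k. ennreal (2 powr (p * real (Suc k))) * of_bool (ennreal (2 ^ k) < g))"
      by (rule sum_le_suminf) auto
    finally show ?thesis by (simp add: add_increasing)
  qed
  have "ennreal u * g \<le> ennreal (u powr (p / (p - 1)) + t powr p)"
    using young_le[OF p u t(2)] t u by (simp add: ennreal_mult[symmetric] ennreal_leI del: ennreal_plus)
  also have "\<dots> = ennreal (u powr (p / (p - 1))) + ennreal (t powr p)" by simp
  finally have "ennreal u * g \<le> ennreal (u powr (p / (p - 1))) + ennreal (t powr p)" .
  from order_trans[OF this add_left_mono[OF tp]] show ?thesis by (simp only: add.assoc)
qed

lemma ln_le_powr:
  assumes "1 \<le> (s::real)" "0 < a"
  shows "ln s \<le> (1 / a) * s powr a"
proof -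
  have "ln (s powr a) \<le> s powr a - 1" using assms by (intro ln_le_minus_one) auto
  then have "a * ln s \<le> s powr a" using assms by (simp add: ln_powr)
  then show ?thesis using assms by (simp add: field_simps)
qed

context test_setting
begin

lemma fun_distr_nn_bound:
  assumes "integrable M a" "\<phi> \<in> TC"
  shows "ennreal (cmod (fun_distr M a \<phi>)) \<le> (\<integral>\<^sup>+y. ennreal (cmod (\<phi> y)) * ennreal (cmod (a y)) \<partial>M)"
  unfolding fun_distr_def
  using integral_norm_bound_ennreal[OF integrable_mult_test(1)[OF assms]]
  by (simp add: norm_mult ennreal_mult mult.commute)

definition CG :: real where "CG = Q * 2 powr (\<gamma> + n) / (1 - 2 powr (- \<gamma>)) * Q"

lemma CG_pos: "0 < CG"
proof -
  have "2 powr (- \<gamma>) < 2 powr (0::real)" using \<gamma> by (intro powr_less_mono) auto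
  then show ?thesis using Q_ge_1 by (simp add: CG_def)
qed

text \<open>Test functions are bumps normalised in L^1, so averages control the grand maximal
  function, as the Hardy-Littlewood maximal function would. In this form no such function has to be
  introduced; the contrapositive produces a ball with a large average.\<close>

lemma grand_maximal_le_averages:
  assumes a: "integrable M a" and s: "0 \<le> s"
    and avg: "\<And>R. 0 < R \<Longrightarrow> (\<integral>\<^sup>+y\<in>ball x R. ennreal (cmod (a y)) \<partial>M) \<le> ennreal (s * V R)"
  shows "GM (fun_distr M a) x \<le> ennreal (CG * s)"
proof (rule grand_maximal_le)
  fix \<phi> \<rho> assume \<phi>: "\<phi> \<in> TC" and \<rho>: "0 < \<rho>" and tb: "tb x \<rho> \<beta> \<gamma> \<phi> 1"
  have [measurable]: "a \<in> borel_measurable M" "\<phi> \<in> borel_measurable M" using a test_closure_measurable[OF \<phi>] by auto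
  define \<nu> where "\<nu> = density M (\<lambda>y. ennreal (cmod (a y)))"
  have "ennreal (cmod (fun_distr M a \<phi>)) \<le> (\<integral>\<^sup>+y. ennreal (cmod (\<phi> y)) * ennreal (cmod (a y)) \<partial>M)"
    by (rule fun_distr_nn_bound[OF a \<phi>])
  also have "\<dots> = (\<integral>\<^sup>+y. ennreal (cmod (\<phi> y)) \<partial>\<nu>)"
    unfolding \<nu>_def by (subst nn_integral_density) (auto simp: mult.commute)
  also have "\<dots> \<le> ennreal (Q * 2 powr (\<gamma> + n) / (1 - 2 powr (0 - \<gamma>)) * s * Q)"
  proof (rule annuli_integral[where x = x and \<rho> = \<rho>])
    show "cmod (\<phi> y) \<le> Q * (\<rho> / (\<rho> + d x y)) powr \<gamma> / V (\<rho> + d x y)" for y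
      using test_bound_size[OF tb, of y] tw_le_V[OF \<rho>, of \<gamma> x y] by simp
    show "emeasure \<nu> (ball x R) \<le> ennreal (s * (R / \<rho>) powr 0 * V R)" if "\<rho> \<le> R" for R
      using avg[of R] that \<rho> by (simp add: \<nu>_def emeasure_density)
  qed (use \<rho> \<gamma> s Q_ge_1 in \<open>auto simp: \<nu>_def\<close>)
  also have "Q * 2 powr (\<gamma> + n) / (1 - 2 powr (0 - \<gamma>)) * s * Q = CG * s" by (simp add: CG_def mult_ac)
  finally show "ennreal (cmod (fun_distr M a \<phi>)) \<le> ennreal (CG * s)" .
qed

lemma q_atom_distribution: "q_atom q x r a \<Longrightarrow> 1 < q \<Longrightarrow> fun_distr M a \<in> DD"
  using integrable_acts_as_distribution[OF q_atom_L1(2)] by (simp add: acts_as_distribution_def)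

text \<open>Jensen's inequality up to a constant, by splitting \<open>cmod (a z)\<close> at
  \<open>c = s / (2 * Q)\<close>: the part below \<open>c\<close> accounts for at most half of the
  large average.\<close>

lemma q_atom_large_average:
  assumes a: "q_atom q x r a" and q: "1 < q" and s: "0 < s" and R: "0 < R"
    and big: "ennreal (s * V R) < (\<integral>\<^sup>+z\<in>ball y R. ennreal (cmod (a z)) \<partial>M)"
  shows "ennreal ((s / (2 * Q)) powr q) * emeasure M (ball y R)
    \<le> (\<integral>\<^sup>+z\<in>ball y R. ennreal (cmod (a z) powr q) \<partial>M)"
proof -
  have [measurable]: "a \<in> borel_measurable M" using a by (simp add: q_atom_def)
  define c where "c = s / (2 * Q)"
  have c: "0 < c" using s Q_ge_1 by (simp add: c_def)
  define m where "m = measure M (ball y R)"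
  have "(\<integral>\<^sup>+z\<in>ball y R. ennreal (cmod (a z) powr q) \<partial>M) \<le> (\<integral>\<^sup>+z. ennreal (cmod (a z) powr q) \<partial>M)"
    by (intro nn_integral_mono) (auto split: split_indicator)
  also have "\<dots> < \<infinity>" using a by (auto simp: q_atom_def intro: le_less_trans)
  finally obtain j where j: "(\<integral>\<^sup>+z\<in>ball y R. ennreal (cmod (a z) powr q) \<partial>M) = ennreal j" "0 \<le> j"
    by (auto simp: less_top_ennreal)
  have "ennreal (s * V R) < (\<integral>\<^sup>+z\<in>ball y R. ennreal (cmod (a z)) \<partial>M)" by (rule big)
  also have "\<dots> \<le> (\<integral>\<^sup>+z. ennreal c * indicator (ball y R) z
      + ennreal (c powr (1 - q)) * (ennreal (cmod (a z) powr q) * indicator (ball y R) z) \<partial>M)"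
  proof (rule nn_integral_mono)
    fix z
    have "cmod (a z) \<le> c + c powr (1 - q) * cmod (a z) powr q"
      using atom_split[OF c zero_less_one q, of "cmod (a z)"] by simp
    then have "ennreal (cmod (a z)) \<le> ennreal c + ennreal (c powr (1 - q)) * ennreal (cmod (a z) powr q)"
      using c by (simp add: ennreal_mult[symmetric] ennreal_plus[symmetric] ennreal_leI del: ennreal_plus)
    then show "ennreal (cmod (a z)) * indicator (ball y R) z \<le> ennreal c * indicator (ball y R) z
      + ennreal (c powr (1 - q)) * (ennreal (cmod (a z) powr q) * indicator (ball y R) z)"
      by (auto split: split_indicator)
  qed
  also have "\<dots> = ennreal c * emeasure M (ball y R) + ennreal (c powr (1 - q)) * ennreal j"
    by (subst nn_integral_add) (auto simp: nn_integral_cmult j(1))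
  also have "\<dots> = ennreal (c * m + c powr (1 - q) * j)"
    using c j R by (simp add: emeasure_ball m_def ennreal_mult)
  finally have lt: "s * V R < c * m + c powr (1 - q) * j"
    using s V_pos[OF R] by (simp add: ennreal_less_iff del: ennreal_plus)
  have "c * m \<le> c * (Q * V R)" using c measure_le_V[OF R, of y] by (simp add: m_def)
  also have "\<dots> = s * V R / 2" using Q_ge_1 by (simp add: c_def)
  finally have cm: "c * m \<le> s * V R / 2" .
  then have "c * m \<le> c powr (1 - q) * j" using lt by linarith
  then have "c powr (q - 1) * (c * m) \<le> c powr (q - 1) * (c powr (1 - q) * j)" by (intro mult_left_mono) auto
  also have "\<dots> = j" using c by (simp add: mult.assoc[symmetric] powr_add[symmetric])
  also have "c powr (q - 1) * (c * m) = c powr q * m" using c by (simp add: powr_diff)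
  finally show ?thesis using c R by (simp add: j(1) c_def[symmetric] emeasure_ball m_def ennreal_mult[symmetric] ennreal_leI)
qed

text \<open>Weak type (q, q), from the Vitali covering with the density
  \<open>cmod (a z) powr q\<close>. The radii are bounded because the L^1 norm of an atom is at most
  2 while \<open>V\<close> is unbounded.\<close>

lemma q_atom_weak_type:
  assumes a: "q_atom q x r a" and q: "1 < q" and t: "0 < t"
  shows "emeasure M {y. ennreal t < GM (fun_distr M a) y}
    \<le> ennreal (CV * (2 * Q * CG) powr q * t powr (-q) * measure M (ball x r) powr (1 - q))"
proof -
  define s where "s = t / CG"
  have s: "0 < s" "CG * s = t" using t CG_pos by (auto simp: s_def)
  define E where "E = {y. ennreal t < GM (fun_distr M a) y}"
  define \<nu> where "\<nu> = density M (\<lambda>z. ennreal (cmod (a z) powr q))"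
  note ai = q_atom_L1(2)[OF a q]
  have [measurable]: "a \<in> borel_measurable M" using ai by auto
  have \<nu>: "emeasure \<nu> (ball y R) = (\<integral>\<^sup>+z\<in>ball y R. ennreal (cmod (a z) powr q) \<partial>M)" for y R
    unfolding \<nu>_def by (rule emeasure_density) auto
  obtain R0 where R0: "\<And>R. R0 \<le> R \<Longrightarrow> 2 / s \<le> V R" using V_unbounded[of "2 / s"] by blast
  have "\<exists>R>0. R \<le> R0 \<and> ennreal ((s / (2 * Q)) powr q) * emeasure M (ball y R) \<le> emeasure \<nu> (ball y R)"
    if y: "y \<in> E" for y
  proof -
    have "\<exists>R>0. ennreal (s * V R) < (\<integral>\<^sup>+z\<in>ball y R. ennreal (cmod (a z)) \<partial>M)"
    proof (rule ccontr)
      assume neg: "\<not> (\<exists>R>0. ennreal (s * V R) < (\<integral>\<^sup>+z\<in>ball y R. ennreal (cmod (a z)) \<partial>M))"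
      have "(\<integral>\<^sup>+z\<in>ball y R. ennreal (cmod (a z)) \<partial>M) \<le> ennreal (s * V R)" if "0 < R" for R
        using neg that unfolding linorder_not_less[symmetric] by blast
      then have "GM (fun_distr M a) y \<le> ennreal (CG * s)"
        using s(1) by (intro grand_maximal_le_averages[OF ai]) auto
      then show False using y by (simp add: E_def s)
    qed
    then obtain R where R: "R > 0" "ennreal (s * V R) < (\<integral>\<^sup>+z\<in>ball y R. ennreal (cmod (a z)) \<partial>M)" by blast
    have "R \<le> R0"
    proof (rule ccontr)
      assume "\<not> ?thesis"
      then have "2 \<le> s * V R" using R0[of R] s by (simp add: field_simps)
      then have "(2::ennreal) \<le> ennreal (s * V R)" using ennreal_leI[of 2 "s * V R"] by simp
      also note R(2)
      also have "(\<integral>\<^sup>+z\<in>ball y R. ennreal (cmod (a z)) \<partial>M) \<le> (\<integral>\<^sup>+z. ennreal (cmod (a z)) \<partial>M)"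
        by (intro nn_integral_mono) (auto split: split_indicator)
      also have "\<dots> \<le> 2" by (rule q_atom_L1(1)[OF a q])
      finally show False by simp
    qed
    then show ?thesis using R q_atom_large_average[OF a q s(1) R] by (auto simp: \<nu>)
  qed
  then obtain R where R: "\<And>y. y \<in> E \<Longrightarrow> 0 < R y" "\<And>y. y \<in> E \<Longrightarrow> R y \<le> R0"
    "\<And>y. y \<in> E \<Longrightarrow> ennreal ((s / (2 * Q)) powr q) * emeasure M (ball y (R y)) \<le> emeasure \<nu> (ball y (R y))"
    by metis
  have UM: "UNIV \<in> sets M" using sets.top[of M] by (simp add: space_UNIV)
  obtain F where F: "F \<subseteq> E" "countable F" "E \<subseteq> (\<Union>y\<in>F. ball y (4 * K * R y))"
    "ennreal ((s / (2 * Q)) powr q) * (\<integral>\<^sup>+y. emeasure M (ball y (4 * K * R y)) \<partial>count_space F)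
      \<le> ennreal CV * emeasure \<nu> UNIV"
    by (rule vitali_covering[of E R R0 \<nu> UNIV "ennreal ((s / (2 * Q)) powr q)"])
      (use R UM in \<open>auto simp: \<nu>_def\<close>)
  have "emeasure \<nu> UNIV \<le> ennreal (measure M (ball x r) powr (1 - q))"
    using a UM unfolding \<nu>_def by (subst emeasure_density) (auto simp: q_atom_def)
  then have "ennreal CV * emeasure \<nu> UNIV \<le> ennreal CV * ennreal (measure M (ball x r) powr (1 - q))"
    by (rule mult_left_mono) simp
  also have "\<dots> = ennreal ((s / (2 * Q)) powr q)
      * ennreal (CV * (2 * Q * CG) powr q * t powr (-q) * measure M (ball x r) powr (1 - q))"
  proof -
    have "(s / (2 * Q)) powr q = t powr q / (2 * Q * CG) powr q"
      using t CG_pos Q_ge_1 by (simp add: s_def powr_divide[symmetric] field_simps)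
    then have "(s / (2 * Q)) powr q * ((2 * Q * CG) powr q * t powr (-q)) = 1"
      using t CG_pos Q_ge_1 by (simp add: powr_minus field_simps)
    then have "CV * measure M (ball x r) powr (1 - q) = (s / (2 * Q)) powr q
      * (CV * (2 * Q * CG) powr q * t powr (-q) * measure M (ball x r) powr (1 - q))"
      by (simp add: algebra_simps)
    then show ?thesis using CV_ge_1 by (simp add: ennreal_mult[symmetric])
  qed
  finally have "ennreal CV * emeasure \<nu> UNIV \<le> ennreal ((s / (2 * Q)) powr q)
      * ennreal (CV * (2 * Q * CG) powr q * t powr (-q) * measure M (ball x r) powr (1 - q))" .
  from order_trans[OF F(4) this] have sum: "(\<integral>\<^sup>+y. emeasure M (ball y (4 * K * R y)) \<partial>count_space F)
    \<le> ennreal (CV * (2 * Q * CG) powr q * t powr (-q) * measure M (ball x r) powr (1 - q))"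
    using s Q_ge_1 by (subst (asm) ennreal_mult_le_mult_iff) auto
  have "emeasure M E \<le> emeasure M (\<Union>y\<in>F. ball y (4 * K * R y))"
    using F by (intro emeasure_mono sets.countable_UN') auto
  also have "\<dots> \<le> (\<integral>\<^sup>+y. emeasure M (ball y (4 * K * R y)) \<partial>count_space F)"
    using F by (intro emeasure_UN_le_nn_integral) auto
  finally show ?thesis using sum unfolding E_def by (rule order_trans)
qed

text \<open>Cancellation: subtracting the constant \<open>\<phi> x\<close> leaves the pairing
  unchanged, and the factor 2 is the L^1 bound of an atom.\<close>

lemma q_atom_oscillation_bound:
  assumes a: "q_atom q x r a" and q: "1 < q" and \<phi>: "\<phi> \<in> TC"
    and osc: "\<And>y. y \<in> ball x r \<Longrightarrow> cmod (\<phi> x - \<phi> y) \<le> B"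
  shows "cmod (fun_distr M a \<phi>) \<le> 2 * B"
proof -
  note ai = q_atom_L1(2)[OF a q]
  have r: "0 < r" and supp: "\<And>y. y \<notin> ball x r \<Longrightarrow> a y = 0" and z: "(LINT y|M. a y) = 0"
    using a by (auto simp: q_atom_def)
  have B: "0 \<le> B" using osc[of x] r by simp
  have i: "integrable M (\<lambda>y. a y * \<phi> y)" by (rule integrable_mult_test(1)[OF ai \<phi>])
  have "fun_distr M a \<phi> = (LINT y|M. a y * \<phi> y) - (LINT y|M. a y * \<phi> x)"
    using z ai by (simp add: fun_distr_def)
  also have "\<dots> = (LINT y|M. a y * \<phi> y - a y * \<phi> x)"
    using i ai by (intro Bochner_Integration.integral_diff[symmetric]) auto
  finally have "ennreal (cmod (fun_distr M a \<phi>)) \<le> (\<integral>\<^sup>+y. ennreal (norm (a y * \<phi> y - a y * \<phi> x)) \<partial>M)"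
    using i ai by (simp only:) (intro integral_norm_bound_ennreal, auto)
  also have "\<dots> \<le> (\<integral>\<^sup>+y. ennreal B * ennreal (cmod (a y)) \<partial>M)"
  proof (rule nn_integral_mono)
    fix y
    have "norm (a y * \<phi> y - a y * \<phi> x) = cmod (a y) * cmod (\<phi> x - \<phi> y)"
      by (simp only: right_diff_distrib[symmetric] norm_mult norm_minus_commute)
    also have "\<dots> \<le> cmod (a y) * B"
      using osc[of y] supp[of y] by (cases "y \<in> ball x r") (auto intro: mult_left_mono)
    finally show "ennreal (norm (a y * \<phi> y - a y * \<phi> x)) \<le> ennreal B * ennreal (cmod (a y))"
      using B by (simp add: ennreal_mult[symmetric] ennreal_leI mult.commute)
  qed
  also have "\<dots> = ennreal B * (\<integral>\<^sup>+y. ennreal (cmod (a y)) \<partial>M)"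
    using ai by (intro nn_integral_cmult) auto
  also have "\<dots> \<le> ennreal B * 2" by (intro mult_left_mono q_atom_L1(1)[OF a q]) auto
  also have "\<dots> = ennreal (2 * B)" using B by (simp add: ennreal_mult mult.commute)
  finally show ?thesis using B by (simp add: ennreal_le_iff)
qed

text \<open>Outside the \<open>2 * K\<close> dilate the centre and any point of the ball form an
  admissible pair in the smoothness condition based at \<open>y\<close>, so cancellation gains
  \<open>(r / d x y) powr \<beta>\<close>. The result is written with \<open>r + d x y\<close> to
  fit \<open>annuli_integral\<close>.\<close>

lemma q_atom_maximal_far:
  assumes a: "q_atom q x r a" and q: "1 < q" and y: "y \<notin> ball x (2 * K * r)"
  shows "GM (fun_distr M a) y \<le> ennreal (2 * 2 powr \<beta> * Q\<^sup>2 * 2 powr n * (r / (r + d x y)) powr \<beta> / V (r + d x y))"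
proof (rule grand_maximal_le)
  fix \<phi> \<rho> assume \<phi>: "\<phi> \<in> TC" and \<rho>: "0 < \<rho>" and tb: "tb y \<rho> \<beta> \<gamma> \<phi> 1"
  have r: "0 < r" using a by (simp add: q_atom_def)
  define D where "D = d x y"
  have D: "2 * K * r \<le> D" using y by (simp add: D_def)
  have "1 * r \<le> (2 * K) * r" using K0_ge_1 r by (intro mult_right_mono) auto
  then have rD: "r \<le> D" using D by simp
  then have D0: "0 < D" using r by simp
  have VD: "V (r + D) \<le> Q * 2 powr n * V D" using rD r D0 by (intro V_scale) auto
  have twx: "tw \<gamma> y \<rho> x \<le> Q / V D"
  proof -
    have "tw \<gamma> y \<rho> x \<le> Q * (\<rho> / (\<rho> + d y x)) powr \<gamma> / V (\<rho> + d y x)" by (rule tw_le_V[OF \<rho>])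
    also have "\<dots> \<le> Q * 1 / V D"
      using \<rho> \<gamma> Q_ge_1 V_pos[OF D0] V_mono[OF D0, of "\<rho> + D"] D0
      by (intro frac_le mult_left_mono powr_le1) (auto simp: D_def dist_commute)
    finally show ?thesis by simp
  qed
  have "cmod (fun_distr M a \<phi>) \<le> 2 * ((r / D) powr \<beta> * (Q / V D))"
  proof (rule q_atom_oscillation_bound[OF a q \<phi>])
    fix z assume z: "z \<in> ball x r"
    have "2 * K * d x z \<le> 2 * K * r" using z K_pos by (intro mult_left_mono) auto
    then have "2 * K * d x z \<le> D" using D by linarith
    then have "d x z \<le> D / (2 * K)" using K_pos by (simp add: field_simps)
    also have "\<dots> \<le> (\<rho> + d y x) / (2 * K)" using \<rho> K_pos by (intro divide_right_mono) (auto simp: D_def dist_commute)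
    finally have "cmod (\<phi> x - \<phi> z) \<le> 1 * ((d x z / (\<rho> + d y x)) powr \<beta> * tw \<gamma> y \<rho> x)"
      by (rule test_bound_diff[OF tb])
    also have "\<dots> \<le> 1 * ((r / D) powr \<beta> * (Q / V D))"
    proof -
      have "d x z / (\<rho> + d y x) \<le> r / D"
        using z \<rho> D0 r by (intro frac_le) (auto simp: D_def dist_commute)
      then have "(d x z / (\<rho> + d y x)) powr \<beta> \<le> (r / D) powr \<beta>"
        using \<beta> dist_nonneg[of x z] radius_pos[OF \<rho>, of y x] by (intro powr_mono2) auto
      from mult_mono[OF this twx powr_ge_zero tw_nonneg[OF \<rho>]] show ?thesis by simp
    qed
    finally show "cmod (\<phi> x - \<phi> z) \<le> (r / D) powr \<beta> * (Q / V D)" by simp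
  qed
  also have "\<dots> \<le> 2 * ((2 powr \<beta> * (r / (r + D)) powr \<beta>) * (Q * (Q * 2 powr n) / V (r + D)))"
  proof -
    have "r / D \<le> 2 * (r / (r + D))" using r rD D0 by (simp add: field_simps)
    then have "(r / D) powr \<beta> \<le> (2 * (r / (r + D))) powr \<beta>" using \<beta> r D0 by (intro powr_mono2) auto
    then have 1: "(r / D) powr \<beta> \<le> 2 powr \<beta> * (r / (r + D)) powr \<beta>" by (simp only: powr_mult)
    have "V (r + D) > 0" using r D0 by (intro V_pos) auto
    then have 2: "Q / V D \<le> Q * (Q * 2 powr n) / V (r + D)"
      using VD V_pos[OF D0] Q_ge_1 mult_left_mono[OF VD, of Q] by (simp add: field_simps)
    show ?thesis using Q_ge_1 V_pos[OF D0] by (intro mult_left_mono mult_mono 1 2) auto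
  qed
  also have "\<dots> = 2 * 2 powr \<beta> * Q\<^sup>2 * 2 powr n * (r / (r + D)) powr \<beta> / V (r + D)"
    by (simp add: power2_eq_square mult_ac)
  finally show "ennreal (cmod (fun_distr M a \<phi>)) \<le> ennreal (2 * 2 powr \<beta> * Q\<^sup>2 * 2 powr n * (r / (r + d x y)) powr \<beta> / V (r + d x y))"
    unfolding D_def by (rule ennreal_leI)
qed

lemma test_closure_L1:
  obtains C where "0 < C" "\<And>\<phi>. \<phi> \<in> TC \<Longrightarrow> (\<integral>\<^sup>+y. ennreal (cmod (\<phi> y)) \<partial>M) \<le> ennreal (C * TN \<phi>)"
proof
  show "0 < CG * Q" using CG_pos Q_ge_1 by simp
  fix \<phi> assume \<phi>: "\<phi> \<in> TC"
  have "(\<integral>\<^sup>+y. ennreal (cmod (\<phi> y)) \<partial>M) \<le> ennreal (Q * 2 powr (\<gamma> + n) / (1 - 2 powr (0 - \<gamma>)) * Q * (Q * TN \<phi>))"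
  proof (rule annuli_integral[where x = x0 and \<rho> = 1])
    fix y
    have "cmod (\<phi> y) \<le> TN \<phi> * tw \<gamma> x0 1 y" by (rule test_bound_size[OF test_closure_bound[OF \<phi>]])
    also have "\<dots> \<le> TN \<phi> * (Q * (1 / (1 + d x0 y)) powr \<gamma> / V (1 + d x0 y))"
      using test_norm_TC_nonneg[OF \<phi>] by (intro mult_left_mono tw_le_V) auto
    finally show "cmod (\<phi> y) \<le> Q * TN \<phi> * (1 / (1 + d x0 y)) powr \<gamma> / V (1 + d x0 y)" by (simp add: mult_ac)
  next
    fix R :: real assume "1 \<le> R"
    then show "emeasure M (ball x0 R) \<le> ennreal (Q * (R / 1) powr 0 * V R)"
      using measure_le_V[of R x0] by (simp add: emeasure_ball ennreal_leI)
  qed (use \<gamma> test_norm_TC_nonneg[OF \<phi>] Q_ge_1 in auto)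
  then show "(\<integral>\<^sup>+y. ennreal (cmod (\<phi> y)) \<partial>M) \<le> ennreal (CG * Q * TN \<phi>)" by (simp add: CG_def mult_ac)
qed

end

section \<open>Atoms against functions of bounded mean oscillation\<close>

locale product_setting = bmo_function d M K \<theta> A Q \<kappa> n V b L + test_setting d M K \<theta> A Q \<kappa> n V x0 \<epsilon> \<beta> \<gamma>
  for d :: "'a \<Rightarrow> 'a \<Rightarrow> real" and M K \<theta> A Q \<kappa> n V b L x0 \<epsilon> \<beta> \<gamma>
begin

text \<open>The exponential bound controls every power of the oscillation. The summand 1 lets one
  weight serve both the maximal function and its product with the oscillation.\<close>

lemma bmo_power_dilated:
  assumes p: "0 < p"
  obtains C where "0 < C" "\<And>x r. 0 < r \<Longrightarrow>
    (\<integral>\<^sup>+y\<in>ball x (2 * K * r). ennreal ((1 + cmod (b y - mb x r)) powr p) \<partial>M) \<le> ennreal (C * measure M (ball x r))"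
proof -
  obtain C1 where C1: "0 < C1" "\<And>u. 0 \<le> u \<Longrightarrow> u powr p \<le> C1 * exp (jn_exp * u)"
    using powr_le_exp[OF p jn_exp_pos] by blast
  have K2: "1 \<le> 2 * K" using K0_ge_1 by simp
  define E where "E = C1 * exp (jn_exp * (1 + L * S (2 * K)))"
  have E: "0 < E" using C1 by (simp add: E_def)
  show ?thesis
  proof
    show "0 < E * 7 * S (2 * K)" using E S_ge_1[OF K2] by simp
    fix x r assume r: "0 < (r::real)"
    define R where "R = 2 * K * r"
    have R: "0 < R" using r K_pos by (simp add: R_def)
    have "1 * r \<le> (2 * K) * r" using K2 r by (intro mult_right_mono) auto
    then have diff: "cmod (mb x r - mb x R) \<le> L * S (2 * K)"
      using r R K2 by (intro mean_diff_le ball_mono) (auto simp: R_def)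
    have "(\<integral>\<^sup>+y\<in>ball x R. ennreal ((1 + cmod (b y - mb x r)) powr p) \<partial>M)
      \<le> (\<integral>\<^sup>+y. ennreal E * (ennreal (exp (jn_exp * cmod (b y - mb x R))) * indicator (ball x R) y) \<partial>M)"
    proof (rule nn_integral_mono)
      fix y
      have "cmod (b y - mb x r) \<le> cmod (b y - mb x R) + L * S (2 * K)"
        using norm_triangle_ineq4[of "b y - mb x R" "mb x r - mb x R"] diff by simp
      then have "jn_exp * (1 + cmod (b y - mb x r)) \<le> jn_exp * ((1 + L * S (2 * K)) + cmod (b y - mb x R))"
        using jn_exp_pos by (intro mult_left_mono) auto
      then have "C1 * exp (jn_exp * (1 + cmod (b y - mb x r))) \<le> E * exp (jn_exp * cmod (b y - mb x R))"
        using C1 by (simp add: E_def exp_add[symmetric] distrib_left)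
      then have "(1 + cmod (b y - mb x r)) powr p \<le> E * exp (jn_exp * cmod (b y - mb x R))"
        using C1(2)[of "1 + cmod (b y - mb x r)"] by simp
      then show "ennreal ((1 + cmod (b y - mb x r)) powr p) * indicator (ball x R) y
        \<le> ennreal E * (ennreal (exp (jn_exp * cmod (b y - mb x R))) * indicator (ball x R) y)"
        using E by (auto split: split_indicator simp: ennreal_mult[symmetric] ennreal_leI)
    qed
    also have "\<dots> = ennreal E * (\<integral>\<^sup>+y\<in>ball x R. ennreal (exp (jn_exp * cmod (b y - mb x R))) \<partial>M)"
      by (rule nn_integral_cmult) measurable
    also have "\<dots> \<le> ennreal E * (7 * emeasure M (ball x R))"
      by (intro mult_left_mono exp_integrability R) auto
    also have "\<dots> = ennreal (E * 7 * measure M (ball x R))"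
      using R E by (simp add: emeasure_ball ennreal_mult mult.assoc)
    also have "\<dots> \<le> ennreal (E * 7 * (S (2 * K) * measure M (ball x r)))"
      using E r R K2 by (intro ennreal_leI mult_left_mono measure_ball_le_S) (auto simp: R_def)
    finally show "(\<integral>\<^sup>+y\<in>ball x (2 * K * r). ennreal ((1 + cmod (b y - mb x r)) powr p) \<partial>M)
      \<le> ennreal (E * 7 * S (2 * K) * measure M (ball x r))" by (simp add: R_def mult.assoc)
  qed
qed

text \<open>Young's inequality for the oscillation and \<open>m * cmod (a y)\<close> with conjugate
  exponents \<open>p\<close> and \<open>q\<close>; the factor \<open>m\<close> makes both terms
  scale like the measure of the ball.\<close>

lemma q_atom_oscillation_L1:
  assumes q: "1 < q"
  obtains C where "0 < C" "\<And>x r a. q_atom q x r a \<Longrightarrow>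
    (\<integral>\<^sup>+y. ennreal (cmod (b y - mb x r)) * ennreal (cmod (a y)) \<partial>M) \<le> ennreal C"
proof -
  define p where "p = q / (q - 1)"
  have p: "0 < p" using q by (simp add: p_def)
  obtain C where C: "0 < C" "\<And>x r. 0 < r \<Longrightarrow>
    (\<integral>\<^sup>+y\<in>ball x (2 * K * r). ennreal ((1 + cmod (b y - mb x r)) powr p) \<partial>M) \<le> ennreal (C * measure M (ball x r))"
    using bmo_power_dilated[OF p] by blast
  show ?thesis
  proof
    show "0 < C + 1" using C by simp
    fix x r a assume a: "q_atom q x r a"
    have r: "0 < r" and [measurable]: "a \<in> borel_measurable M" and supp: "\<And>y. y \<notin> ball x r \<Longrightarrow> a y = 0"
      and size: "(\<integral>\<^sup>+y. ennreal (cmod (a y) powr q) \<partial>M) \<le> ennreal (measure M (ball x r) powr (1 - q))"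
      using a by (auto simp: q_atom_def)
    define m where "m = measure M (ball x r)"
    have m: "0 < m" using measure_qball_pos[OF r] by (simp add: m_def)
    have "1 * r \<le> (2 * K) * r" using K0_ge_1 r by (intro mult_right_mono) auto
    then have sub: "y \<in> ball x r \<Longrightarrow> y \<in> ball x (2 * K * r)" for y by auto
    have "(\<integral>\<^sup>+y. ennreal (cmod (b y - mb x r)) * ennreal (cmod (a y)) \<partial>M)
      \<le> (\<integral>\<^sup>+y. ennreal (1 / m) * (ennreal ((1 + cmod (b y - mb x r)) powr p) * indicator (ball x (2 * K * r)) y)
         + ennreal (m powr (q - 1)) * ennreal (cmod (a y) powr q) \<partial>M)"
    proof (rule nn_integral_mono)
      fix y
      define u where "u = cmod (b y - mb x r)"
      have u: "0 \<le> u" by (simp add: u_def)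
      show "ennreal (cmod (b y - mb x r)) * ennreal (cmod (a y))
        \<le> ennreal (1 / m) * (ennreal ((1 + cmod (b y - mb x r)) powr p) * indicator (ball x (2 * K * r)) y)
         + ennreal (m powr (q - 1)) * ennreal (cmod (a y) powr q)"
      proof (cases "y \<in> ball x r")
        case True
        have "u * (m * cmod (a y)) \<le> u powr p + (m * cmod (a y)) powr q"
          unfolding p_def using q m u by (intro young_le) auto
        also have "\<dots> \<le> (1 + u) powr p + m powr q * cmod (a y) powr q"
          using u p m by (intro add_mono powr_mono2) (auto simp: powr_mult)
        finally have "(1 / m) * (m * (u * cmod (a y))) \<le> (1 / m) * ((1 + u) powr p + m powr q * cmod (a y) powr q)"
          using m by (intro mult_left_mono) (auto simp: mult_ac)
        then have "u * cmod (a y) \<le> (1 / m) * (1 + u) powr p + m powr (q - 1) * cmod (a y) powr q"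
          using m by (simp add: powr_diff distrib_left)
        then have "ennreal (u * cmod (a y)) \<le> ennreal ((1 / m) * (1 + u) powr p + m powr (q - 1) * cmod (a y) powr q)"
          by (rule ennreal_leI)
        also have "\<dots> = ennreal (1 / m) * ennreal ((1 + u) powr p) + ennreal (m powr (q - 1)) * ennreal (cmod (a y) powr q)"
          using m by (simp only: ennreal_plus ennreal_mult mult_nonneg_nonneg powr_ge_zero zero_le_divide_1_iff less_imp_le)
        finally show ?thesis using sub[OF True] u by (simp add: u_def ennreal_mult)
      qed (use supp in simp)
    qed
    also have "\<dots> = ennreal (1 / m) * (\<integral>\<^sup>+y\<in>ball x (2 * K * r). ennreal ((1 + cmod (b y - mb x r)) powr p) \<partial>M)
         + ennreal (m powr (q - 1)) * (\<integral>\<^sup>+y. ennreal (cmod (a y) powr q) \<partial>M)"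
      by (subst nn_integral_add) (auto simp: nn_integral_cmult)
    also have "\<dots> \<le> ennreal (1 / m) * ennreal (C * m) + ennreal (m powr (q - 1)) * ennreal (m powr (1 - q))"
      using C(2)[OF r, of x] size by (intro add_mono mult_left_mono) (auto simp: m_def)
    also have "\<dots> = ennreal (C + 1)"
      using m C by (simp add: ennreal_mult[symmetric] powr_add[symmetric])
    finally show "(\<integral>\<^sup>+y. ennreal (cmod (b y - mb x r)) * ennreal (cmod (a y)) \<partial>M) \<le> ennreal (C + 1)" .
  qed
qed

text \<open>A weak type bound with exponent q controls smaller powers on sets of finite measure, so
  \<open>p\<close> is taken strictly between 1 and \<open>q\<close>; the ratio
  \<open>2 powr (p - q)\<close> of the dyadic sum is then below 1. Multiplication by
  \<open>m\<close> normalises the maximal function, whose natural size on the ball is 1 / m.\<close>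

lemma q_atom_maximal_near:
  assumes q: "1 < q"
  obtains C where "0 < C" "\<And>x r a. q_atom q x r a \<Longrightarrow>
    (\<integral>\<^sup>+y\<in>ball x (2 * K * r). ennreal (1 + cmod (b y - mb x r)) * GM (fun_distr M a) y \<partial>M) \<le> ennreal C"
proof -
  define p where "p = (1 + q) / 2"
  have p: "1 < p" "p < q" using q by (auto simp: p_def)
  define p' where "p' = p / (p - 1)"
  have p': "0 < p'" using p by (simp add: p'_def)
  obtain C1 where C1: "0 < C1" "\<And>x r. 0 < r \<Longrightarrow>
    (\<integral>\<^sup>+y\<in>ball x (2 * K * r). ennreal ((1 + cmod (b y - mb x r)) powr p') \<partial>M) \<le> ennreal (C1 * measure M (ball x r))"
    using bmo_power_dilated[OF p'] by blast
  have K2: "1 \<le> 2 * K" using K0_ge_1 by simp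
  define W where "W = CV * (2 * Q * CG) powr q"
  have W: "0 < W" using CV_ge_1 CG_pos Q_ge_1 by (simp add: W_def)
  have g: "2 powr (p - q) < (1::real)" using p powr_less_mono[of "p - q" 0 "2::real"] by simp
  define C2 where "C2 = W * 2 powr p * (1 / (1 - 2 powr (p - q)))"
  have C2: "0 < C2" using W g by (simp add: C2_def)
  show ?thesis
  proof
    show "0 < C1 + S (2 * K) + C2" using C1 C2 S_ge_1[OF K2] by simp
    fix x r a assume a: "q_atom q x r a"
    have r: "0 < r" using a by (simp add: q_atom_def)
    define m where "m = measure M (ball x r)"
    have m: "0 < m" using measure_qball_pos[OF r] by (simp add: m_def)
    note GMm[measurable] = grand_maximal_measurable[OF q_atom_distribution[OF a q]]
    define B where "B = ball x (2 * K * r)"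
    have B[measurable]: "B \<in> sets M" by (simp add: B_def)
    define G where "G = GM (fun_distr M a)"
    have [measurable]: "G \<in> borel_measurable M" by (simp add: G_def)
    \<comment> \<open>The normalisation leaves exactly one factor \<open>m\<close>: the power
      \<open>m powr q\<close> from the height \<open>2 ^ k / m\<close> times
      \<open>m powr (1 - q)\<close> from the atom.\<close>
    have level: "emeasure M {y \<in> space M. ennreal (2 ^ k) < ennreal m * G y} \<le> ennreal (W * (2 powr (-q)) ^ k * m)" for k
    proof -
      have "emeasure M {y \<in> space M. ennreal (2 ^ k) < ennreal m * G y} \<le> emeasure M {y. ennreal (2 ^ k / m) < G y}"
      proof (rule emeasure_mono)
        show "{y \<in> space M. ennreal (2 ^ k) < ennreal m * G y} \<subseteq> {y. ennreal (2 ^ k / m) < G y}"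
        proof (intro subsetI CollectI, rule ccontr)
          fix y assume y: "y \<in> {y \<in> space M. ennreal (2 ^ k) < ennreal m * G y}" "\<not> ennreal (2 ^ k / m) < G y"
          then have "ennreal m * G y \<le> ennreal m * ennreal (2 ^ k / m)" by (intro mult_left_mono) (auto simp: not_less)
          also have "\<dots> = ennreal (2 ^ k)" using m by (simp add: ennreal_mult[symmetric])
          finally show False using y(1) by (auto dest: order.strict_trans2)
        qed
        show "{y. ennreal (2 ^ k / m) < G y} \<in> sets M"
          unfolding G_def by (intro qopen_measurable grand_maximal_lower_semicontinuous q_atom_distribution[OF a q])
      qed
      also have "\<dots> \<le> ennreal (CV * (2 * Q * CG) powr q * (2 ^ k / m) powr (-q) * measure M (ball x r) powr (1 - q))"
        unfolding G_def using m by (intro q_atom_weak_type[OF a q]) auto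
      also have "CV * (2 * Q * CG) powr q * (2 ^ k / m) powr (-q) * measure M (ball x r) powr (1 - q)
          = W * (2 powr (-q)) ^ k * m"
      proof -
        have "(2 ^ k / m) powr (-q) = (2 powr (-q)) ^ k * m powr q"
        proof -
          have "(2 ^ k :: real) powr (-q) = (2 powr (-q)) ^ k"
            by (simp add: powr_realpow[symmetric] powr_powr mult.commute)
          moreover have "m powr (-q) = 1 / m powr q" by (rule powr_minus_divide)
          ultimately show ?thesis using m by (simp only: powr_divide) simp
        qed
        moreover have "m powr q * m powr (1 - q) = m" using m by (simp add: powr_add[symmetric])
        ultimately show ?thesis by (simp add: W_def m_def[symmetric] mult.assoc)
      qed
      finally show ?thesis .
    qed
    have "ennreal m * (\<integral>\<^sup>+y\<in>B. ennreal (1 + cmod (b y - mb x r)) * G y \<partial>M)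
        = (\<integral>\<^sup>+y. ennreal (1 + cmod (b y - mb x r)) * (ennreal m * G y) * indicator B y \<partial>M)"
      by (subst nn_integral_cmult[symmetric]) (auto simp: mult_ac)
    also have "\<dots> \<le> (\<integral>\<^sup>+y. ennreal ((1 + cmod (b y - mb x r)) powr p') * indicator B y + indicator B y
        + (\<Sum>k. ennreal (2 powr (p * real (Suc k))) * indicator {y \<in> space M. ennreal (2 ^ k) < ennreal m * G y} y) \<partial>M)"
    proof (rule nn_integral_mono)
      fix y
      have "ennreal (1 + cmod (b y - mb x r)) * (ennreal m * G y) \<le> ennreal ((1 + cmod (b y - mb x r)) powr p') + 1
        + (\<Sum>k. ennreal (2 powr (p * real (Suc k))) * of_bool (ennreal (2 ^ k) < ennreal m * G y))"
        unfolding p'_def by (rule young_dyadic_levels[OF p(1)]) simp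
      also have "(\<Sum>k. ennreal (2 powr (p * real (Suc k))) * of_bool (ennreal (2 ^ k) < ennreal m * G y))
        = (\<Sum>k. ennreal (2 powr (p * real (Suc k))) * indicator {y \<in> space M. ennreal (2 ^ k) < ennreal m * G y} y)"
        by (intro suminf_cong) (simp add: indicator_def space_UNIV)
      finally show "ennreal (1 + cmod (b y - mb x r)) * (ennreal m * G y) * indicator B y
        \<le> ennreal ((1 + cmod (b y - mb x r)) powr p') * indicator B y + indicator B y
        + (\<Sum>k. ennreal (2 powr (p * real (Suc k))) * indicator {y \<in> space M. ennreal (2 ^ k) < ennreal m * G y} y)"
        by (cases "y \<in> B") simp_all
    qed
    also have "\<dots> = (\<integral>\<^sup>+y\<in>B. ennreal ((1 + cmod (b y - mb x r)) powr p') \<partial>M) + emeasure M B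
        + (\<Sum>k. ennreal (2 powr (p * real (Suc k))) * emeasure M {y \<in> space M. ennreal (2 ^ k) < ennreal m * G y})"
      by (subst nn_integral_add, measurable, subst nn_integral_add, measurable)
        (simp add: nn_integral_suminf nn_integral_cmult)
    also have "\<dots> \<le> ennreal (C1 * m) + ennreal (S (2 * K) * m) + ennreal (C2 * m)"
    proof (intro add_mono)
      show "(\<integral>\<^sup>+y\<in>B. ennreal ((1 + cmod (b y - mb x r)) powr p') \<partial>M) \<le> ennreal (C1 * m)"
        unfolding B_def m_def by (rule C1(2)[OF r])
      have "measure M B \<le> S (2 * K) * m"
        unfolding B_def m_def using r K_pos K2 by (intro measure_ball_le_S) auto
      then show "emeasure M B \<le> ennreal (S (2 * K) * m)"
        unfolding B_def using r K_pos by (simp add: emeasure_ball ennreal_leI)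
      have "(\<Sum>k. ennreal (2 powr (p * real (Suc k))) * emeasure M {y \<in> space M. ennreal (2 ^ k) < ennreal m * G y})
        \<le> (\<Sum>k. ennreal (2 powr (p * real (Suc k))) * ennreal (W * (2 powr (-q)) ^ k * m))"
        by (intro suminf_le mult_left_mono level) auto
      also have "\<dots> = (\<Sum>k. ennreal (W * 2 powr p * m * (2 powr (p - q)) ^ k))"
      proof (rule suminf_cong)
        fix k
        have "2 powr (p * real (Suc k)) = 2 powr p * (2 powr p) ^ k"
          by (simp add: powr_realpow[symmetric] powr_powr powr_add[symmetric] algebra_simps)
        moreover have "(2 powr (p - q)) ^ k = (2 powr p) ^ k * (2 powr (-q) :: real) ^ k"
          by (simp add: power_mult_distrib[symmetric] powr_add[symmetric])
        ultimately have "2 powr (p * real (Suc k)) * (W * (2 powr (-q)) ^ k * m) = W * 2 powr p * m * (2 powr (p - q)) ^ k"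
          by (simp add: mult_ac)
        then show "ennreal (2 powr (p * real (Suc k))) * ennreal (W * (2 powr (-q)) ^ k * m)
            = ennreal (W * 2 powr p * m * (2 powr (p - q)) ^ k)"
          using W m by (subst ennreal_mult[symmetric]) simp_all
      qed
      also have "\<dots> = ennreal (W * 2 powr p * m * (1 / (1 - 2 powr (p - q))))"
      proof (rule suminf_ennreal_eq)
        show "(\<lambda>k. W * 2 powr p * m * (2 powr (p - q)) ^ k) sums (W * 2 powr p * m * (1 / (1 - 2 powr (p - q))))"
          using g by (intro sums_mult geometric_sums) auto
      qed (use W m in auto)
      also have "W * 2 powr p * m * (1 / (1 - 2 powr (p - q))) = C2 * m" by (simp add: C2_def)
      finally show "(\<Sum>k. ennreal (2 powr (p * real (Suc k))) * emeasure M {y \<in> space M. ennreal (2 ^ k) < ennreal m * G y})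
        \<le> ennreal (C2 * m)" .
    qed
    also have "\<dots> = ennreal m * ennreal (C1 + S (2 * K) + C2)"
      using m C1 C2 S_ge_1[OF K2]
      by (simp add: ennreal_mult[symmetric] ennreal_plus[symmetric] algebra_simps del: ennreal_plus)
    finally show "(\<integral>\<^sup>+y\<in>ball x (2 * K * r). ennreal (1 + cmod (b y - mb x r)) * GM (fun_distr M a) y \<partial>M)
       \<le> ennreal (C1 + S (2 * K) + C2)"
      using m unfolding B_def G_def by (subst (asm) ennreal_mult_le_mult_iff) auto
  qed
qed

text \<open>The mean over the larger ball drifts by a logarithm of \<open>R / r\<close>, which is
  bounded by an arbitrarily small power \<open>e\<close>. The shape is that of the growth hypothesis
  in \<open>annuli_integral\<close>.\<close>

lemma bmo_growth_ball:
  assumes r: "0 < r" "r \<le> R" and e: "0 < e"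
  shows "(\<integral>\<^sup>+y\<in>ball x R. ennreal (1 + cmod (b y - mb x r)) \<partial>M)
    \<le> ennreal ((1 + L + L * S 2 / ln 2 * (1 + 1 / e)) * Q * (R / r) powr e * V R)"
proof -
  have R: "0 < R" using r by simp
  define c where "c = 1 + cmod (mb x R - mb x r)"
  have "(\<integral>\<^sup>+y\<in>ball x R. ennreal (1 + cmod (b y - mb x r)) \<partial>M)
    \<le> (\<integral>\<^sup>+y. ennreal (cmod (b y - mb x R)) * indicator (ball x R) y + ennreal c * indicator (ball x R) y \<partial>M)"
  proof (rule nn_integral_mono)
    fix y
    have "1 + cmod (b y - mb x r) \<le> cmod (b y - mb x R) + c"
      using norm_triangle_ineq[of "b y - mb x R" "mb x R - mb x r"] by (simp add: c_def)
    then have "ennreal (1 + cmod (b y - mb x r)) \<le> ennreal (cmod (b y - mb x R) + c)" by (rule ennreal_leI)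
    also have "\<dots> = ennreal (cmod (b y - mb x R)) + ennreal c"
      by (rule ennreal_plus) (auto simp: c_def)
    finally have "ennreal (1 + cmod (b y - mb x r)) \<le> ennreal (cmod (b y - mb x R)) + ennreal c" .
    then show "ennreal (1 + cmod (b y - mb x r)) * indicator (ball x R) y
      \<le> ennreal (cmod (b y - mb x R)) * indicator (ball x R) y + ennreal c * indicator (ball x R) y"
      by (cases "y \<in> ball x R") simp_all
  qed
  also have "\<dots> = (\<integral>\<^sup>+y\<in>ball x R. ennreal (cmod (b y - mb x R)) \<partial>M) + ennreal c * emeasure M (ball x R)"
    by (subst nn_integral_add) (auto simp: nn_integral_cmult)
  also have "\<dots> \<le> ennreal (L * measure M (ball x R)) + ennreal c * emeasure M (ball x R)"
    by (intro add_right_mono oscillation R)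
  also have "\<dots> = ennreal ((L + c) * measure M (ball x R))"
    using R L_pos by (simp add: emeasure_ball c_def ennreal_mult[symmetric] ennreal_plus[symmetric] distrib_right del: ennreal_plus)
  also have "\<dots> \<le> ennreal ((1 + L + L * S 2 / ln 2 * (1 + 1 / e)) * Q * (R / r) powr e * V R)"
  proof (rule ennreal_leI)
    define t where "t = (R / r) powr e"
    define C1 where "C1 = L * S 2 / ln 2"
    have C1: "0 < C1" using L_pos S_ge_1[of 2] by (simp add: C1_def)
    have t: "1 \<le> t" using r e by (auto simp: t_def intro!: ge_one_powr_ge_zero)
    have "ln (R / r) \<le> (1 / e) * t" unfolding t_def using r e by (intro ln_le_powr) auto
    then have "1 + ln (R / r) \<le> (1 + 1 / e) * t" using t by (simp add: distrib_right)
    then have "C1 * (1 + ln (R / r)) \<le> C1 * ((1 + 1 / e) * t)" using C1 by (intro mult_left_mono) auto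
    moreover have "cmod (mb x R - mb x r) \<le> C1 * (1 + ln (R / r))"
      unfolding C1_def by (rule mean_diff_concentric[OF r])
    moreover have "1 + L \<le> (1 + L) * t" using t L_pos by simp
    ultimately have "L + c \<le> (1 + L + C1 * (1 + 1 / e)) * t" by (simp add: c_def algebra_simps)
    moreover have "measure M (ball x R) \<le> Q * V R" by (rule measure_le_V[OF R])
    ultimately have "(L + c) * measure M (ball x R) \<le> ((1 + L + C1 * (1 + 1 / e)) * t) * (Q * V R)"
      using L_pos C1 e t by (intro mult_mono) auto
    then show "(L + c) * measure M (ball x R) \<le> (1 + L + L * S 2 / ln 2 * (1 + 1 / e)) * Q * (R / r) powr e * V R"
      by (simp add: C1_def t_def mult_ac)
  qed
  finally show ?thesis .
qed

lemma q_atom_maximal_L1: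
  assumes q: "1 < q"
  obtains C where "0 < C" "\<And>x r a. q_atom q x r a \<Longrightarrow>
    (\<integral>\<^sup>+y. ennreal (1 + cmod (b y - mb x r)) * GM (fun_distr M a) y \<partial>M) \<le> ennreal C"
proof -
  obtain C1 where C1: "0 < C1" "\<And>x r a. q_atom q x r a \<Longrightarrow>
    (\<integral>\<^sup>+y\<in>ball x (2 * K * r). ennreal (1 + cmod (b y - mb x r)) * GM (fun_distr M a) y \<partial>M) \<le> ennreal C1"
    using q_atom_maximal_near[OF q] by blast
  \<comment> \<open>The drift of the means must stay below the decay exponent \<beta> of the maximal
    function far from the atom.\<close>
  define e where "e = \<beta> / 2"
  have e: "0 < e" "e < \<beta>" using \<beta> by (auto simp: e_def)
  define s where "s = (1 + L + L * S 2 / ln 2 * (1 + 1 / e)) * Q"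
  have s: "0 \<le> s" using L_pos S_ge_1[of 2] e Q_ge_1 by (simp add: s_def)
  define N where "N = 2 * 2 powr \<beta> * Q\<^sup>2 * 2 powr n"
  have N: "0 \<le> N" by (simp add: N_def)
  define C2 where "C2 = Q * 2 powr (\<beta> + n) / (1 - 2 powr (e - \<beta>)) * s * N"
  have "2 powr (e - \<beta>) < (1::real)" using e powr_less_mono[of "e - \<beta>" 0 "2::real"] by simp
  then have C2: "0 \<le> C2" using Q_ge_1 s N by (simp add: C2_def)
  show ?thesis
  proof
    show "0 < C1 + C2" using C1 C2 by simp
    fix x r a assume a: "q_atom q x r a"
    have r: "0 < r" using a by (simp add: q_atom_def)
    note [measurable] = grand_maximal_measurable[OF q_atom_distribution[OF a q]]
    define G where "G = GM (fun_distr M a)"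
    have [measurable]: "G \<in> borel_measurable M" by (simp add: G_def)
    define B where "B = ball x (2 * K * r)"
    have B[measurable]: "B \<in> sets M" by (simp add: B_def)
    \<comment> \<open>\<open>annuli_integral\<close> takes a real function; off the dilate the
      maximal function is finite, so the conversion loses nothing.\<close>
    define w where "w y = enn2real (G y * indicator (- B) y)" for y
    have Bc[measurable]: "- B \<in> sets M" using sets.compl_sets[OF B] by (simp add: space_UNIV Compl_eq_Diff_UNIV)
    have w[measurable]: "w \<in> borel_measurable M" unfolding w_def by measurable
    have wle: "w y \<le> N * (r / (r + d x y)) powr \<beta> / V (r + d x y)"
      and weq: "G y * indicator (- B) y = ennreal (w y)" for y
    proof -
      note p = radius_pos[OF r, of x y]
      have nn: "0 \<le> N * (r / (r + d x y)) powr \<beta> / V (r + d x y)" using N V_pos[OF p] by simp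
      have le: "G y * indicator (- B) y \<le> ennreal (N * (r / (r + d x y)) powr \<beta> / V (r + d x y))"
        using q_atom_maximal_far[OF a q, of y] by (cases "y \<in> B") (auto simp: B_def G_def N_def)
      then show "G y * indicator (- B) y = ennreal (w y)" unfolding w_def
        by (metis ennreal_enn2real ennreal_less_top le_less_trans)
      then show "w y \<le> N * (r / (r + d x y)) powr \<beta> / V (r + d x y)"
        using le nn by (simp add: ennreal_le_iff)
    qed
    define \<nu> where "\<nu> = density M (\<lambda>y. ennreal (1 + cmod (b y - mb x r)))"
    have "(\<integral>\<^sup>+y. ennreal (1 + cmod (b y - mb x r)) * G y \<partial>M)
      = (\<integral>\<^sup>+y. (ennreal (1 + cmod (b y - mb x r)) * G y) * indicator B y
          + ennreal (1 + cmod (b y - mb x r)) * (G y * indicator (- B) y) \<partial>M)"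
      by (intro nn_integral_cong) (auto split: split_indicator)
    also have "\<dots> = (\<integral>\<^sup>+y\<in>B. ennreal (1 + cmod (b y - mb x r)) * G y \<partial>M)
          + (\<integral>\<^sup>+y. ennreal (1 + cmod (b y - mb x r)) * ennreal (w y) \<partial>M)"
      unfolding weq by (rule nn_integral_add) measurable
    also have "(\<integral>\<^sup>+y. ennreal (1 + cmod (b y - mb x r)) * ennreal (w y) \<partial>M) = (\<integral>\<^sup>+y. ennreal (w y) \<partial>\<nu>)"
      unfolding \<nu>_def by (rule nn_integral_density[symmetric]) measurable
    also have "\<dots> \<le> ennreal C2"
      unfolding C2_def
    proof (rule annuli_integral[where x = x and \<rho> = r])
      show "emeasure \<nu> (ball x R) \<le> ennreal (s * (R / r) powr e * V R)" if "r \<le> R" for R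
        using bmo_growth_ball[OF r that e(1), of x] by (simp add: \<nu>_def emeasure_density s_def)
    qed (use r e N s wle in \<open>auto simp: \<nu>_def\<close>)
    also have "(\<integral>\<^sup>+y\<in>B. ennreal (1 + cmod (b y - mb x r)) * G y \<partial>M) \<le> ennreal C1"
      unfolding B_def G_def by (rule C1(2)[OF a])
    finally show "(\<integral>\<^sup>+y. ennreal (1 + cmod (b y - mb x r)) * GM (fun_distr M a) y \<partial>M) \<le> ennreal (C1 + C2)"
      using C1 C2 by (simp add: G_def add_mono)
  qed
qed

text \<open>The logarithmic growth of the means is beaten by the cancellation of the atom on small balls and by
  the integrability of the test function on large ones.\<close>

lemma q_atom_mean_pairing:
  assumes q: "1 < q"
  obtains C where "0 < C" "\<And>x r a \<phi>. q_atom q x r a \<Longrightarrow> \<phi> \<in> TC \<Longrightarrow>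
    cmod (mb x r) * cmod (fun_distr M a \<phi>) \<le> C * TN \<phi>"
proof -
  obtain Cm where Cm: "0 < Cm" "\<And>x r s. 0 < r \<Longrightarrow> r \<le> s \<Longrightarrow> 1 \<le> s \<Longrightarrow> d x0 x \<le> s \<Longrightarrow>
    cmod (mb x r) \<le> Cm * (1 + ln (s / r) + ln s)" using mean_growth by blast
  obtain C1 where C1: "0 < C1" "\<And>\<phi>. \<phi> \<in> TC \<Longrightarrow> (\<integral>\<^sup>+y. ennreal (cmod (\<phi> y)) \<partial>M) \<le> ennreal (C1 * TN \<phi>)"
    using test_closure_L1 by blast
  have K2: "1 \<le> 2 * K" using K0_ge_1 by simp
  define W where "W = Q / V 1"
  have W: "0 < W" using Q_ge_1 V_pos[of 1] by (simp add: W_def)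
  define Ca where "Ca = Cm * (2 * W * (1 + 1 / \<beta> + 1 / \<gamma>))"
  have Ca: "0 < Ca" using Cm W \<beta> \<gamma> by (simp add: Ca_def add_pos_pos)
  \<comment> \<open>Lower volume bound from reverse doubling: when \<open>s = 2 * K * r\<close> is
    at least 1, a ball of radius \<open>r\<close> has measure at least
    \<open>c0 * s powr \<kappa>\<close>.\<close>
  define c0 where "c0 = V 1 / (Q * (Q * (2 * K) powr n) * Q)"
  have c0: "0 < c0" using Q_ge_1 V_pos[of 1] K_pos by (simp add: c0_def)
  \<comment> \<open>Small enough for \<open>s powr \<delta>\<close> to be absorbed both by
    \<open>m powr (-1/2)\<close> and by \<open>m powr (- ((q - 1) / 2))\<close>, the two terms that
    the threshold \<open>m powr (1/2)\<close> produces.\<close>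
  define \<delta> where "\<delta> = min (\<kappa> / 2) (\<kappa> * (q - 1) / 2)"
  have \<delta>: "0 < \<delta>" "\<delta> \<le> \<kappa> / 2" "\<delta> \<le> \<kappa> * (q - 1) / 2" using \<kappa>_pos q by (auto simp: \<delta>_def)
  define Cb where "Cb = Cm * ((C1 * c0 powr (-1/2) + W * c0 powr ((1 - q) / 2)) * (1 + ln (2 * K) + 1 / \<delta>))"
  have Cb: "0 < Cb"
    unfolding Cb_def using Cm C1 W c0 \<delta> K2 by (intro mult_pos_pos add_pos_pos add_pos_nonneg) auto
  show ?thesis
  proof
    show "0 < Ca + Cb" using Ca Cb by simp
    fix x r a \<phi> assume a: "q_atom q x r a" and \<phi>: "\<phi> \<in> TC"
    have r: "0 < r" using a by (simp add: q_atom_def)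
    define N where "N = TN \<phi>"
    have N: "0 \<le> N" unfolding N_def by (rule test_norm_TC_nonneg[OF \<phi>])
    define D where "D = d x0 x"
    have D: "0 \<le> D" by (simp add: D_def dist_nonneg)
    \<comment> \<open>The case split is at the radius up to which every point of the ball forms an
      admissible pair with the centre in the smoothness condition for \<phi>; a larger ball has a
      radius comparable to its distance from \<open>x0\<close>, or exceeding it.\<close>
    have "cmod (mb x r) * cmod (fun_distr M a \<phi>) \<le> max Ca Cb * N"
    proof (cases "r \<le> (1 + D) / (2 * K)")
      case True
      define s where "s = 1 + D"
      have s: "1 \<le> s" "D \<le> s" using D by (auto simp: s_def)
      have "s / (2 * K) \<le> s / 1" using s K2 by (intro divide_left_mono) auto
      then have rs: "r \<le> s" using True by (simp add: s_def)
      \<comment> \<open>\<open>u\<close> is what the smoothness \<beta> gains for a small ball and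
        \<open>v\<close> what the decay \<gamma> gains for a remote one; each dominates one of the
        two logarithms in the mean.\<close>
      define u where "u = (s / r) powr \<beta>"
      define v where "v = s powr \<gamma>"
      have uv: "1 \<le> u" "1 \<le> v" using rs r s \<beta> \<gamma> by (auto simp: u_def v_def intro!: ge_one_powr_ge_zero)
      have "cmod (mb x r) \<le> Cm * (1 + ln (s / r) + ln s)"
        using r rs s by (intro Cm(2)) (auto simp: D_def)
      also have "\<dots> \<le> Cm * (1 + (1 / \<beta>) * u + (1 / \<gamma>) * v)"
        unfolding u_def v_def using Cm rs r s \<beta> \<gamma> by (intro mult_left_mono add_mono ln_le_powr) auto
      also have "\<dots> \<le> Cm * ((1 + 1 / \<beta> + 1 / \<gamma>) * (u * v))"
      proof (intro mult_left_mono)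
        have "1 \<le> u * v" "u \<le> u * v" "v \<le> u * v" using uv mult_mono[of 1 u 1 v] by simp_all
        then have "1 + (1 / \<beta>) * u + (1 / \<gamma>) * v \<le> u * v + (1 / \<beta>) * (u * v) + (1 / \<gamma>) * (u * v)"
          using \<beta> \<gamma> by (intro add_mono mult_left_mono) auto
        then show "1 + (1 / \<beta>) * u + (1 / \<gamma>) * v \<le> (1 + 1 / \<beta> + 1 / \<gamma>) * (u * v)" by (simp add: algebra_simps)
      qed (use Cm in auto)
      finally have mbu: "cmod (mb x r) \<le> Cm * ((1 + 1 / \<beta> + 1 / \<gamma>) * (u * v))" .
      have "cmod (fun_distr M a \<phi>) \<le> 2 * (N * W / (u * v))"
      proof (rule q_atom_oscillation_bound[OF a q \<phi>])
        fix y assume y: "y \<in> ball x r"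
        have "d x y \<le> (1 + d x0 x) / (2 * K)" using y True by (simp add: D_def)
        then have "cmod (\<phi> x - \<phi> y) \<le> N * ((d x y / (1 + d x0 x)) powr \<beta> * tw \<gamma> x0 1 x)"
          unfolding N_def by (rule test_bound_diff[OF test_closure_bound[OF \<phi>]])
        also have "\<dots> \<le> N * ((1 / u) * (W / v))"
        proof (intro mult_left_mono mult_mono N)
          have "(d x y / s) powr \<beta> \<le> (r / s) powr \<beta>"
            using y s \<beta> dist_nonneg[of x y] by (intro powr_mono2 divide_right_mono) auto
          also have "\<dots> = 1 / u" using r s by (simp add: u_def powr_divide)
          finally show "(d x y / (1 + d x0 x)) powr \<beta> \<le> 1 / u" by (simp add: s_def D_def)
          have "tw \<gamma> x0 1 x \<le> Q * (1 / s) powr \<gamma> / V s"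
            using tw_le_V[OF zero_less_one, of \<gamma> x0 x] by (simp add: s_def D_def)
          also have "\<dots> \<le> Q * (1 / s) powr \<gamma> / V 1"
            using s Q_ge_1 V_pos[of 1] V_mono[of 1 s] V_pos[of s] by (intro divide_left_mono) auto
          also have "\<dots> = W / v" using s by (simp add: W_def v_def powr_divide)
          finally show "tw \<gamma> x0 1 x \<le> W / v" .
        qed (use uv tw_nonneg[OF zero_less_one] in auto)
        finally show "cmod (\<phi> x - \<phi> y) \<le> N * W / (u * v)" by simp
      qed
      then have "cmod (mb x r) * cmod (fun_distr M a \<phi>)
          \<le> (Cm * ((1 + 1 / \<beta> + 1 / \<gamma>) * (u * v))) * (2 * (N * W / (u * v)))"
        using mbu by (intro mult_mono) (auto intro: order_trans[OF norm_ge_zero])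
      also have "\<dots> = Ca * N"
      proof -
        have "u * v \<noteq> 0" using uv by simp
        then show ?thesis by (simp add: Ca_def field_simps)
      qed
      also have "\<dots> \<le> max Ca Cb * N" using N by (intro mult_right_mono) auto
      finally show ?thesis .
    next
      case False
      define s where "s = 2 * K * r"
      have s: "1 + D \<le> s" using False K_pos by (simp add: s_def field_simps)
      then have s1: "1 \<le> s" "D \<le> s" using D by auto
      have "1 * r \<le> (2 * K) * r" using K2 r by (intro mult_right_mono) auto
      then have rs: "r \<le> s" by (simp add: s_def)
      have sr: "s / r = 2 * K" using r by (simp add: s_def)
      define v where "v = s powr \<delta>"
      have v: "1 \<le> v" using s1 \<delta> by (auto simp: v_def intro!: ge_one_powr_ge_zero)
      have "cmod (mb x r) \<le> Cm * (1 + ln (s / r) + ln s)"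
        using r rs s1 by (intro Cm(2)) (auto simp: D_def)
      also have "\<dots> \<le> Cm * ((1 + ln (2 * K)) * v + (1 / \<delta>) * v)"
      proof (intro mult_left_mono add_mono)
        have "0 \<le> 1 + ln (2 * K)" using K2 by simp
        from mult_left_mono[OF v this] show "1 + ln (s / r) \<le> (1 + ln (2 * K)) * v" by (simp add: sr)
        show "ln s \<le> (1 / \<delta>) * v" unfolding v_def by (rule ln_le_powr[OF s1(1) \<delta>(1)])
      qed (use Cm in auto)
      finally have mbu: "cmod (mb x r) \<le> Cm * ((1 + ln (2 * K) + 1 / \<delta>) * v)" by (simp add: algebra_simps)
      define m where "m = measure M (ball x r)"
      have m: "0 < m" unfolding m_def by (rule measure_qball_pos[OF r])
      have mlow: "c0 * s powr \<kappa> \<le> m"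
      proof -
        have "s powr \<kappa> * V 1 \<le> Q * V s" using V_reverse[of 1 s] s1 by simp
        also have "\<dots> \<le> Q * (Q * (2 * K) powr n * V r)"
          using Q_ge_1 r s1 K2 by (intro mult_left_mono V_scale) (auto simp: s_def)
        also have "\<dots> \<le> Q * (Q * (2 * K) powr n * (Q * m))"
          using Q_ge_1 V_le_measure[OF r, of x] by (intro mult_left_mono) (auto simp: m_def)
        finally have "s powr \<kappa> * V 1 \<le> m * (Q * (Q * (2 * K) powr n) * Q)" by (simp add: mult_ac)
        moreover have "0 < Q * (Q * (2 * K) powr n) * Q" using Q_ge_1 K_pos by simp
        ultimately show ?thesis by (simp add: c0_def pos_divide_le_eq mult_ac)
      qed
      have mpow: "m powr (- e) \<le> c0 powr (- e) * (1 / v)" if e: "0 < e" "\<delta> \<le> \<kappa> * e" for e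
      proof -
        have "0 < c0 * s powr \<kappa>" using c0 s1 by simp
        then have "m powr (- e) \<le> (c0 * s powr \<kappa>) powr (- e)"
          using mlow e by (intro powr_mono2') auto
        also have "\<dots> = c0 powr (- e) * s powr (- (\<kappa> * e))" by (simp add: powr_mult powr_powr)
        also have "\<dots> \<le> c0 powr (- e) * s powr (- \<delta>)" using e s1 by (intro mult_left_mono powr_mono) auto
        also have "s powr (- \<delta>) = 1 / v" by (simp add: v_def powr_minus_divide)
        finally show ?thesis .
      qed
      have ai: "integrable M a" by (rule q_atom_L1(2)[OF a q])
      have [measurable]: "\<phi> \<in> borel_measurable M" by (rule test_closure_measurable[OF \<phi>])
      have "ennreal (cmod (fun_distr M a \<phi>)) \<le> (\<integral>\<^sup>+y. ennreal (cmod (\<phi> y)) * ennreal (cmod (a y)) \<partial>M)"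
        by (rule fun_distr_nn_bound[OF ai \<phi>])
      also have "\<dots> \<le> ennreal (m powr (1/2) / m) * (\<integral>\<^sup>+y\<in>ball x r. ennreal (cmod (\<phi> y)) \<partial>M)
          + ennreal (W * N * (m powr (1/2)) powr (1 - q))"
      proof (rule q_atom_weighted[OF a q])
        show "ennreal (cmod (\<phi> y)) \<le> ennreal (W * N)" for y
          using test_closure_sup[OF \<phi>, of y] by (simp add: W_def N_def ennreal_leI)
      qed (use m W N in \<open>auto simp: m_def\<close>)
      also have "\<dots> \<le> ennreal (m powr (1/2) / m) * ennreal (C1 * N) + ennreal (W * N * (m powr (1/2)) powr (1 - q))"
      proof (intro add_right_mono mult_left_mono)
        have "(\<integral>\<^sup>+y\<in>ball x r. ennreal (cmod (\<phi> y)) \<partial>M) \<le> (\<integral>\<^sup>+y. ennreal (cmod (\<phi> y)) \<partial>M)"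
          by (intro nn_integral_mono) (auto split: split_indicator)
        then show "(\<integral>\<^sup>+y\<in>ball x r. ennreal (cmod (\<phi> y)) \<partial>M) \<le> ennreal (C1 * N)"
          unfolding N_def using C1(2)[OF \<phi>] by (rule order_trans)
      qed auto
      also have "\<dots> = ennreal (m powr (-1/2) * (C1 * N) + W * N * m powr (- ((q - 1) / 2)))"
      proof -
        have "m powr (1/2) / m = m powr (1/2) / m powr 1" using m by simp
        also have "\<dots> = m powr (-1/2)" by (simp only: powr_diff[symmetric]) simp
        finally have 1: "m powr (1/2) / m = m powr (-1/2)" .
        have "(1/2) * (1 - q) = - ((q - 1) / 2)" by (simp add: diff_divide_distrib right_diff_distrib)
        then have 2: "(m powr (1/2)) powr (1 - q) = m powr (- ((q - 1) / 2))" by (simp only: powr_powr)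
        show ?thesis unfolding 1 2 using C1 N W
          by (simp add: ennreal_mult[symmetric] ennreal_plus[symmetric] del: ennreal_plus)
      qed
      finally have "cmod (fun_distr M a \<phi>) \<le> m powr (-1/2) * (C1 * N) + W * N * m powr (- ((q - 1) / 2))"
        using C1 N W by (subst (asm) ennreal_le_iff) auto
      also have "\<dots> \<le> (c0 powr (-1/2) * (1 / v)) * (C1 * N) + W * N * (c0 powr (- ((q - 1) / 2)) * (1 / v))"
        using mpow[of "1/2"] mpow[of "(q - 1) / 2"] \<delta> q C1 N W
        by (intro add_mono mult_left_mono mult_right_mono) auto
      also have "\<dots> = (C1 * c0 powr (-1/2) + W * c0 powr ((1 - q) / 2)) * (N / v)"
      proof -
        have eq: "- ((q - 1) / 2) = (1 - q) / 2" by (simp only: minus_divide_left minus_diff_eq)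
        show ?thesis unfolding eq distrib_right by (simp add: mult_ac)
      qed
      finally have "cmod (mb x r) * cmod (fun_distr M a \<phi>) \<le> (Cm * ((1 + ln (2 * K) + 1 / \<delta>) * v))
          * ((C1 * c0 powr (-1/2) + W * c0 powr ((1 - q) / 2)) * (N / v))"
        using mbu by (intro mult_mono) (auto intro: order_trans[OF norm_ge_zero])
      also have "\<dots> = Cb * N" using v by (simp add: Cb_def)
      also have "\<dots> \<le> max Ca Cb * N" using N by (intro mult_right_mono) auto
      finally show ?thesis .
    qed
    also have "\<dots> \<le> (Ca + Cb) * N" using Ca Cb N by (intro mult_right_mono) auto
    finally show "cmod (mb x r) * cmod (fun_distr M a \<phi>) \<le> (Ca + Cb) * TN \<phi>" by (simp add: N_def)
  qed
qed

end

section \<open>Series of atoms\<close>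

lemma L1_series:
  fixes F :: "nat \<Rightarrow> 'b \<Rightarrow> complex"
  assumes i: "\<And>i. integrable N (F i)" and s: "summable (\<lambda>i. LINT y|N. cmod (F i y))"
  shows "AE y in N. summable (\<lambda>i. cmod (F i y))" "integrable N (\<lambda>y. \<Sum>i. F i y)"
    "(\<lambda>i. LINT y|N. F i y) sums (LINT y|N. (\<Sum>i. F i y))"
proof -
  have [measurable]: "F i \<in> borel_measurable N" for i using i by auto
  have "(\<integral>\<^sup>+y. (\<Sum>i. ennreal (cmod (F i y))) \<partial>N) = (\<Sum>i. \<integral>\<^sup>+y. ennreal (cmod (F i y)) \<partial>N)"
    by (rule nn_integral_suminf) measurable
  also have "\<dots> = (\<Sum>i. ennreal (LINT y|N. cmod (F i y)))"
    using i by (intro suminf_cong nn_integral_eq_integral) auto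
  also have "\<dots> = ennreal (\<Sum>i. LINT y|N. cmod (F i y))"
    by (intro suminf_ennreal2 s integral_nonneg_AE) auto
  finally have "AE y in N. (\<Sum>i. ennreal (cmod (F i y))) \<noteq> \<infinity>"
    by (intro nn_integral_noteq_infinite) auto
  then show ae: "AE y in N. summable (\<lambda>i. cmod (F i y))"
    by eventually_elim (rule summable_suminf_not_top, auto)
  show "integrable N (\<lambda>y. \<Sum>i. F i y)" by (rule integrable_suminf[OF i ae s])
  show "(\<lambda>i. LINT y|N. F i y) sums (LINT y|N. (\<Sum>i. F i y))" by (rule sums_integral[OF i ae s])
qed

text \<open>The bounded factor will be a test function, or a test function times a truncation of
  \<open>b\<close>.\<close>

lemma L1_series_mult:
  fixes F :: "nat \<Rightarrow> 'b \<Rightarrow> complex"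
  assumes i: "\<And>i. integrable N (F i)" and s: "summable (\<lambda>i. LINT y|N. cmod (F i y))"
    and g: "g \<in> borel_measurable N" and B: "\<And>y. cmod (g y) \<le> B"
  shows "(\<lambda>i. LINT y|N. F i y * g y) sums (LINT y|N. (\<Sum>i. F i y) * g y)"
proof -
  have [measurable]: "F i \<in> borel_measurable N" for i using i by auto
  note g[measurable]
  have le: "cmod (F i y * g y) \<le> cmod (F i y) * B" for i y
    using B[of y] by (simp add: norm_mult mult_left_mono)
  have ib: "integrable N (\<lambda>y. cmod (F i y) * B)" for i using i by simp
  have i': "integrable N (\<lambda>y. F i y * g y)" for i
  proof (rule Bochner_Integration.integrable_bound[OF ib])
    show "AE y in N. norm (F i y * g y) \<le> norm (cmod (F i y) * B)"
      by (intro AE_I2 order_trans[OF le]) (simp only: real_norm_def abs_ge_self)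
  qed measurable
  have s': "summable (\<lambda>i. LINT y|N. cmod (F i y * g y))"
  proof (rule summable_comparison_test'[OF summable_mult2[OF s, of B], of 0])
    fix i
    have "0 \<le> (LINT y|N. cmod (F i y * g y))" by (intro integral_nonneg_AE) auto
    moreover have "(LINT y|N. cmod (F i y * g y)) \<le> (LINT y|N. cmod (F i y) * B)"
      using i' ib le by (intro integral_mono) auto
    ultimately show "norm (LINT y|N. cmod (F i y * g y)) \<le> (LINT y|N. cmod (F i y)) * B" by simp
  qed
  have "(\<lambda>i. LINT y|N. F i y * g y) sums (LINT y|N. (\<Sum>i. F i y * g y))" by (rule L1_series(3)[OF i' s'])
  also have "(LINT y|N. (\<Sum>i. F i y * g y)) = (LINT y|N. (\<Sum>i. F i y) * g y)"
  proof (rule integral_cong_AE)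
    show "AE y in N. (\<Sum>i. F i y * g y) = (\<Sum>i. F i y) * g y"
      using L1_series(1)[OF i s] by eventually_elim (rule suminf_mult2[symmetric], rule summable_norm_cancel)
  qed measurable
  finally show ?thesis .
qed

lemma real_LINT_le:
  assumes "(\<integral>\<^sup>+y. ennreal (f y) \<partial>N) \<le> ennreal C" "0 \<le> C" "f \<in> borel_measurable N" "\<And>y. 0 \<le> (f y :: real)"
  shows "integrable N f" "(LINT y|N. f y) \<le> C"
proof -
  show "integrable N f" using assms by (intro integrableI_nonneg) (auto intro: le_less_trans)
  then show "(LINT y|N. f y) \<le> C" using assms by (subst (asm) nn_integral_eq_integral) (auto simp: ennreal_le_iff)
qed

section \<open>The Orlicz function t / log (e + t)\<close>

lemma wp_mono:
  assumes "0 \<le> u" "u \<le> (v::real)"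
  shows "u / ln (exp 1 + u) \<le> v / ln (exp 1 + v)"
proof -
  have e: "(1::real) < exp 1" using exp_gt_one[of "1::real"] by simp
  have pos: "0 < exp 1 + u" "0 < exp 1 + v" using assms e by linarith+
  have l: "1 \<le> ln (exp 1 + u)" using assms by (subst ln_ge_iff) (use pos in auto)
  have l': "1 \<le> ln (exp 1 + v)" using assms by (subst ln_ge_iff) (use pos in auto)
  have "ln ((exp 1 + v) / (exp 1 + u)) \<le> (exp 1 + v) / (exp 1 + u) - 1" using pos by (intro ln_le_minus_one) auto
  then have "ln (exp 1 + v) \<le> ln (exp 1 + u) + (v - u) / (exp 1 + u)"
    using pos by (simp add: ln_div field_simps)
  then have "u * ln (exp 1 + v) \<le> u * (ln (exp 1 + u) + (v - u) / (exp 1 + u))" using assms by (intro mult_left_mono) auto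
  also have "\<dots> = u * ln (exp 1 + u) + (v - u) * (u / (exp 1 + u))" by (simp add: algebra_simps)
  also have "\<dots> \<le> u * ln (exp 1 + u) + (v - u) * ln (exp 1 + u)"
  proof (intro add_left_mono mult_left_mono)
    have "u / (exp 1 + u) \<le> 1" using pos e by (simp add: divide_le_eq)
    then show "u / (exp 1 + u) \<le> ln (exp 1 + u)" using l by linarith
  qed (use assms in auto)
  finally have "u * ln (exp 1 + v) \<le> v * ln (exp 1 + u)" by (simp add: algebra_simps)
  then show ?thesis using l l' by (simp add: field_simps)
qed

lemma ln_exp_ge_1: "0 \<le> u \<Longrightarrow> 1 \<le> ln (exp 1 + (u::real))"
  by (subst ln_ge_iff) (auto intro: add_pos_nonneg)

lemma wp_subadditive:
  assumes "0 \<le> u" "0 \<le> (v::real)"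
  shows "(u + v) / ln (exp 1 + (u + v)) \<le> u / ln (exp 1 + u) + v / ln (exp 1 + v)"
proof -
  have l: "1 \<le> ln (exp 1 + u)" "1 \<le> ln (exp 1 + v)" "1 \<le> ln (exp 1 + (u + v))" using assms by (auto intro: ln_exp_ge_1)
  have e: "(0::real) < exp 1" by simp
  have m: "ln (exp 1 + u) \<le> ln (exp 1 + (u + v))" "ln (exp 1 + v) \<le> ln (exp 1 + (u + v))"
    using assms e by (auto intro!: ln_mono add_pos_nonneg)
  have "u / ln (exp 1 + (u + v)) \<le> u / ln (exp 1 + u)" "v / ln (exp 1 + (u + v)) \<le> v / ln (exp 1 + v)"
    using m l assms by (auto intro!: divide_left_mono mult_pos_pos)
  then show ?thesis by (simp add: add_divide_distrib)
qed

text \<open>Compared with homogeneity there is a logarithmic loss, but the factor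
  \<open>(1 + ln k) / k\<close> still tends to 0, which is enough to bring a finite modular below
  1.\<close>

lemma wp_scale:
  assumes k: "1 \<le> (k::real)" and t: "0 \<le> t"
  shows "(t / k) / ln (exp 1 + t / k) \<le> ((1 + ln k) / k) * (t / ln (exp 1 + t))"
proof -
  have l: "1 \<le> ln (exp 1 + t / k)" "1 \<le> ln (exp 1 + t)" using k t by (auto intro: ln_exp_ge_1)
  have e: "(0::real) < exp 1" by simp
  have "exp 1 + t \<le> k * (exp 1 + t / k)" using k mult_right_mono[OF k, of "exp 1"] by (simp add: distrib_left)
  then have "ln (exp 1 + t) \<le> ln (k * (exp 1 + t / k))" using e t by (intro ln_mono) (auto intro: add_pos_nonneg)
  also have "\<dots> = ln k + ln (exp 1 + t / k)"
  proof (rule ln_mult_pos)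
    have "0 < exp 1 + t / k" using k t e by (intro add_pos_nonneg) auto
    then show "0 < exp 1 + t / k" .
  qed (use k in auto)
  also have "\<dots> \<le> ln k * ln (exp 1 + t / k) + ln (exp 1 + t / k)"
    using l k mult_left_mono[OF l(1), of "ln k"] by simp
  finally have *: "ln (exp 1 + t) \<le> (1 + ln k) * ln (exp 1 + t / k)" by (simp add: algebra_simps)
  define u v X where "u = ln (exp 1 + t / k)" and "v = ln (exp 1 + t)" and "X = t / k"
  have "X * v \<le> X * ((1 + ln k) * u)"
    using * k t by (intro mult_left_mono) (auto simp: u_def v_def X_def)
  then have "X / u \<le> (1 + ln k) * (X / v)" using l unfolding u_def[symmetric] v_def[symmetric]
    by (simp add: field_simps)
  then show ?thesis by (simp add: u_def v_def X_def)
qed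

text \<open>The generalised Hoelder inequality behind \<open>L\<^sup>1 \<cdot> exp L \<subseteq> L\<^sup>\<wp>\<close> in pointwise form: either \<open>t\<close> is
  dominated by \<open>exp (s / 2)\<close>, or \<open>s\<close> is at most logarithmic in \<open>t\<close>.\<close>

lemma wp_product_bound:
  fixes s t w l N :: real
  assumes s: "0 \<le> s" and t: "0 \<le> t" and w: "0 < w" and l: "1 \<le> l" and N: "0 \<le> N" and lw: "- N * l \<le> ln w"
  shows "(s * t) / ln (exp 1 + s * t) / l \<le> (2 + 2 * N) * (t + exp s * w)"
proof -
  have st: "0 \<le> s * t" using s t by simp
  define m where "m = ln (exp 1 + s * t)"
  have m: "1 \<le> m" unfolding m_def by (rule ln_exp_ge_1[OF st])
  have ml: "1 \<le> m * l" using m l mult_mono[of 1 m 1 l] by simp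
  have eq: "(s * t) / m / l = s * t / (m * l)" by simp
  have ew: "0 \<le> exp s * w" using w by simp
  have "s * t / (m * l) \<le> (2 + 2 * N) * (t + exp s * w)"
  proof (cases "t \<le> exp (s / 2) * w")
    case True
    have "s * t / (m * l) \<le> s * t / 1" using ml st by (intro divide_left_mono) auto
    also have "\<dots> \<le> s * (exp (s / 2) * w)" using True s by (simp add: mult_left_mono)
    also have "\<dots> \<le> (2 * exp (s / 2)) * (exp (s / 2) * w)"
    proof (rule mult_right_mono)
      have "s / 2 \<le> exp (s / 2)" using exp_ge_add_one_self[of "s / 2"] by linarith
      then have "2 * (s / 2) \<le> 2 * exp (s / 2)" by (rule mult_left_mono) simp
      then show "s \<le> 2 * exp (s / 2)" by simp
    qed (use w in auto)
    also have "\<dots> = 2 * (exp s * w)" by (simp add: exp_add[symmetric])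
    also have "\<dots> \<le> (2 + 2 * N) * (t + exp s * w)"
      using N t ew by (intro mult_mono) auto
    finally show ?thesis .
  next
    case False
    have t0: "0 < t" using False w less_le_trans[of 0 "exp (s / 2) * w" t] by simp
    have "ln (exp (s / 2) * w) \<le> ln t" using False w by (intro ln_mono) auto
    then have "s / 2 + ln w \<le> ln t" using w by (simp add: ln_mult)
    \<comment> \<open>The lower bound on the weight costs at most \<open>N * l\<close>, so division
      by \<open>m * l\<close> removes both logarithms.\<close>
    then have s2: "s \<le> 2 * ln t + 2 * N * l" using lw by linarith
    have "s \<le> (2 + 2 * N) * (m * l)"
    proof (cases "s \<le> 1")
      case True
      have "1 * 1 \<le> (2 + 2 * N) * (m * l)" using N ml by (intro mult_mono) auto
      then show ?thesis using True by simp
    next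
      case False
      have e: "(0::real) < exp 1" by simp
      have "1 * t \<le> s * t" using False t0 by (intro mult_right_mono) auto
      then have "t \<le> exp 1 + s * t" using e by linarith
      then have "ln t \<le> m" unfolding m_def using t0 by (intro ln_mono)
      moreover have "m \<le> m * l" "l \<le> m * l" using m l mult_mono[of m m 1 l] mult_mono[of 1 m l l] by simp_all
      ultimately have "2 * ln t + 2 * N * l \<le> 2 * (m * l) + 2 * N * (m * l)"
        using N by (intro add_mono mult_left_mono) auto
      then show ?thesis using s2 by (simp add: algebra_simps)
    qed
    then have "s * t / (m * l) \<le> ((2 + 2 * N) * (m * l)) * t / (m * l)"
      using t ml by (intro divide_right_mono mult_right_mono) auto
    also have "\<dots> = (2 + 2 * N) * t" using m l by simp
    also have "\<dots> \<le> (2 + 2 * N) * (t + exp s * w)" using N ew by (intro mult_left_mono) auto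
    finally show ?thesis .
  qed
  then show ?thesis unfolding m_def[symmetric] eq .
qed

lemma orlicz_wp_scale:
  assumes k: "1 \<le> k"
  shows "orlicz_wp (t / ennreal k) \<le> ennreal ((1 + ln k) / k) * orlicz_wp t"
proof (cases "t = \<infinity>")
  case True
  define e where "e = ennreal ((1 + ln k) / k)"
  have "0 < (1 + ln k) / k" using k by (simp add: add_pos_nonneg)
  then have "e \<noteq> 0" by (simp only: e_def ennreal_eq_0_iff not_le)
  then have "e * orlicz_wp t = \<infinity>" using True by (simp add: orlicz_wp_def ennreal_mult_top)
  then show ?thesis unfolding e_def by simp
next
  case False
  then obtain u where u: "t = ennreal u" "0 \<le> u" by (cases t) auto
  have "t / ennreal k = ennreal (u / k)" using u k by (simp add: divide_ennreal)
  moreover have "0 \<le> (1 + ln k) / k" using k by simp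
  ultimately show ?thesis using u k wp_scale[OF k u(2)]
    by (simp add: orlicz_wp_def ennreal_mult'[symmetric] ennreal_leI)
qed

text \<open>Scaling brings a finite modular \<open>J\<close> below 1. \<open>k\<close> is a square
  because \<open>ln k \<le> 2 * (sqrt k - 1)\<close> leaves the bound \<open>2 * J / sqrt k\<close>,
  and \<open>sqrt k = 2 * J + 1\<close>.\<close>

lemma orlicz_norm_finite:
  assumes [measurable]: "g \<in> borel_measurable N" and fin: "(\<integral>\<^sup>+x. orlicz_wp (g x) \<partial>N) < \<infinity>"
  shows "orlicz_norm N g < \<infinity>"
proof -
  have [measurable]: "(\<lambda>x. orlicz_wp (g x)) \<in> borel_measurable N" unfolding orlicz_wp_def by measurable
  obtain J where J: "(\<integral>\<^sup>+x. orlicz_wp (g x) \<partial>N) = ennreal J" "0 \<le> J"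
    using fin by (cases "\<integral>\<^sup>+x. orlicz_wp (g x) \<partial>N") auto
  define k where "k = (2 * J + 1)\<^sup>2"
  have k: "1 \<le> k" using J by (simp add: k_def)
  have sk: "sqrt k = 2 * J + 1" using J by (simp add: k_def)
  have "ln k = 2 * ln (sqrt k)" using k by (simp add: ln_sqrt)
  also have "\<dots> \<le> 2 * (sqrt k - 1)" using k by (intro mult_left_mono ln_le_minus_one) auto
  finally have "(1 + ln k) / k * J \<le> (2 * sqrt k) / k * J" using k J by (intro mult_right_mono divide_right_mono) auto
  also have "\<dots> = 2 * J / sqrt k" using k real_sqrt_mult_self[of k] by (simp add: field_simps)
  also have "\<dots> \<le> 1" using J by (simp add: sk)
  finally have kJ: "(1 + ln k) / k * J \<le> 1" .
  have "(\<integral>\<^sup>+x. orlicz_wp (g x / ennreal k) \<partial>N) \<le> (\<integral>\<^sup>+x. ennreal ((1 + ln k) / k) * orlicz_wp (g x) \<partial>N)"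
    by (intro nn_integral_mono orlicz_wp_scale k)
  also have "\<dots> = ennreal ((1 + ln k) / k) * (\<integral>\<^sup>+x. orlicz_wp (g x) \<partial>N)" by (rule nn_integral_cmult) measurable
  also have "\<dots> = ennreal ((1 + ln k) / k * J)"
    unfolding J(1) using k J by (intro ennreal_mult[symmetric]) auto
  also have "\<dots> \<le> 1" using kJ by simp
  finally have "orlicz_norm N g \<le> ennreal k"
    unfolding orlicz_norm_def using k by (intro Inf_lower) auto
  then show ?thesis by (rule le_less_trans) simp
qed

section \<open>Regular and singular part as distributions\<close>

context product_setting
begin

text \<open>A decomposition without its limit: centres and radii replace the balls, and the exponent
  is finite. Convergence of the series is derived, not assumed.\<close>

definition atomic_data :: "real \<Rightarrow> (nat \<Rightarrow> complex) \<Rightarrow> (nat \<Rightarrow> 'a \<Rightarrow> complex) \<Rightarrow> (nat \<Rightarrow> 'a) \<Rightarrow> (nat \<Rightarrow> real) \<Rightarrow> bool" where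
  "atomic_data q c a X R \<longleftrightarrow> 1 < q \<and> (\<forall>i. q_atom q (X i) (R i) (a i)) \<and> summable (\<lambda>i. cmod (c i))"

definition regular_part where
  "regular_part c a X R y = (\<Sum>i. c i * (b y - mb (X i) (R i)) * a i y)"

text \<open>Summed after pairing: the means are unbounded, so the series of functions need not
  converge in L^1.\<close>

definition singular_part where
  "singular_part c a X R \<phi> = (\<Sum>i. c i * mb (X i) (R i) * fun_distr M (a i) \<phi>)"

lemma L1_series_distr_sums:
  assumes i: "\<And>i. integrable M (F i)" and s: "summable (\<lambda>i. LINT y|M. cmod (F i y))"
  shows "distr_sums d M K x0 \<epsilon> \<beta> \<gamma> F (fun_distr M (\<lambda>y. \<Sum>i. F i y))"
    "integrable M (\<lambda>y. \<Sum>i. F i y)"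
proof -
  show int: "integrable M (\<lambda>y. \<Sum>i. F i y)" by (rule L1_series(2)[OF i s])
  have "(\<lambda>i. fun_distr M (F i) \<phi>) sums fun_distr M (\<lambda>y. \<Sum>i. F i y) \<phi>" if "\<phi> \<in> TC" for \<phi>
    unfolding fun_distr_def
    by (rule L1_series_mult[OF i s test_closure_measurable[OF that] test_closure_sup[OF that]])
  then show "distr_sums d M K x0 \<epsilon> \<beta> \<gamma> F (fun_distr M (\<lambda>y. \<Sum>i. F i y))"
    using integrable_acts_as_distribution[OF i] integrable_acts_as_distribution[OF int]
    by (auto simp: distr_sums_def acts_as_distribution_def)
qed

lemma q_atom_oscillation_integrable:
  assumes q: "1 < q"
  obtains C where "0 < C" "\<And>x r a. q_atom q x r a \<Longrightarrow> integrable M (\<lambda>y. (b y - mb x r) * a y) \<and>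
    (LINT y|M. cmod ((b y - mb x r) * a y)) \<le> C"
proof -
  obtain C where C: "0 < C" "\<And>x r a. q_atom q x r a \<Longrightarrow>
    (\<integral>\<^sup>+y. ennreal (cmod (b y - mb x r)) * ennreal (cmod (a y)) \<partial>M) \<le> ennreal C"
    using q_atom_oscillation_L1[OF q] by blast
  show ?thesis
  proof (rule that[OF C(1)])
    fix x r a assume a: "q_atom q x r a"
    have [measurable]: "a \<in> borel_measurable M" using a by (simp add: q_atom_def)
    have "(\<integral>\<^sup>+y. ennreal (cmod ((b y - mb x r) * a y)) \<partial>M) \<le> ennreal C"
      using C(2)[OF a] by (simp add: norm_mult ennreal_mult)
    from real_LINT_le[OF this less_imp_le[OF C(1)]]
    have 1: "integrable M (\<lambda>y. cmod ((b y - mb x r) * a y))" "(LINT y|M. cmod ((b y - mb x r) * a y)) \<le> C"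
      by auto
    moreover have "integrable M (\<lambda>y. (b y - mb x r) * a y)" using 1(1) by (subst (asm) integrable_norm_iff) auto
    ultimately show "integrable M (\<lambda>y. (b y - mb x r) * a y) \<and> (LINT y|M. cmod ((b y - mb x r) * a y)) \<le> C" by simp
  qed
qed

lemma q_atom_LINT_norm_le:
  assumes "q_atom q x r a" "1 < q"
  shows "(LINT y|M. cmod (a y)) \<le> 2"
proof (rule real_LINT_le(2))
  show "(\<integral>\<^sup>+y. ennreal (cmod (a y)) \<partial>M) \<le> ennreal 2" using q_atom_L1(1)[OF assms] by simp
qed (use assms in \<open>auto simp: q_atom_def\<close>)

lemma regular_part_distr_sums:
  assumes "atomic_data q c a X R"
  shows "distr_sums d M K x0 \<epsilon> \<beta> \<gamma> (\<lambda>i y. c i * (b y - mb (X i) (R i)) * a i y) (fun_distr M (regular_part c a X R))"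
    "integrable M (regular_part c a X R)"
proof -
  have q: "1 < q" and a: "\<And>i. q_atom q (X i) (R i) (a i)" and c: "summable (\<lambda>i. cmod (c i))"
    using assms by (auto simp: atomic_data_def)
  obtain C where C: "0 < C" "\<And>x r a. q_atom q x r a \<Longrightarrow> integrable M (\<lambda>y. (b y - mb x r) * a y) \<and>
    (LINT y|M. cmod ((b y - mb x r) * a y)) \<le> C" using q_atom_oscillation_integrable[OF q] by blast
  have i: "integrable M (\<lambda>y. c i * (b y - mb (X i) (R i)) * a i y)" for i
    using C(2)[OF a[of i]] by (simp add: mult.assoc)
  have s: "summable (\<lambda>i. LINT y|M. cmod (c i * (b y - mb (X i) (R i)) * a i y))"
  proof (rule summable_comparison_test'[OF summable_mult2[OF c, of C], of 0])
    fix i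
    have "norm (LINT y|M. cmod (c i * (b y - mb (X i) (R i)) * a i y)) =
        \<bar>cmod (c i) * (LINT y|M. cmod ((b y - mb (X i) (R i)) * a i y))\<bar>"
      by (simp add: norm_mult mult.assoc)
    also have "\<dots> = cmod (c i) * (LINT y|M. cmod ((b y - mb (X i) (R i)) * a i y))"
      by (intro abs_of_nonneg mult_nonneg_nonneg integral_nonneg_AE) auto
    also have "\<dots> \<le> cmod (c i) * C" using C(2)[OF a[of i]] by (intro mult_left_mono) auto
    finally show "norm (LINT y|M. cmod (c i * (b y - mb (X i) (R i)) * a i y)) \<le> cmod (c i) * C" .
  qed
  have eq: "regular_part c a X R = (\<lambda>y. \<Sum>i. c i * (b y - mb (X i) (R i)) * a i y)"
    by (rule ext) (simp add: regular_part_def)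
  show "distr_sums d M K x0 \<epsilon> \<beta> \<gamma> (\<lambda>i y. c i * (b y - mb (X i) (R i)) * a i y) (fun_distr M (regular_part c a X R))"
    unfolding eq by (rule L1_series_distr_sums(1)[OF i s])
  show "integrable M (regular_part c a X R)" unfolding eq by (rule L1_series_distr_sums(2)[OF i s])
qed

lemma fun_distr_const_mult: "fun_distr M (\<lambda>y. k * a y) \<phi> = k * fun_distr M a \<phi>"
  by (simp add: fun_distr_def mult.assoc)

text \<open>The constant depends neither on \<phi> nor on \<open>i\<close>, which yields both
  absolute convergence and continuity of the sum on test functions.\<close>

lemma singular_part_term_bound:
  assumes "atomic_data q c a X R"
  shows "\<exists>C>0. \<forall>\<phi>\<in>TC. \<forall>i. cmod (c i * mb (X i) (R i) * fun_distr M (a i) \<phi>) \<le> cmod (c i) * (C * TN \<phi>)"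
proof -
  have q: "1 < q" and a: "\<And>i. q_atom q (X i) (R i) (a i)"
    using assms by (auto simp: atomic_data_def)
  obtain C where C: "0 < C" "\<And>x r a \<phi>. q_atom q x r a \<Longrightarrow> \<phi> \<in> TC \<Longrightarrow>
    cmod (mb x r) * cmod (fun_distr M a \<phi>) \<le> C * TN \<phi>" using q_atom_mean_pairing[OF q] by blast
  show ?thesis
  proof (intro exI[of _ C] conjI ballI allI)
    fix \<phi> i assume "\<phi> \<in> TC"
    then show "cmod (c i * mb (X i) (R i) * fun_distr M (a i) \<phi>) \<le> cmod (c i) * (C * TN \<phi>)"
      using mult_left_mono[OF C(2)[OF a], of \<phi> "cmod (c i)"] by (simp add: norm_mult mult.assoc)
  qed (rule C(1))
qed

lemma singular_part_summable:
  assumes A: "atomic_data q c a X R" and \<phi>: "\<phi> \<in> TC"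
  shows "summable (\<lambda>i. cmod (c i * mb (X i) (R i) * fun_distr M (a i) \<phi>))"
proof -
  have c: "summable (\<lambda>i. cmod (c i))" using A by (simp add: atomic_data_def)
  obtain C where "\<And>i. cmod (c i * mb (X i) (R i) * fun_distr M (a i) \<phi>) \<le> cmod (c i) * (C * TN \<phi>)"
    using singular_part_term_bound[OF A] \<phi> by metis
  then show ?thesis
    by (intro summable_comparison_test'[OF summable_mult2[OF c, of "C * TN \<phi>"], of 0]) simp
qed

lemma singular_part_bound:
  assumes A: "atomic_data q c a X R"
  shows "\<exists>C. \<forall>\<phi>\<in>TC. cmod (singular_part c a X R \<phi>) \<le> C * TN \<phi>"
proof -
  have c: "summable (\<lambda>i. cmod (c i))" using A by (simp add: atomic_data_def)
  obtain C where C: "\<And>\<phi> i. \<phi> \<in> TC \<Longrightarrow> cmod (c i * mb (X i) (R i) * fun_distr M (a i) \<phi>) \<le> cmod (c i) * (C * TN \<phi>)"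
    using singular_part_term_bound[OF A] by metis
  have "cmod (singular_part c a X R \<phi>) \<le> ((\<Sum>i. cmod (c i)) * C) * TN \<phi>" if \<phi>: "\<phi> \<in> TC" for \<phi>
  proof -
    have "cmod (singular_part c a X R \<phi>) \<le> (\<Sum>i. cmod (c i * mb (X i) (R i) * fun_distr M (a i) \<phi>))"
      unfolding singular_part_def by (rule summable_norm[OF singular_part_summable[OF A \<phi>]])
    also have "\<dots> \<le> (\<Sum>i. cmod (c i) * (C * TN \<phi>))"
      by (intro suminf_le C \<phi> singular_part_summable[OF A] summable_mult2 c)
    also have "\<dots> = (\<Sum>i. cmod (c i)) * (C * TN \<phi>)" by (rule suminf_mult2[OF c, symmetric])
    finally show ?thesis by (simp add: mult.assoc)
  qed
  then show ?thesis by blast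
qed

lemma singular_part_distribution:
  assumes A: "atomic_data q c a X R"
  shows "singular_part c a X R \<in> DD"
proof -
  have q: "1 < q" and a: "\<And>i. q_atom q (X i) (R i) (a i)" using A by (auto simp: atomic_data_def)
  obtain C where C: "\<And>\<phi>. \<phi> \<in> TC \<Longrightarrow> cmod (singular_part c a X R \<phi>) \<le> C * TN \<phi>"
    using singular_part_bound[OF A] by auto
  note s = summable_norm_cancel[OF singular_part_summable[OF A]]
  show ?thesis
  proof (rule distributionI[of _ C])
    fix \<phi> \<psi> assume "\<phi> \<in> TC" "\<psi> \<in> TC"
    then show "singular_part c a X R (\<lambda>x. \<phi> x + \<psi> x) = singular_part c a X R \<phi> + singular_part c a X R \<psi>"
      using suminf_add[OF s s] fun_distr_add[OF q_atom_L1(2)[OF a q]]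
      by (simp add: singular_part_def distrib_left)
  next
    fix k \<phi> assume \<phi>: "\<phi> \<in> TC"
    have "singular_part c a X R (\<lambda>x. k * \<phi> x) = (\<Sum>i. k * (c i * mb (X i) (R i) * fun_distr M (a i) \<phi>))"
      by (simp add: singular_part_def fun_distr_cmult mult_ac)
    also have "\<dots> = k * singular_part c a X R \<phi>" unfolding singular_part_def by (rule suminf_mult[OF s[OF \<phi>]])
    finally show "singular_part c a X R (\<lambda>x. k * \<phi> x) = k * singular_part c a X R \<phi>" .
  qed (use C in auto)
qed

lemma singular_part_distr_sums:
  assumes A: "atomic_data q c a X R"
  shows "distr_sums d M K x0 \<epsilon> \<beta> \<gamma> (\<lambda>i y. c i * mb (X i) (R i) * a i y) (singular_part c a X R)"
  unfolding distr_sums_def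
proof (intro conjI allI ballI)
  have q: "1 < q" and a: "\<And>i. q_atom q (X i) (R i) (a i)" using A by (auto simp: atomic_data_def)
  fix i
  show "acts_as_distribution d M K x0 \<epsilon> \<beta> \<gamma> (\<lambda>y. c i * mb (X i) (R i) * a i y)"
    using q_atom_L1(2)[OF a[of i] q] by (intro integrable_acts_as_distribution) auto
next
  show "singular_part c a X R \<in> DD" by (rule singular_part_distribution[OF A])
  fix \<phi> assume "\<phi> \<in> TC"
  then show "(\<lambda>i. fun_distr M (\<lambda>y. c i * mb (X i) (R i) * a i y) \<phi>) sums singular_part c a X R \<phi>"
    unfolding fun_distr_const_mult singular_part_def by (intro summable_sums summable_norm_cancel[OF singular_part_summable[OF A]])
qed

end

section \<open>The product\<close>

text \<open>The nearest-point projection is 1-Lipschitz, so that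
  \<open>truncate_disc N (b y) - truncate_disc N (mb x r)\<close> is dominated by the oscillation of
  \<open>b\<close>.\<close>

definition truncate_disc :: "nat \<Rightarrow> complex \<Rightarrow> complex" where
  "truncate_disc N = closest_point (cball 0 (real N))"

lemma truncate_disc_lipschitz: "cmod (truncate_disc N z - truncate_disc N w) \<le> cmod (z - w)"
  using closest_point_lipschitz[of "cball 0 (real N)" z w] by (simp add: truncate_disc_def dist_norm)

lemma truncate_disc_eq: "cmod z \<le> real N \<Longrightarrow> truncate_disc N z = z"
  by (simp add: truncate_disc_def closest_point_self)

lemma truncate_disc_le: "cmod (truncate_disc N z) \<le> cmod z"
  using truncate_disc_lipschitz[of N z 0] truncate_disc_eq[of 0 N] by simp

lemma truncate_disc_bound: "cmod (truncate_disc N z) \<le> real N"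
  using closest_point_in_set[of "cball (0::complex) (real N)" z] by (simp add: truncate_disc_def)

lemma truncate_disc_measurable [measurable]: "truncate_disc N \<in> borel_measurable borel"
  unfolding truncate_disc_def
  by (intro borel_measurable_continuous_onI continuous_on_closest_point) auto

lemma truncate_disc_tendsto: "(\<lambda>N. truncate_disc N z) \<longlonglongrightarrow> z"
proof (rule tendsto_eventually)
  obtain k :: nat where "cmod z < real k" using reals_Archimedean2 by blast
  then show "\<forall>\<^sub>F N in sequentially. truncate_disc N z = z"
    by (intro eventually_sequentiallyI[of k] truncate_disc_eq) auto
qed

context product_setting
begin

lemma q_atom_mult_integrable:
  assumes "q_atom q x r a" "1 < q"
  shows "integrable M (\<lambda>y. b y * a y)"
proof -
  obtain C where C: "0 < C" "\<And>x r a. q_atom q x r a \<Longrightarrow> integrable M (\<lambda>y. (b y - mb x r) * a y) \<and>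
    (LINT y|M. cmod ((b y - mb x r) * a y)) \<le> C" using q_atom_oscillation_integrable[OF assms(2)] by blast
  have "integrable M (\<lambda>y. (b y - mb x r) * a y + mb x r * a y)"
    using C(2) assms q_atom_L1(2)[OF assms] by (intro Bochner_Integration.integrable_add) auto
  then show ?thesis by (simp add: algebra_simps)
qed

lemma fun_distr_plus:
  assumes "integrable M f" "integrable M g" "\<phi> \<in> TC"
  shows "fun_distr M (\<lambda>y. f y + g y) \<phi> = fun_distr M f \<phi> + fun_distr M g \<phi>"
  using integrable_mult_test(1)[OF assms(1,3)] integrable_mult_test(1)[OF assms(2,3)]
  by (simp add: fun_distr_def distrib_right)

text \<open>Uniformity in \<open>N\<close> is the point: the Lipschitz property controls the
  oscillating part, and the truncated mean is no larger than the mean, whose pairing is already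
  bounded. Together with the coefficients this is the summable majorant for removing the
  truncation.\<close>

lemma truncated_pairing_bound:
  assumes q: "1 < q"
  shows "\<exists>C. \<forall>x r a \<phi> N. q_atom q x r a \<longrightarrow> \<phi> \<in> TC \<longrightarrow>
    cmod (fun_distr M (\<lambda>y. truncate_disc N (b y) * a y) \<phi>) \<le> C * TN \<phi>"
proof -
  obtain C1 where C1: "0 < C1" "\<And>x r a. q_atom q x r a \<Longrightarrow> integrable M (\<lambda>y. (b y - mb x r) * a y) \<and>
    (LINT y|M. cmod ((b y - mb x r) * a y)) \<le> C1" using q_atom_oscillation_integrable[OF q] by blast
  obtain C2 where C2: "0 < C2" "\<And>x r a \<phi>. q_atom q x r a \<Longrightarrow> \<phi> \<in> TC \<Longrightarrow>
    cmod (mb x r) * cmod (fun_distr M a \<phi>) \<le> C2 * TN \<phi>" using q_atom_mean_pairing[OF q] by blast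
  have "cmod (fun_distr M (\<lambda>y. truncate_disc N (b y) * a y) \<phi>) \<le> (C1 * (Q / V 1) + C2) * TN \<phi>"
    if a: "q_atom q x r a" and \<phi>: "\<phi> \<in> TC" for x r a \<phi> N
  proof -
    define g where "g y = (truncate_disc N (b y) - truncate_disc N (mb x r)) * a y" for y
    have [measurable]: "a \<in> borel_measurable M" using a by (simp add: q_atom_def)
    note ai = q_atom_L1(2)[OF a q]
    have gle: "cmod (g y) \<le> cmod ((b y - mb x r) * a y)" for y
      unfolding g_def norm_mult by (intro mult_right_mono truncate_disc_lipschitz) simp
    have C1a: "integrable M (\<lambda>y. (b y - mb x r) * a y)" "(LINT y|M. cmod ((b y - mb x r) * a y)) \<le> C1"
      using C1(2)[OF a] by auto
    have gi: "integrable M g"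
    proof (rule Bochner_Integration.integrable_bound[OF C1a(1)])
      show "g \<in> borel_measurable M" unfolding g_def by measurable
    qed (use gle in simp)
    have eq: "(\<lambda>y. truncate_disc N (b y) * a y) = (\<lambda>y. g y + truncate_disc N (mb x r) * a y)"
      by (auto simp: g_def algebra_simps)
    have "fun_distr M (\<lambda>y. truncate_disc N (b y) * a y) \<phi> = fun_distr M g \<phi> + truncate_disc N (mb x r) * fun_distr M a \<phi>"
      unfolding eq using gi ai \<phi> by (subst fun_distr_plus) (auto simp: fun_distr_const_mult)
    then have "cmod (fun_distr M (\<lambda>y. truncate_disc N (b y) * a y) \<phi>)
        \<le> cmod (fun_distr M g \<phi>) + cmod (truncate_disc N (mb x r)) * cmod (fun_distr M a \<phi>)"
      using norm_triangle_ineq[of "fun_distr M g \<phi>" "truncate_disc N (mb x r) * fun_distr M a \<phi>"]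
      by (simp add: norm_mult)
    also have "\<dots> \<le> C1 * (Q / V 1 * TN \<phi>) + C2 * TN \<phi>"
    proof (rule add_mono)
      have "0 \<le> Q / V 1 * TN \<phi>" using test_norm_TC_nonneg[OF \<phi>] Q_ge_1 V_pos[of 1] by simp
      moreover have "(LINT y|M. cmod (g y)) \<le> C1"
        using integral_mono[OF integrable_norm[OF gi] integrable_norm[OF C1a(1)] gle] C1a(2) by linarith
      ultimately have "(LINT y|M. cmod (g y)) * (Q / V 1 * TN \<phi>) \<le> C1 * (Q / V 1 * TN \<phi>)" by (rule mult_right_mono[rotated])
      then show "cmod (fun_distr M g \<phi>) \<le> C1 * (Q / V 1 * TN \<phi>)" using fun_distr_bound[OF gi \<phi>] by linarith
      have "cmod (truncate_disc N (mb x r)) * cmod (fun_distr M a \<phi>) \<le> cmod (mb x r) * cmod (fun_distr M a \<phi>)"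
        by (intro mult_right_mono truncate_disc_le) auto
      then show "cmod (truncate_disc N (mb x r)) * cmod (fun_distr M a \<phi>) \<le> C2 * TN \<phi>" using C2(2)[OF a \<phi>] by linarith
    qed
    finally show ?thesis by (simp add: distrib_right mult_ac)
  qed
  then show ?thesis by blast
qed

lemma atomic_data_L1:
  assumes "atomic_data q c a X R"
  shows "\<And>i. integrable M (\<lambda>y. c i * a i y)" "summable (\<lambda>i. LINT y|M. cmod (c i * a i y))"
proof -
  have q: "1 < q" and a: "\<And>i. q_atom q (X i) (R i) (a i)" and c: "summable (\<lambda>i. cmod (c i))"
    using assms by (auto simp: atomic_data_def)
  show "integrable M (\<lambda>y. c i * a i y)" for i using q_atom_L1(2)[OF a q] by simp
  show "summable (\<lambda>i. LINT y|M. cmod (c i * a i y))"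
  proof (rule summable_comparison_test'[OF summable_mult2[OF c, of 2], of 0])
    fix i
    have "0 \<le> (LINT y|M. cmod (a i y))" by (intro integral_nonneg_AE) auto
    then show "norm (LINT y|M. cmod (c i * a i y)) \<le> cmod (c i) * 2"
      using q_atom_LINT_norm_le[OF a q, of i] by (simp add: norm_mult abs_mult mult_left_mono)
  qed
qed

text \<open>The product is recovered from the \<open>L\<^sup>1\<close> sum of the atoms alone, so it does not depend on the
  decomposition: the truncations of \<open>b\<close> pair with the sum, and Tannery's theorem removes the truncation.\<close>

lemma product_as_truncated_limit:
  assumes A: "atomic_data q c a X R" and \<phi>: "\<phi> \<in> TC"
  shows "(\<lambda>N. LINT y|M. (\<Sum>i. c i * a i y) * (truncate_disc N (b y) * \<phi> y))
    \<longlonglongrightarrow> fun_distr M (regular_part c a X R) \<phi> + singular_part c a X R \<phi>"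
proof -
  have q: "1 < q" and a: "\<And>i. q_atom q (X i) (R i) (a i)" and c: "summable (\<lambda>i. cmod (c i))"
    using A by (auto simp: atomic_data_def)
  have [measurable]: "\<phi> \<in> borel_measurable M" by (rule test_closure_measurable[OF \<phi>])
  have [measurable]: "a i \<in> borel_measurable M" for i using a by (simp add: q_atom_def)
  define t where "t i N = c i * fun_distr M (\<lambda>y. truncate_disc N (b y) * a i y) \<phi>" for i N
  define l where "l i = c i * fun_distr M (\<lambda>y. b y * a i y) \<phi>" for i
  have sums: "(\<lambda>i. t i N) sums (LINT y|M. (\<Sum>i. c i * a i y) * (truncate_disc N (b y) * \<phi> y))" for N
  proof -
    have "(\<lambda>i. LINT y|M. (c i * a i y) * (truncate_disc N (b y) * \<phi> y))
        sums (LINT y|M. (\<Sum>i. c i * a i y) * (truncate_disc N (b y) * \<phi> y))"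
    proof (rule L1_series_mult[OF atomic_data_L1[OF A]])
      show "cmod (truncate_disc N (b y) * \<phi> y) \<le> real N * (Q / V 1 * TN \<phi>)" for y
        unfolding norm_mult by (intro mult_mono truncate_disc_bound test_closure_sup \<phi>) auto
    qed measurable
    moreover have "(LINT y|M. (c i * a i y) * (truncate_disc N (b y) * \<phi> y)) = t i N" for i
    proof -
      have "(\<lambda>y. (c i * a i y) * (truncate_disc N (b y) * \<phi> y)) = (\<lambda>y. c i * (truncate_disc N (b y) * a i y * \<phi> y))"
        by (simp add: mult_ac)
      then show ?thesis by (simp add: t_def fun_distr_def)
    qed
    ultimately show ?thesis by simp
  qed
  have lim: "(\<lambda>N. t i N) \<longlonglongrightarrow> l i" for i
    unfolding t_def l_def fun_distr_def
  proof (intro tendsto_mult tendsto_const integral_dominated_convergence[where w = "\<lambda>y. cmod (b y * a i y * \<phi> y)"])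
    show "integrable M (\<lambda>y. cmod (b y * a i y * \<phi> y))"
      by (intro integrable_norm integrable_mult_test(1)[OF q_atom_mult_integrable[OF a q] \<phi>])
    show "AE y in M. (\<lambda>N. truncate_disc N (b y) * a i y * \<phi> y) \<longlonglongrightarrow> b y * a i y * \<phi> y"
      by (intro AE_I2 tendsto_mult tendsto_const truncate_disc_tendsto)
    show "AE y in M. norm (truncate_disc N (b y) * a i y * \<phi> y) \<le> cmod (b y * a i y * \<phi> y)" for N
      unfolding norm_mult by (intro AE_I2 mult_right_mono truncate_disc_le) auto
  qed measurable
  obtain C where C: "\<And>x r a \<phi> N. q_atom q x r a \<Longrightarrow> \<phi> \<in> TC \<Longrightarrow>
    cmod (fun_distr M (\<lambda>y. truncate_disc N (b y) * a y) \<phi>) \<le> C * TN \<phi>" using truncated_pairing_bound[OF q] by blast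
  have bound: "norm (t i N) \<le> cmod (c i) * (C * TN \<phi>)" for i N
    unfolding t_def norm_mult by (intro mult_left_mono C[OF a \<phi>]) auto
  have "((\<lambda>N. \<Sum>i. t i N) \<longlongrightarrow> (\<Sum>i. l i)) sequentially"
  proof -
    have "eventually (\<lambda>(i, N). norm (t i N) \<le> cmod (c i) * (C * TN \<phi>)) (at_top \<times>\<^sub>F sequentially)"
      by (rule always_eventually) (use bound in auto)
    from tannerys_theorem[OF lim this summable_mult2[OF c]] show ?thesis by simp
  qed
  moreover have "(\<Sum>i. t i N) = (LINT y|M. (\<Sum>i. c i * a i y) * (truncate_disc N (b y) * \<phi> y))" for N
    using sums_unique[OF sums[of N]] by simp
  moreover have "(\<Sum>i. l i) = fun_distr M (regular_part c a X R) \<phi> + singular_part c a X R \<phi>"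
  proof -
    have r: "(\<lambda>i. fun_distr M (\<lambda>y. c i * (b y - mb (X i) (R i)) * a i y) \<phi>) sums fun_distr M (regular_part c a X R) \<phi>"
      using regular_part_distr_sums(1)[OF A] \<phi> by (simp add: distr_sums_def)
    have s: "(\<lambda>i. fun_distr M (\<lambda>y. c i * mb (X i) (R i) * a i y) \<phi>) sums singular_part c a X R \<phi>"
      using singular_part_distr_sums[OF A] \<phi> by (simp add: distr_sums_def)
    have "fun_distr M (\<lambda>y. c i * (b y - mb (X i) (R i)) * a i y) \<phi> + fun_distr M (\<lambda>y. c i * mb (X i) (R i) * a i y) \<phi> = l i" for i
    proof -
      have s: "integrable M (\<lambda>y. c i * mb (X i) (R i) * a i y)" using q_atom_L1(2)[OF a q] by simp
      have t: "integrable M (\<lambda>y. c i * (b y * a i y) - c i * mb (X i) (R i) * a i y)"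
        using s q_atom_mult_integrable[OF a q] by (intro Bochner_Integration.integrable_diff) auto
      have eq: "(\<lambda>y. c i * (b y - mb (X i) (R i)) * a i y) = (\<lambda>y. c i * (b y * a i y) - c i * mb (X i) (R i) * a i y)"
        by (auto simp: algebra_simps)
      show ?thesis unfolding l_def eq fun_distr_plus[OF t s \<phi>, symmetric]
        by (simp add: fun_distr_const_mult)
    qed
    then show ?thesis using sums_unique[OF sums_add[OF r s]] by simp
  qed
  ultimately show ?thesis by simp
qed

lemma product_unique:
  assumes A: "atomic_data q c a X R" and A': "atomic_data q' c' a' X' R'"
    and eq: "\<And>\<phi>. \<phi> \<in> TC \<Longrightarrow> fun_distr M (\<lambda>y. \<Sum>i. c i * a i y) \<phi> = fun_distr M (\<lambda>y. \<Sum>i. c' i * a' i y) \<phi>"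
    and \<phi>: "\<phi> \<in> TC"
  shows "fun_distr M (regular_part c a X R) \<phi> + singular_part c a X R \<phi>
    = fun_distr M (regular_part c' a' X' R') \<phi> + singular_part c' a' X' R' \<phi>"
proof -
  define f where "f = (\<lambda>y. \<Sum>i. c i * a i y)"
  define f' where "f' = (\<lambda>y. \<Sum>i. c' i * a' i y)"
  have f: "integrable M f" "integrable M f'"
    unfolding f_def f'_def
    using L1_series_distr_sums(2)[OF atomic_data_L1[OF A]] L1_series_distr_sums(2)[OF atomic_data_L1[OF A']] by auto
  have [measurable]: "f \<in> borel_measurable M" "f' \<in> borel_measurable M" "\<phi> \<in> borel_measurable M"
    using f test_closure_measurable[OF \<phi>] by auto
  have mf': "integrable M (\<lambda>y. - 1 * f' y)" using f(2) by (rule integrable_mult_right)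
  have "AE y in M. f y + - 1 * f' y = 0"
  proof (rule test_separation)
    show "integrable M (\<lambda>y. f y + - 1 * f' y)" using f(1) mf' by (rule Bochner_Integration.integrable_add)
    fix \<psi> assume \<psi>: "\<psi> \<in> TC"
    show "fun_distr M (\<lambda>y. f y + - 1 * f' y) \<psi> = 0"
      unfolding fun_distr_plus[OF f(1) mf' \<psi>] fun_distr_const_mult using eq[OF \<psi>] by (simp add: f_def f'_def)
  qed
  then have ae: "AE y in M. f y = f' y" by simp
  have "(LINT y|M. f y * (truncate_disc N (b y) * \<phi> y)) = (LINT y|M. f' y * (truncate_disc N (b y) * \<phi> y))" for N
  proof (rule integral_cong_AE)
    show "AE y in M. f y * (truncate_disc N (b y) * \<phi> y) = f' y * (truncate_disc N (b y) * \<phi> y)"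
      using ae by eventually_elim simp
  qed measurable
  then show ?thesis
    using product_as_truncated_limit[OF A \<phi>] product_as_truncated_limit[OF A' \<phi>]
    unfolding f_def f'_def by (auto intro: LIMSEQ_unique)
qed

section \<open>Membership in the Hardy-Orlicz space\<close>

text \<open>The means over balls at \<open>x0\<close> grow at most logarithmically, so the integral
  of \<open>exp (c * cmod (b y))\<close> over such a ball exceeds its volume by at most a power
  \<open>R powr \<eta>\<close>; the decay \<open>\<eta> + 1\<close> in \<open>w\<close> makes it
  integrable. The lower bound on \<open>ln (w y)\<close> says that \<open>w\<close> decays only
  polynomially, which \<open>wp_product_bound\<close> trades for the logarithmic density of the
  target measure.\<close>

lemma exponential_weight:
  defines c: "c \<equiv> jn_exp"
  shows "\<exists>w \<in> borel_measurable M. (\<forall>y. 0 < w y) \<and> (\<exists>N\<ge>0. \<forall>y. - N * ln (exp 1 + d x0 y) \<le> ln (w y)) \<and>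
    (\<integral>\<^sup>+y. ennreal (exp (c * cmod (b y))) * ennreal (w y) \<partial>M) < \<infinity>"
proof -
  obtain Cm where Cm: "0 < Cm" "\<And>x r s. 0 < r \<Longrightarrow> r \<le> s \<Longrightarrow> 1 \<le> s \<Longrightarrow> d x0 x \<le> s \<Longrightarrow>
    cmod (mb x r) \<le> Cm * (1 + ln (s / r) + ln s)" using mean_growth by blast
  have c0: "0 < c" using c jn_exp_pos by simp
  define \<eta> where "\<eta> = c * Cm"
  have \<eta>: "0 < \<eta>" using c0 Cm by (simp add: \<eta>_def)
  define g where "g = \<eta> + 1"
  define w where "w y = (1 / (1 + d x0 y)) powr g / V (1 + d x0 y)" for y
  have D1: "0 < 1 + d x0 y" "1 \<le> 1 + d x0 y" for y using dist_nonneg[of x0 y] by auto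
  \<comment> \<open>The maximum extends \<open>V\<close>, known to be monotone on positive radii, to
    a monotone function on the whole line.\<close>
  have "(\<lambda>t. V (1 + max 0 t)) \<in> borel_measurable borel"
    by (intro borel_measurable_mono monoI V_mono) auto
  then have "(\<lambda>y. V (1 + max 0 (d x0 y))) \<in> borel_measurable M" by (rule measurable_compose_rev) measurable
  then have Vm[measurable]: "(\<lambda>y. V (1 + d x0 y)) \<in> borel_measurable M" by (simp add: dist_nonneg max_def)
  have wm[measurable]: "w \<in> borel_measurable M" unfolding w_def by measurable
  have w0: "0 < w y" for y using D1 V_pos[OF D1(1)] by (simp add: w_def less_imp_neq[symmetric])
  \<comment> \<open>One term for each factor of \<open>w\<close>: the power \<open>g\<close>, the
    growth exponent \<open>n\<close> of the volume, and the constant of that growth, which is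
    multiplied by \<open>ln (exp 1 + D) \<ge> 1\<close>.\<close>
  define N where "N = g + n + \<bar>ln (Q * V 1)\<bar>"
  have N: "0 \<le> N" using \<eta> n_nonneg by (simp add: N_def g_def)
  have lw: "- N * ln (exp 1 + d x0 y) \<le> ln (w y)" for y
  proof -
    define D where "D = d x0 y"
    have D: "0 \<le> D" "0 < 1 + D" by (auto simp: D_def dist_nonneg add_pos_nonneg)
    have QV: "0 < Q * V 1" using Q_ge_1 V_pos[of 1] by simp
    have "V (1 + D) \<le> Q * ((1 + D) / 1) powr n * V 1" using D by (intro V_growth) auto
    then have "V (1 + D) \<le> (Q * V 1) * (1 + D) powr n" by (simp add: mult_ac)
    then have "ln (V (1 + D)) \<le> ln ((Q * V 1) * (1 + D) powr n)" using V_pos[OF D(2)] by (intro ln_mono)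
    also have "\<dots> = ln (Q * V 1) + n * ln (1 + D)" using QV D by (subst ln_mult_pos) (auto simp: ln_powr)
    finally have lV: "ln (V (1 + D)) \<le> ln (Q * V 1) + n * ln (1 + D)" .
    have lnw: "ln (w y) = - g * ln (1 + D) - ln (V (1 + D))"
      using D V_pos[OF D(2)] by (simp add: w_def D_def[symmetric] ln_div ln_powr)
    have l1: "1 \<le> ln (exp 1 + D)" by (rule ln_exp_ge_1[OF D(1)])
    have "1 + D \<le> exp 1 + D" using exp_ge_add_one_self[of "1::real"] by linarith
    then have l2: "ln (1 + D) \<le> ln (exp 1 + D)" using D by (intro ln_mono)
    have "(g + n) * ln (1 + D) \<le> (g + n) * ln (exp 1 + D)" using l2 \<eta> n_nonneg by (intro mult_left_mono) (auto simp: g_def)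
    moreover have "ln (Q * V 1) \<le> \<bar>ln (Q * V 1)\<bar> * ln (exp 1 + D)"
      using mult_left_mono[OF l1, of "\<bar>ln (Q * V 1)\<bar>"] by simp
    ultimately show ?thesis using lV lnw unfolding N_def D_def[symmetric] by (simp add: algebra_simps)
  qed
  define s where "s = 7 * exp (c * Cm) * Q"
  define \<nu> where "\<nu> = density M (\<lambda>y. ennreal (exp (c * cmod (b y))))"
  have "(\<integral>\<^sup>+y. ennreal (w y) \<partial>\<nu>) \<le> ennreal (Q * 2 powr (g + n) / (1 - 2 powr (\<eta> - g)) * s * 1)"
  proof (rule annuli_integral[where x = x0 and \<rho> = 1])
    fix R :: real assume R: "1 \<le> R"
    then have R0: "0 < R" by simp
    have "cmod (mb x0 R) \<le> Cm * (1 + ln (R / R) + ln R)" using R by (intro Cm(2)) auto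
    then have m: "cmod (mb x0 R) \<le> Cm * (1 + ln R)" using R by simp
    have "emeasure \<nu> (ball x0 R) = (\<integral>\<^sup>+y\<in>ball x0 R. ennreal (exp (c * cmod (b y))) \<partial>M)"
      unfolding \<nu>_def by (rule emeasure_density) auto
    also have "\<dots> \<le> (\<integral>\<^sup>+y. ennreal (exp (c * Cm) * R powr \<eta>) *
        (ennreal (exp (jn_exp * cmod (b y - mb x0 R))) * indicator (ball x0 R) y) \<partial>M)"
    proof (rule nn_integral_mono)
      fix y
      have "cmod (b y) \<le> cmod (b y - mb x0 R) + cmod (mb x0 R)" using norm_triangle_ineq[of "b y - mb x0 R" "mb x0 R"] by simp
      then have "c * cmod (b y) \<le> c * (cmod (b y - mb x0 R) + Cm * (1 + ln R))" using m c0 by (intro mult_left_mono) auto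
      also have "\<dots> = c * Cm + \<eta> * ln R + c * cmod (b y - mb x0 R)" by (simp add: \<eta>_def algebra_simps)
      finally have "exp (c * cmod (b y)) \<le> exp (c * Cm + \<eta> * ln R + c * cmod (b y - mb x0 R))" by simp
      also have "\<dots> = exp (c * Cm) * R powr \<eta> * exp (c * cmod (b y - mb x0 R))"
        using R0 by (simp add: exp_add powr_def)
      finally show "ennreal (exp (c * cmod (b y))) * indicator (ball x0 R) y \<le> ennreal (exp (c * Cm) * R powr \<eta>) *
        (ennreal (exp (jn_exp * cmod (b y - mb x0 R))) * indicator (ball x0 R) y)"
        by (cases "y \<in> ball x0 R") (auto simp: ennreal_mult[symmetric] c ennreal_leI)
    qed
    also have "\<dots> = ennreal (exp (c * Cm) * R powr \<eta>) *
        (\<integral>\<^sup>+y\<in>ball x0 R. ennreal (exp (jn_exp * cmod (b y - mb x0 R))) \<partial>M)"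
      by (rule nn_integral_cmult) measurable
    also have "\<dots> \<le> ennreal (exp (c * Cm) * R powr \<eta>) * (7 * emeasure M (ball x0 R))"
      by (intro mult_left_mono exp_integrability R0) auto
    also have "\<dots> = ennreal (exp (c * Cm) * R powr \<eta> * (7 * measure M (ball x0 R)))"
      using R0 by (simp add: emeasure_ball ennreal_mult)
    also have "\<dots> \<le> ennreal (exp (c * Cm) * R powr \<eta> * (7 * (Q * V R)))"
      using measure_le_V[OF R0, of x0] by (intro ennreal_leI mult_left_mono) auto
    also have "exp (c * Cm) * R powr \<eta> * (7 * (Q * V R)) = s * (R / 1) powr \<eta> * V R" by (simp add: s_def)
    finally show "emeasure \<nu> (ball x0 R) \<le> ennreal (s * (R / 1) powr \<eta> * V R)" .
  qed (use \<eta> Q_ge_1 in \<open>auto simp: \<nu>_def g_def w_def s_def\<close>)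
  also have "\<dots> < \<infinity>" by simp
  also have "(\<integral>\<^sup>+y. ennreal (w y) \<partial>\<nu>) = (\<integral>\<^sup>+y. ennreal (exp (c * cmod (b y))) * ennreal (w y) \<partial>M)"
    unfolding \<nu>_def by (rule nn_integral_density) measurable
  finally show ?thesis using wm w0 N lw by blast
qed

text \<open>Subadditivity separates \<open>H\<close>, on which the Orlicz function is at most the
  identity. In the product, \<open>c\<close> is moved from one factor to the other so that the
  exponent becomes \<open>c * u\<close>, the exponentially integrable one.\<close>

lemma wp_weighted_bound:
  assumes F: "F \<le> ennreal u * G + H" and u: "0 \<le> (u::real)" and c: "0 < (c::real)"
    and w: "0 < w" and l: "1 \<le> l" and N: "0 \<le> N" and lw: "- N * l \<le> ln w"
  shows "ennreal (1 / l) * orlicz_wp F \<le> H + ennreal ((2 + 2 * N) / c) * G + ennreal (2 + 2 * N) * (ennreal (exp (c * u)) * ennreal w)"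
proof (cases "G = \<infinity> \<or> H = \<infinity>")
  case True
  have "0 < (2 + 2 * N) / c" using N c by simp
  then have "ennreal ((2 + 2 * N) / c) \<noteq> 0" by (simp only: ennreal_eq_0_iff not_le)
  then have *: "H + ennreal ((2 + 2 * N) / c) * G = \<infinity>" using True by (auto simp: ennreal_mult_top)
  show ?thesis unfolding * by simp
next
  case False
  then obtain t h where th: "G = ennreal t" "0 \<le> t" "H = ennreal h" "0 \<le> h" by (cases G; cases H) auto
  then have F': "F \<le> ennreal (u * t + h)" using F u by (simp add: ennreal_mult)
  then obtain f where f: "F = ennreal f" "0 \<le> f" by (cases F) (auto simp: top_unique)
  have ut: "0 \<le> u * t" using u th by simp
  then have "0 \<le> u * t + h" using th by simp
  then have fle: "f \<le> u * t + h" using F' by (simp only: f(1) ennreal_le_iff)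
  have "f / ln (exp 1 + f) \<le> (u * t + h) / ln (exp 1 + (u * t + h))" by (rule wp_mono[OF f(2) fle])
  also have "\<dots> \<le> u * t / ln (exp 1 + u * t) + h / ln (exp 1 + h)" by (rule wp_subadditive[OF ut th(4)])
  also have "h / ln (exp 1 + h) \<le> h / 1" using ln_exp_ge_1[OF th(4)] th(4) by (intro divide_left_mono) auto
  finally have "f / ln (exp 1 + f) \<le> u * t / ln (exp 1 + u * t) + h" by simp
  then have "f / ln (exp 1 + f) / l \<le> (u * t / ln (exp 1 + u * t) + h) / l" using l by (intro divide_right_mono) auto
  also have "\<dots> = (c * u * (t / c)) / ln (exp 1 + c * u * (t / c)) / l + h / l" using c by (simp add: add_divide_distrib)
  also have "\<dots> \<le> (2 + 2 * N) * (t / c + exp (c * u) * w) + h"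
  proof (rule add_mono)
    show "(c * u * (t / c)) / ln (exp 1 + c * u * (t / c)) / l \<le> (2 + 2 * N) * (t / c + exp (c * u) * w)"
      using u c th by (intro wp_product_bound w l N lw) auto
    show "h / l \<le> h" using l th divide_left_mono[of 1 l h] by simp
  qed
  also have "\<dots> = h + (2 + 2 * N) / c * t + (2 + 2 * N) * (exp (c * u) * w)"
    by (simp only: distrib_left[of "2 + 2 * N"] times_divide_eq_right times_divide_eq_left add_ac)
  finally have real: "(1 / l) * (f / ln (exp 1 + f)) \<le> h + (2 + 2 * N) / c * t + (2 + 2 * N) * (exp (c * u) * w)"
    by (simp only: times_divide_eq_left mult_1)
  have "ennreal (1 / l) * orlicz_wp F = ennreal ((1 / l) * (f / ln (exp 1 + f)))"
    using l f ln_exp_ge_1[OF f(2)] by (simp add: orlicz_wp_def ennreal_mult'[symmetric])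
  also have "\<dots> \<le> ennreal (h + (2 + 2 * N) / c * t + (2 + 2 * N) * (exp (c * u) * w))" by (rule ennreal_leI[OF real])
  also have "\<dots> = ennreal h + ennreal ((2 + 2 * N) / c) * ennreal t + ennreal (2 + 2 * N) * (ennreal (exp (c * u)) * ennreal w)"
  proof -
    have nn: "0 \<le> (2 + 2 * N) / c" "0 \<le> 2 + 2 * N" "0 \<le> exp (c * u)" "0 \<le> w" using N c w by auto
    show ?thesis
      using nn th by (simp only: ennreal_mult ennreal_plus mult_nonneg_nonneg add_nonneg_nonneg)
  qed
  finally show ?thesis by (simp only: th)
qed

text \<open>Each mean is replaced by the value of \<open>b\<close> at the point where the maximal
  function is evaluated; the error is the oscillation already controlled by
  \<open>q_atom_maximal_L1\<close>.\<close>

lemma singular_part_maximal: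
  assumes A: "atomic_data q c a X R"
  shows "GM (singular_part c a X R) y \<le>
    ennreal (cmod (b y)) * (\<Sum>i. ennreal (cmod (c i)) * GM (fun_distr M (a i)) y)
    + (\<Sum>i. ennreal (cmod (c i)) * (ennreal (cmod (b y - mb (X i) (R i))) * GM (fun_distr M (a i)) y))"
proof (rule grand_maximal_le)
  fix \<phi> r assume \<phi>: "\<phi> \<in> TC" and r: "0 < r" "tb y r \<beta> \<gamma> \<phi> 1"
  note s = singular_part_summable[OF A \<phi>]
  have "ennreal (cmod (singular_part c a X R \<phi>)) \<le> ennreal (\<Sum>i. cmod (c i * mb (X i) (R i) * fun_distr M (a i) \<phi>))"
    unfolding singular_part_def by (intro ennreal_leI summable_norm s)
  also have "\<dots> = (\<Sum>i. ennreal (cmod (c i * mb (X i) (R i) * fun_distr M (a i) \<phi>)))"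
    by (rule suminf_ennreal2[symmetric]) (use s in auto)
  also have "\<dots> \<le> (\<Sum>i. ennreal (cmod (b y)) * (ennreal (cmod (c i)) * GM (fun_distr M (a i)) y)
      + ennreal (cmod (c i)) * (ennreal (cmod (b y - mb (X i) (R i))) * GM (fun_distr M (a i)) y))"
  proof (intro suminf_le)
    fix i
    have G: "ennreal (cmod (fun_distr M (a i) \<phi>)) \<le> GM (fun_distr M (a i)) y" by (rule grand_maximal_upper[OF \<phi> r])
    have "cmod (mb (X i) (R i)) \<le> cmod (b y) + cmod (b y - mb (X i) (R i))"
      using norm_triangle_ineq4[of "b y" "b y - mb (X i) (R i)"] by simp
    then have m: "ennreal (cmod (mb (X i) (R i))) \<le> ennreal (cmod (b y)) + ennreal (cmod (b y - mb (X i) (R i)))"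
      by (simp add: ennreal_plus[symmetric] ennreal_leI del: ennreal_plus)
    have "ennreal (cmod (c i * mb (X i) (R i) * fun_distr M (a i) \<phi>))
      = ennreal (cmod (c i)) * (ennreal (cmod (mb (X i) (R i))) * ennreal (cmod (fun_distr M (a i) \<phi>)))"
      by (simp add: norm_mult ennreal_mult mult.assoc)
    also have "\<dots> \<le> ennreal (cmod (c i)) * ((ennreal (cmod (b y)) + ennreal (cmod (b y - mb (X i) (R i)))) * GM (fun_distr M (a i)) y)"
      by (intro mult_left_mono mult_mono m G) auto
    also have "\<dots> = ennreal (cmod (b y)) * (ennreal (cmod (c i)) * GM (fun_distr M (a i)) y)
      + ennreal (cmod (c i)) * (ennreal (cmod (b y - mb (X i) (R i))) * GM (fun_distr M (a i)) y)"
      by (simp add: algebra_simps)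
    finally show "ennreal (cmod (c i * mb (X i) (R i) * fun_distr M (a i) \<phi>)) \<le>
      ennreal (cmod (b y)) * (ennreal (cmod (c i)) * GM (fun_distr M (a i)) y)
      + ennreal (cmod (c i)) * (ennreal (cmod (b y - mb (X i) (R i))) * GM (fun_distr M (a i)) y)" .
  qed auto
  also have "\<dots> = ennreal (cmod (b y)) * (\<Sum>i. ennreal (cmod (c i)) * GM (fun_distr M (a i)) y)
    + (\<Sum>i. ennreal (cmod (c i)) * (ennreal (cmod (b y - mb (X i) (R i))) * GM (fun_distr M (a i)) y))"
    by (subst suminf_add[symmetric]) auto
  finally show "ennreal (cmod (singular_part c a X R \<phi>)) \<le> \<dots>" .
qed

lemma singular_part_hardy_orlicz:
  assumes A: "atomic_data q c a X R"
  shows "singular_part c a X R \<in> hardy_orlicz d M K x0 \<epsilon> \<beta> \<gamma> (log_weighted d M x0)"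
proof -
  have q: "1 < q" and a: "\<And>i. q_atom q (X i) (R i) (a i)" and c: "summable (\<lambda>i. cmod (c i))"
    using A by (auto simp: atomic_data_def)
  obtain C where C: "0 < C" "\<And>x r a. q_atom q x r a \<Longrightarrow>
    (\<integral>\<^sup>+y. ennreal (1 + cmod (b y - mb x r)) * GM (fun_distr M a) y \<partial>M) \<le> ennreal C"
    using q_atom_maximal_L1[OF q] by blast
  obtain w N where w[measurable]: "w \<in> borel_measurable M" and w0: "\<And>y. 0 < w y" and N: "0 \<le> N"
    "\<And>y. - N * ln (exp 1 + d x0 y) \<le> ln (w y)"
    and wi: "(\<integral>\<^sup>+y. ennreal (exp (jn_exp * cmod (b y))) * ennreal (w y) \<partial>M) < \<infinity>"
    using exponential_weight by blast
  note D = singular_part_distribution[OF A]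
  have Gm[measurable]: "GM (fun_distr M (a i)) \<in> borel_measurable M" for i
    by (rule grand_maximal_measurable[OF q_atom_distribution[OF a q]])
  define G where "G y = (\<Sum>i. ennreal (cmod (c i)) * GM (fun_distr M (a i)) y)" for y
  define H where "H y = (\<Sum>i. ennreal (cmod (c i)) * (ennreal (cmod (b y - mb (X i) (R i))) * GM (fun_distr M (a i)) y))" for y
  have [measurable]: "G \<in> borel_measurable M" "H \<in> borel_measurable M" unfolding G_def H_def by measurable
  \<comment> \<open>Applied with 1 and with the oscillation in place of \<open>f\<close>; both lie
    below the single weight \<open>1 + cmod (b y - mb (X i) (R i))\<close>.\<close>
  have fin: "(\<integral>\<^sup>+y. (\<Sum>i. ennreal (cmod (c i)) * (f i y * GM (fun_distr M (a i)) y)) \<partial>M) < \<infinity>"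
    if f[measurable]: "\<And>i. f i \<in> borel_measurable M" and fle: "\<And>i y. f i y \<le> ennreal (1 + cmod (b y - mb (X i) (R i)))" for f
  proof -
    have "(\<integral>\<^sup>+y. (\<Sum>i. ennreal (cmod (c i)) * (f i y * GM (fun_distr M (a i)) y)) \<partial>M)
      = (\<Sum>i. ennreal (cmod (c i)) * (\<integral>\<^sup>+y. f i y * GM (fun_distr M (a i)) y \<partial>M))"
      by (subst nn_integral_suminf) (auto simp: nn_integral_cmult)
    also have "\<dots> \<le> (\<Sum>i. ennreal (cmod (c i)) * ennreal C)"
    proof (intro suminf_le mult_left_mono)
      fix i
      have "(\<integral>\<^sup>+y. f i y * GM (fun_distr M (a i)) y \<partial>M)
        \<le> (\<integral>\<^sup>+y. ennreal (1 + cmod (b y - mb (X i) (R i))) * GM (fun_distr M (a i)) y \<partial>M)"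
        by (intro nn_integral_mono mult_right_mono fle) auto
      then show "(\<integral>\<^sup>+y. f i y * GM (fun_distr M (a i)) y \<partial>M) \<le> ennreal C" using C(2)[OF a] by (rule order_trans)
    qed auto
    also have "\<dots> = (\<Sum>i. ennreal (cmod (c i) * C))" using C by (simp add: ennreal_mult)
    also have "\<dots> = ennreal (\<Sum>i. cmod (c i) * C)" using C by (intro suminf_ennreal2 summable_mult2 c) auto
    also have "\<dots> < \<infinity>" by simp
    finally show ?thesis .
  qed
  have Gfin: "(\<integral>\<^sup>+y. G y \<partial>M) < \<infinity>"
    using fin[of "\<lambda>i y. 1"] by (simp add: G_def)
  have Hfin: "(\<integral>\<^sup>+y. H y \<partial>M) < \<infinity>"
    unfolding H_def by (rule fin) (auto intro: ennreal_leI)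
  define F where "F = GM (singular_part c a X R)"
  have Fm[measurable]: "F \<in> borel_measurable M" unfolding F_def by (rule grand_maximal_measurable[OF D])
  have wpm[measurable]: "(\<lambda>y. orlicz_wp (F y)) \<in> borel_measurable M" unfolding orlicz_wp_def by measurable
  have "(\<integral>\<^sup>+y. orlicz_wp (F y) \<partial>log_weighted d M x0) = (\<integral>\<^sup>+y. ennreal (1 / ln (exp 1 + d x0 y)) * orlicz_wp (F y) \<partial>M)"
    unfolding log_weighted_def by (rule nn_integral_density) measurable
  also have "\<dots> \<le> (\<integral>\<^sup>+y. H y + ennreal ((2 + 2 * N) / jn_exp) * G y
      + ennreal (2 + 2 * N) * (ennreal (exp (jn_exp * cmod (b y))) * ennreal (w y)) \<partial>M)"
    unfolding F_def G_def H_def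
    by (intro nn_integral_mono wp_weighted_bound singular_part_maximal[OF A] jn_exp_pos w0 N ln_exp_ge_1 dist_nonneg) simp
  also have "\<dots> = (\<integral>\<^sup>+y. H y \<partial>M) + ennreal ((2 + 2 * N) / jn_exp) * (\<integral>\<^sup>+y. G y \<partial>M)
      + ennreal (2 + 2 * N) * (\<integral>\<^sup>+y. ennreal (exp (jn_exp * cmod (b y))) * ennreal (w y) \<partial>M)"
    by (simp add: nn_integral_add nn_integral_cmult)
  also have "\<dots> < \<infinity>" using Gfin Hfin wi by (simp add: ennreal_mult_less_top ennreal_add_less_top)
  finally have "(\<integral>\<^sup>+y. orlicz_wp (F y) \<partial>log_weighted d M x0) < \<infinity>" .
  moreover have "F \<in> borel_measurable (log_weighted d M x0)" by (simp add: log_weighted_def)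
  ultimately have "F \<in> orlicz_space (log_weighted d M x0)"
    unfolding orlicz_space_def using orlicz_norm_finite by blast
  then show ?thesis using D by (simp add: hardy_orlicz_def F_def)
qed

lemma product_L1_plus_hardy_orlicz:
  assumes A: "atomic_data q c a X R"
  defines "P \<equiv> \<lambda>\<phi>. fun_distr M (regular_part c a X R) \<phi> + singular_part c a X R \<phi>"
  shows "P \<in> DD" "P \<in> L1_plus_hardy_orlicz d M K x0 \<epsilon> \<beta> \<gamma> (log_weighted d M x0)"
proof -
  have g: "integrable M (regular_part c a X R)" by (rule regular_part_distr_sums(2)[OF A])
  have 1: "fun_distr M (regular_part c a X R) \<in> DD" "acts_as_distribution d M K x0 \<epsilon> \<beta> \<gamma> (regular_part c a X R)"
    using integrable_acts_as_distribution[OF g] by (auto simp: acts_as_distribution_def)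
  have 2: "singular_part c a X R \<in> DD" by (rule singular_part_distribution[OF A])
  obtain C1 where C1: "\<And>\<phi>. \<phi> \<in> TC \<Longrightarrow> cmod (fun_distr M (regular_part c a X R) \<phi>) \<le> C1 * TN \<phi>"
    using distribution_bound[OF 1(1)] by blast
  obtain C2 where C2: "\<And>\<phi>. \<phi> \<in> TC \<Longrightarrow> cmod (singular_part c a X R \<phi>) \<le> C2 * TN \<phi>"
    using distribution_bound[OF 2] by blast
  show P: "P \<in> DD"
  proof (rule distributionI[of _ "C1 + C2"])
    fix \<phi> assume "\<phi> \<in> TC"
    then show "cmod (P \<phi>) \<le> (C1 + C2) * TN \<phi>"
      using norm_triangle_ineq[of "fun_distr M (regular_part c a X R) \<phi>" "singular_part c a X R \<phi>"] C1[of \<phi>] C2[of \<phi>]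
      by (simp add: P_def distrib_right)
  qed (use distribution_add[OF 1(1)] distribution_add[OF 2] distribution_cmult[OF 1(1)] distribution_cmult[OF 2]
      in \<open>auto simp: P_def distrib_left\<close>)
  show "P \<in> L1_plus_hardy_orlicz d M K x0 \<epsilon> \<beta> \<gamma> (log_weighted d M x0)"
    unfolding L1_plus_hardy_orlicz_def
    using P g 1 singular_part_hardy_orlicz[OF A] by (auto simp: P_def)
qed

section \<open>From atomic decompositions to the product\<close>

lemma decomposition_data:
  assumes q: "1 < q" and dec: "atomic_decomposition d M K x0 \<epsilon> \<beta> \<gamma> q c a B h"
  shows "\<exists>q' X R. atomic_data q' c a X R \<and> B = (\<lambda>i. ball (X i) (R i))"
proof -
  have B: "\<And>i. B i \<in> qballs d" "\<And>i. atom M q (B i) (a i)" and c: "summable (\<lambda>i. cmod (c i))"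
    using dec by (auto simp: atomic_decomposition_def)
  from B(1) have "\<exists>x r. B i = ball x r \<and> 0 < r" for i by (auto simp: qballs_def)
  then obtain X R where XR: "\<And>i. B i = ball (X i) (R i)" "\<And>i. 0 < R i" by metis
  define q' where "q' = (if q = \<infinity> then 2 else real_of_ereal q)"
  have "1 < q'" using q by (cases q) (auto simp: q'_def)
  moreover have "q_atom q' (X i) (R i) (a i)" for i
    unfolding q'_def using atom_imp_q_atom[OF _ q XR(2)[of i], of "X i" "a i"] B(2)[of i] by (simp add: XR(1))
  ultimately have "atomic_data q' c a X R" using c by (simp add: atomic_data_def)
  then show ?thesis using XR(1) by blast
qed

lemma decomposition_sum:
  assumes A: "atomic_data q' c a X R" and dec: "atomic_decomposition d M K x0 \<epsilon> \<beta> \<gamma> q c a B h" and \<phi>: "\<phi> \<in> TC"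
  shows "fun_distr M (\<lambda>y. \<Sum>i. c i * a i y) \<phi> = h \<phi>"
proof -
  have "(\<lambda>i. fun_distr M (\<lambda>y. c i * a i y) \<phi>) sums h \<phi>"
    using dec \<phi> by (simp add: atomic_decomposition_def distr_sums_def)
  moreover have "(\<lambda>i. fun_distr M (\<lambda>y. c i * a i y) \<phi>) sums fun_distr M (\<lambda>y. \<Sum>i. c i * a i y) \<phi>"
    using L1_series_distr_sums(1)[OF atomic_data_L1[OF A]] \<phi> by (simp add: distr_sums_def)
  ultimately show ?thesis by (rule sums_unique2[symmetric])
qed

lemma trivial_atomic_data: "atomic_data 2 (\<lambda>i. 0) (\<lambda>i y. 0) (\<lambda>i. x0) (\<lambda>i. 1)"
  by (simp add: atomic_data_def q_atom_def)

text \<open>If \<open>h\<close> has no atomic decomposition, the requirement on the product is vacuous and the product of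
  the zero series serves.\<close>

lemma product_exists:
  "\<exists>P. is_product d M K x0 \<epsilon> \<beta> \<gamma> b h P \<and> P \<in> L1_plus_hardy_orlicz d M K x0 \<epsilon> \<beta> \<gamma> (log_weighted d M x0)"
proof -
  \<comment> \<open>One reference series is fixed, so that \<open>P\<close> is the same functional
    for all decompositions of \<open>h\<close>, whatever their exponents.\<close>
  have "\<exists>q c a X R. atomic_data q c a X R \<and> (\<forall>q' c' a' B'. 1 < q' \<longrightarrow>
      atomic_decomposition d M K x0 \<epsilon> \<beta> \<gamma> q' c' a' B' h \<longrightarrow> (\<forall>\<phi>\<in>TC. fun_distr M (\<lambda>y. \<Sum>i. c i * a i y) \<phi> = h \<phi>))"
  proof (cases "\<exists>q c a B. 1 < q \<and> atomic_decomposition d M K x0 \<epsilon> \<beta> \<gamma> q c a B h")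
    case True
    then obtain q c a B where dec: "1 < q" "atomic_decomposition d M K x0 \<epsilon> \<beta> \<gamma> q c a B h" by blast
    then obtain q' X R where A: "atomic_data q' c a X R" using decomposition_data by blast
    show ?thesis using A decomposition_sum[OF A dec(2)] by blast
  next
    case False
    then show ?thesis using trivial_atomic_data by blast
  qed
  then obtain q c a X R where A: "atomic_data q c a X R" and
    h: "\<And>q' c' a' B' \<phi>. 1 < q' \<Longrightarrow> atomic_decomposition d M K x0 \<epsilon> \<beta> \<gamma> q' c' a' B' h \<Longrightarrow> \<phi> \<in> TC \<Longrightarrow>
      fun_distr M (\<lambda>y. \<Sum>i. c i * a i y) \<phi> = h \<phi>" by blast
  define P where "P = (\<lambda>\<phi>. fun_distr M (regular_part c a X R) \<phi> + singular_part c a X R \<phi>)"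
  have "is_product d M K x0 \<epsilon> \<beta> \<gamma> b h P"
    unfolding is_product_def
  proof (intro conjI allI impI)
    show "P \<in> DD" unfolding P_def by (rule product_L1_plus_hardy_orlicz(1)[OF A])
    fix q' c' a' B' assume dec: "1 < q'" "atomic_decomposition d M K x0 \<epsilon> \<beta> \<gamma> q' c' a' B' h"
    obtain q'' X' R' where A': "atomic_data q'' c' a' X' R'" and B': "B' = (\<lambda>i. ball (X' i) (R' i))"
      using decomposition_data[OF dec] by blast
    have m: "mean M (B' i) b = mb (X' i) (R' i)" for i by (simp add: mb_def B')
    show "\<exists>S\<^sub>1 S\<^sub>2. distr_sums d M K x0 \<epsilon> \<beta> \<gamma> (\<lambda>i x. c' i * (b x - mean M (B' i) b) * a' i x) S\<^sub>1 \<and>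
        distr_sums d M K x0 \<epsilon> \<beta> \<gamma> (\<lambda>i x. c' i * mean M (B' i) b * a' i x) S\<^sub>2 \<and>
        (\<forall>\<phi>\<in>TC. P \<phi> = S\<^sub>1 \<phi> + S\<^sub>2 \<phi>)"
      unfolding m P_def
      using regular_part_distr_sums(1)[OF A'] singular_part_distr_sums[OF A']
        product_unique[OF A A'] h[OF dec] decomposition_sum[OF A' dec(2)]
      by (intro exI[of _ "fun_distr M (regular_part c' a' X' R')"] exI[of _ "singular_part c' a' X' R'"]) simp
  qed
  then show ?thesis using product_L1_plus_hardy_orlicz(2)[OF A] unfolding P_def by blast
qed

end

text \<open>Adding 1 keeps the constant positive also for constant functions, whose seminorm is
  0.\<close>

lemma (in hom_space) BMO_bmo_function:
  assumes "b \<in> BMO d M"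
  shows "\<exists>L. bmo_function d M K \<theta> A Q \<kappa> n V b L"
proof -
  have int: "\<And>B. B \<in> qballs d \<Longrightarrow> set_integrable M B b" and fin: "BMO_norm d M b < \<infinity>"
    using assms by (auto simp: BMO_def)
  obtain L0 where L0: "BMO_norm d M b = ennreal L0" "0 \<le> L0" using fin by (cases "BMO_norm d M b") auto
  have qb: "ball x r \<in> qballs d" if "0 < r" for x r using that by (auto simp: qballs_def)
  have "bmo_function d M K \<theta> A Q \<kappa> n V b (L0 + 1)"
  proof (intro bmo_function.intro hom_space_axioms bmo_function_axioms.intro)
    fix r :: real and x assume r: "0 < r"
    show "set_integrable M (ball x r) b" by (rule int[OF qb[OF r]])
    have "ennreal ((LINT y:ball x r|M. cmod (b y - mean M (ball x r) b)) / measure M (ball x r)) \<le> BMO_norm d M b"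
      unfolding BMO_norm_def by (rule SUP_upper[OF qb[OF r]])
    then have "(LINT y:ball x r|M. cmod (b y - mean M (ball x r) b)) / measure M (ball x r) \<le> L0"
      using L0 by (simp add: ennreal_le_iff)
    then have "(LINT y:ball x r|M. cmod (b y - mean M (ball x r) b)) \<le> L0 * measure M (ball x r)"
      using measure_qball_pos[OF r, of x] by (simp add: pos_divide_le_eq)
    then show "(LINT y:ball x r|M. cmod (b y - mean M (ball x r) b)) \<le> (L0 + 1) * measure M (ball x r)"
      by (simp add: distrib_right add_increasing2)
  qed (use L0 in simp)
  then show ?thesis by blast
qed

theorem theorem1p1:
  fixes d :: "'a \<Rightarrow> 'a \<Rightarrow> real" and M :: "'a measure"
    and K\<^sub>0 \<theta> \<epsilon> \<beta> \<gamma> :: real and x\<^sub>0 :: 'a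
    and h :: "('a \<Rightarrow> complex) \<Rightarrow> complex" and b :: "'a \<Rightarrow> complex"
  assumes "rd_space d M K\<^sub>0 \<theta>"
    and "0 < \<epsilon>" "\<epsilon> \<le> \<theta>"
    and "0 < \<beta>" "\<beta> < \<epsilon>" "0 < \<gamma>" "\<gamma> < \<epsilon>"
    and "h \<in> hardy_1 d M K\<^sub>0 x\<^sub>0 \<epsilon> \<beta> \<gamma>"
    and "b \<in> BMO d M"
  shows "\<exists>P. is_product d M K\<^sub>0 x\<^sub>0 \<epsilon> \<beta> \<gamma> b h P \<and>
             P \<in> L1_plus_hardy_orlicz d M K\<^sub>0 x\<^sub>0 \<epsilon> \<beta> \<gamma> (log_weighted d M x\<^sub>0)"
proof -
  obtain A Q \<kappa> n V where "hom_space d M K\<^sub>0 \<theta> A Q \<kappa> n V"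
    using rd_space.hom_space_exists[OF assms(1)] by blast
  then interpret hom_space d M K\<^sub>0 \<theta> A Q \<kappa> n V .
  obtain L where "bmo_function d M K\<^sub>0 \<theta> A Q \<kappa> n V b L" using BMO_bmo_function[OF assms(9)] by blast
  then interpret bmo_function d M K\<^sub>0 \<theta> A Q \<kappa> n V b L .
  interpret product_setting d M K\<^sub>0 \<theta> A Q \<kappa> n V b L x\<^sub>0 \<epsilon> \<beta> \<gamma>
    by unfold_locales (use assms in auto)
  show ?thesis by (rule product_exists)
qed

end
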